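(* Let $N \geq 2$, $\frac{2(N+1)}{N-1} < p < 2^\ast$, and let $a, b \in L^\infty(\mathbb{R}^N)$ be $[0,1]^N$-periodic (i.e. $\mathbb{Z}^N$-periodic) with $0 \leq b(x) \leq p-1$ and $a(x) \geq a_0 > 0$ for a constant $a_0$. Let $a_-,b_-$ denote the essential infima and $a_+,b_+$ the essential suprema of $a$ and $b$. (a) If $2<p<4$ and $b_->0$, then for all $\mu,\nu>0$ every dual ground state of the functional $J_{\mu\nu}$ is fully nontrivial. (b) If $p\geq 4$ and $b_- > \frac{a_+}{a_-}\,2^{\frac{p-2}{2}} - 1$, then there exists $\delta>0$ with the property that, for all $\mu,\nu>0$ with $\left|\sqrt{\frac{\mu}{\nu}}-1\right|<\delta$, every dual ground state of $J_{\mu\nu}$ is fully nontrivial.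
   Context: All functions are real-valued unless stated otherwise. $2^\ast = \frac{2N}{N-2}$ for $N\geq 3$, $2^\ast = \infty$ for $N=2$; $p' = \frac{p}{p-1}$. The bar in $\bar u,\bar v,\bar s,\bar t$ is only notation for dual variables. Function $h$: let $f(x,s,t) = \frac{a(x)}{p}\left(|s|^p + 2b(x)|s|^{\frac p2}|t|^{\frac p2} + |t|^p\right)$ for $x\in\mathbb{R}^N$, $s,t\in\mathbb{R}$. For each $x$, $h(x,\cdot,\cdot)$ is the Legendre transform of $f(x,\cdot,\cdot)$: $h(x,\bar s,\bar t) = \sup_{s,t\in\mathbb{R}}\left(s\bar s + t\bar t - f(x,s,t)\right)$. Under the assumptions on $a,b,p$ it is finite and differentiable in $(\bar s,\bar t)$. Kernel: for $\lambda>0$, $\Psi_\lambda := \mathrm{Re}\,\Phi_\lambda$ where $\Phi_\lambda(x) = \frac{i}{4}\left(\frac{\lambda}{4\pi^2|x|^2}\right)^{\frac{N-2}{4}} H^{(1)}_{\frac{N-2}{2}}(\sqrt\lambda\,|x|)$ and $H^{(1)}_{\frac{N-2}{2}}$ is the Hankel function of the first kind. For $\frac{2(N+1)}{N-1}<p<2^\ast$, $g\mapsto \Psi_\lambda\ast g$ (defined on Schwartz functions) extends to a continuous linear operator $L^{p'}(\mathbb{R}^N)\to L^p(\mathbb{R}^N)$, again denoted $\Psi_\lambda\ast$ (known fact). Functional, for $\mu,\nu>0$: $J_{\mu\nu}: L^{p'}(\mathbb{R}^N)\times L^{p'}(\mathbb{R}^N)\to\mathbb{R}$, $$J_{\mu\nu}(\bar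 u,\bar v) = \int_{\mathbb{R}^N} h(x,\bar u,\bar v)\,dx - \frac12\int_{\mathbb{R}^N} \left(\bar u\,(\Psi_\mu\ast\bar u) + \bar v\,(\Psi_\nu\ast\bar v)\right)dx,$$ which is well defined and continuously Fréchet differentiable. Mountain pass level: $c_{\mu\nu} := \inf_{\gamma\in\Gamma_{\mu\nu}}\sup_{0\le t\le1}J_{\mu\nu}(\gamma(t))$ with $\Gamma_{\mu\nu} := \{\gamma\in C([0,1],L^{p'}(\mathbb{R}^N)\times L^{p'}(\mathbb{R}^N)) : \gamma(0)=0,\ J_{\mu\nu}(\gamma(1))<0\}$. A dual ground state of $J_{\mu\nu}$ is a critical point $(\bar u,\bar v)$ of $J_{\mu\nu}$ with $J_{\mu\nu}(\bar u,\bar v)=c_{\mu\nu}$. It is semitrivial if $\bar u=0$ or $\bar v=0$, and fully nontrivial if both $\bar u\neq0$ and $\bar v\neq0$. *)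

theory Defs
  imports "HOL-Analysis.Analysis" "HOL-Probability.Essential_Supremum"
begin

section \<open>Lebesgue spaces\<close>

text \<open>
  Elements of \<open>L\<^sup>q\<close> are represented by Borel functions. Classes modulo equality almost everywhere
  are not formed; instead every notion below (equality, vanishing, linearity of operators) is
  taken almost everywhere with respect to Lebesgue measure.
\<close>

definition Lq :: "real \<Rightarrow> ('a::euclidean_space \<Rightarrow> real) set" where
  "Lq q = {f \<in> borel_measurable lborel. integrable lborel (\<lambda>x. \<bar>f x\<bar> powr q)}"

definition Lq_norm :: "real \<Rightarrow> ('a::euclidean_space \<Rightarrow> real) \<Rightarrow> real" where
  "Lq_norm q f = (LINT x|lborel. \<bar>f x\<bar> powr q) powr (1 / q)"

definition L_infty :: "('a::euclidean_space \<Rightarrow> real) set" where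
  "L_infty = {f \<in> borel_measurable lborel. \<exists>C. AE x in lborel. \<bar>f x\<bar> \<le> C}"

definition ess_sup :: "('a::euclidean_space \<Rightarrow> real) \<Rightarrow> real" where
  "ess_sup f = real_of_ereal (esssup lborel (\<lambda>x. ereal (f x)))"

definition ess_inf :: "('a::euclidean_space \<Rightarrow> real) \<Rightarrow> real" where
  "ess_inf f = - ess_sup (\<lambda>x. - f x)"

definition conj_exp :: "real \<Rightarrow> real" where
  "conj_exp p = p / (p - 1)"

definition crit_exp :: "nat \<Rightarrow> ereal" where
  "crit_exp N = (if N \<ge> 3 then ereal (2 * real N / (real N - 2)) else \<infinity>)"

definition Z_periodic :: "(real ^ 'n \<Rightarrow> real) \<Rightarrow> bool" where
  "Z_periodic f \<longleftrightarrow> (\<forall>k. (\<forall>i. k $ i \<in> \<int>) \<longrightarrow> (AE x in lborel. f (x + k) = f x))"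


section \<open>Schwartz functions\<close>

text \<open>Iterated partial derivatives along a list of coordinate directions.\<close>

primrec partials :: "'n::finite list \<Rightarrow> (real ^ 'n \<Rightarrow> real) \<Rightarrow> (real ^ 'n \<Rightarrow> real)" where
  "partials [] f = f"
| "partials (i # is) f = (\<lambda>x. frechet_derivative (partials is f) (at x) (axis i 1))"

text \<open>Differentiability of all iterated partial derivatives amounts to smoothness.\<close>

definition schwartz :: "(real ^ 'n \<Rightarrow> real) \<Rightarrow> bool" where
  "schwartz f \<longleftrightarrow> (\<forall>is. (\<forall>x. partials is f differentiable at x) \<and>
     (\<forall>k::nat. \<exists>C. \<forall>x. norm x ^ k * \<bar>partials is f x\<bar> \<le> C))"


section \<open>The Helmholtz kernel\<close>

text \<open>Bessel functions of real order \<open>\<nu>\<close> at positive real arguments.\<close>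

definition bessel_J :: "real \<Rightarrow> real \<Rightarrow> real" where
  "bessel_J \<nu> z = (\<Sum>k. (-1) ^ k / fact k * rGamma (\<nu> + real k + 1) * (z / 2) powr (\<nu> + 2 * real k))"

definition bessel_Y :: "real \<Rightarrow> real \<Rightarrow> real" where
  "bessel_Y \<nu> z =
     (let Y = (\<lambda>\<alpha>. (bessel_J \<alpha> z * cos (\<alpha> * pi) - bessel_J (- \<alpha>) z) / sin (\<alpha> * pi))
      in if \<nu> \<in> \<int> then Lim (at \<nu>) Y else Y \<nu>)"

definition hankel1 :: "real \<Rightarrow> real \<Rightarrow> complex" where
  "hankel1 \<nu> z = complex_of_real (bessel_J \<nu> z) + \<i> * complex_of_real (bessel_Y \<nu> z)"

definition Phi :: "real \<Rightarrow> real ^ 'n \<Rightarrow> complex" where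
  "Phi l x = \<i> / 4
     * complex_of_real ((l / (4 * pi\<^sup>2 * (norm x)\<^sup>2)) powr ((real CARD('n) - 2) / 4))
     * hankel1 ((real CARD('n) - 2) / 2) (sqrt l * norm x)"

definition Psi :: "real \<Rightarrow> real ^ 'n \<Rightarrow> real" where
  "Psi l x = Re (Phi l x)"

text \<open>\<open>T\<close> is a continuous linear extension of \<open>g \<mapsto> \<Psi> \<star> g\<close> from Schwartz functions to
  an operator from \<open>L\<^sup>p\<^sup>'\<close> to \<open>L\<^sup>p\<close>.\<close>

definition conv_extension ::
    "real \<Rightarrow> (real ^ 'n \<Rightarrow> real) \<Rightarrow> ((real ^ 'n \<Rightarrow> real) \<Rightarrow> (real ^ 'n \<Rightarrow> real)) \<Rightarrow> bool" where
  "conv_extension p K T \<longleftrightarrow>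
     (\<forall>g\<in>Lq (conj_exp p). T g \<in> Lq p) \<and>
     (\<forall>f\<in>Lq (conj_exp p). \<forall>g\<in>Lq (conj_exp p).
        AE x in lborel. T (\<lambda>y. f y + g y) x = T f x + T g x) \<and>
     (\<forall>c. \<forall>g\<in>Lq (conj_exp p). AE x in lborel. T (\<lambda>y. c * g y) x = c * T g x) \<and>
     (\<exists>C. \<forall>g\<in>Lq (conj_exp p). Lq_norm p (T g) \<le> C * Lq_norm (conj_exp p) g) \<and>
     (\<forall>g. schwartz g \<longrightarrow> (AE x in lborel. T g x = (LINT y|lborel. K (x - y) * g y)))"

text \<open>By density of the Schwartz functions, \<open>T g\<close> is determined almost everywhere for
  \<open>g \<in> L\<^sup>p\<^sup>'\<close>, so the choice below is immaterial. In the range of exponents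
  considered an extension exists; elsewhere \<open>Psi_op\<close> is a dummy, namely \<open>0\<close>.\<close>

definition Psi_op :: "real \<Rightarrow> real \<Rightarrow> (real ^ 'n \<Rightarrow> real) \<Rightarrow> (real ^ 'n \<Rightarrow> real)" where
  "Psi_op p l = (if \<exists>T. conv_extension p (Psi l :: real ^ 'n \<Rightarrow> real) T
                 then SOME T. conv_extension p (Psi l) T else (\<lambda>g x. 0))"


section \<open>The dual functional\<close>

definition f_nl ::
    "(real ^ 'n \<Rightarrow> real) \<Rightarrow> (real ^ 'n \<Rightarrow> real) \<Rightarrow> real \<Rightarrow> real ^ 'n \<Rightarrow> real \<Rightarrow> real \<Rightarrow> real" where
  "f_nl a b p x s t = a x / p *
     (\<bar>s\<bar> powr p + 2 * b x * \<bar>s\<bar> powr (p / 2) * \<bar>t\<bar> powr (p / 2) + \<bar>t\<bar> powr p)"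

definition h_nl ::
    "(real ^ 'n \<Rightarrow> real) \<Rightarrow> (real ^ 'n \<Rightarrow> real) \<Rightarrow> real \<Rightarrow> real ^ 'n \<Rightarrow> real \<Rightarrow> real \<Rightarrow> real" where
  "h_nl a b p x s' t' = (SUP (s, t)\<in>UNIV. s * s' + t * t' - f_nl a b p x s t)"

type_synonym 'n field_pair = "(real ^ 'n \<Rightarrow> real) \<times> (real ^ 'n \<Rightarrow> real)"

definition Lq_pair :: "real \<Rightarrow> 'n::finite field_pair set" where
  "Lq_pair q = Lq q \<times> Lq q"

definition pair_norm :: "real \<Rightarrow> 'n::finite field_pair \<Rightarrow> real" where
  "pair_norm q w = Lq_norm q (fst w) + Lq_norm q (snd w)"

definition pair_add :: "'n::finite field_pair \<Rightarrow> 'n field_pair \<Rightarrow> 'n field_pair" where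
  "pair_add w d = ((\<lambda>x. fst w x + fst d x), (\<lambda>x. snd w x + snd d x))"

definition pair_scale :: "real \<Rightarrow> 'n::finite field_pair \<Rightarrow> 'n field_pair" where
  "pair_scale c w = ((\<lambda>x. c * fst w x), (\<lambda>x. c * snd w x))"

definition dual_J ::
    "(real ^ 'n \<Rightarrow> real) \<Rightarrow> (real ^ 'n \<Rightarrow> real) \<Rightarrow> real \<Rightarrow> real \<Rightarrow> real \<Rightarrow> 'n::finite field_pair \<Rightarrow> real" where
  "dual_J a b p \<mu> \<nu> w =
     (LINT x|lborel. h_nl a b p x (fst w x) (snd w x))
     - 1 / 2 * (LINT x|lborel. fst w x * Psi_op p \<mu> (fst w) x + snd w x * Psi_op p \<nu> (snd w) x)"

text \<open>\<open>D\<close> is the Frechet derivative of \<open>F\<close> at \<open>w\<close> on \<open>L\<^sup>q \<times> L\<^sup>q\<close>.\<close>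

definition has_frechet_deriv ::
    "real \<Rightarrow> ('n::finite field_pair \<Rightarrow> real) \<Rightarrow> ('n field_pair \<Rightarrow> real) \<Rightarrow> 'n field_pair \<Rightarrow> bool" where
  "has_frechet_deriv q F D w \<longleftrightarrow>
     (\<forall>d\<in>Lq_pair q. \<forall>e\<in>Lq_pair q. D (pair_add d e) = D d + D e) \<and>
     (\<forall>c. \<forall>d\<in>Lq_pair q. D (pair_scale c d) = c * D d) \<and>
     (\<exists>C. \<forall>d\<in>Lq_pair q. \<bar>D d\<bar> \<le> C * pair_norm q d) \<and>
     (\<forall>\<epsilon>>0. \<exists>\<delta>>0. \<forall>d\<in>Lq_pair q. pair_norm q d < \<delta> \<longrightarrow>
        \<bar>F (pair_add w d) - F w - D d\<bar> \<le> \<epsilon> * pair_norm q d)"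

definition critical_point ::
    "real \<Rightarrow> ('n::finite field_pair \<Rightarrow> real) \<Rightarrow> 'n field_pair \<Rightarrow> bool" where
  "critical_point q F w \<longleftrightarrow> w \<in> Lq_pair q \<and> has_frechet_deriv q F (\<lambda>d. 0) w"

text \<open>Continuous paths in \<open>L\<^sup>q \<times> L\<^sup>q\<close> over \<open>[0,1]\<close>, extended arbitrarily to the real line.\<close>

definition continuous_path :: "real \<Rightarrow> (real \<Rightarrow> 'n::finite field_pair) \<Rightarrow> bool" where
  "continuous_path q \<gamma> \<longleftrightarrow>
     (\<forall>t\<in>{0..1}. \<gamma> t \<in> Lq_pair q) \<and>
     (\<forall>t\<in>{0..1}. ((\<lambda>s. pair_norm q (pair_add (\<gamma> s) (pair_scale (-1) (\<gamma> t)))) \<longlongrightarrow> 0)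
        (at t within {0..1}))"

definition mp_paths ::
    "(real ^ 'n \<Rightarrow> real) \<Rightarrow> (real ^ 'n \<Rightarrow> real) \<Rightarrow> real \<Rightarrow> real \<Rightarrow> real \<Rightarrow> (real \<Rightarrow> 'n::finite field_pair) set" where
  "mp_paths a b p \<mu> \<nu> = {\<gamma>. continuous_path (conj_exp p) \<gamma> \<and>
     (AE x in lborel. fst (\<gamma> 0) x = 0) \<and> (AE x in lborel. snd (\<gamma> 0) x = 0) \<and>
     dual_J a b p \<mu> \<nu> (\<gamma> 1) < 0}"

definition mp_level ::
    "(real ^ 'n \<Rightarrow> real) \<Rightarrow> (real ^ 'n::finite \<Rightarrow> real) \<Rightarrow> real \<Rightarrow> real \<Rightarrow> real \<Rightarrow> ereal" where
  "mp_level a b p \<mu> \<nu> = (INF \<gamma>\<in>mp_paths a b p \<mu> \<nu>. SUP t\<in>{0..1}. ereal (dual_J a b p \<mu> \<nu> (\<gamma> t)))"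

definition dual_ground_state ::
    "(real ^ 'n \<Rightarrow> real) \<Rightarrow> (real ^ 'n \<Rightarrow> real) \<Rightarrow> real \<Rightarrow> real \<Rightarrow> real \<Rightarrow> 'n::finite field_pair \<Rightarrow> bool" where
  "dual_ground_state a b p \<mu> \<nu> w \<longleftrightarrow>
     critical_point (conj_exp p) (dual_J a b p \<mu> \<nu>) w \<and>
     ereal (dual_J a b p \<mu> \<nu> w) = mp_level a b p \<mu> \<nu>"

definition fully_nontrivial :: "'n::finite field_pair \<Rightarrow> bool" where
  "fully_nontrivial w \<longleftrightarrow>
     \<not> (AE x in lborel. fst w x = 0) \<and> \<not> (AE x in lborel. snd w x = 0)"

end

theory Submission
  imports Defs
begin

text \<open>
  Along a ray \<open>t w\<close> the functional is \<open>t\<^sup>q A(w) - t\<^sup>2 B(w) / 2\<close> with \<open>q = p'\<close>, where \<open>A\<close> is the integral of \<open>h\<close>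
  and \<open>B\<close> the quadratic form of the two Helmholtz operators. Since the mountain pass level is positive and bounded
  by the maximum along every ray with \<open>B > 0\<close>, a dual ground state minimises \<open>A\<^sup>2 / B\<^sup>q\<close>. So it suffices to
  lower this quotient at a semitrivial pair \<open>(u, 0)\<close>.

  For \<open>p < 4\<close> take \<open>(u, e 1\<^sub>E)\<close>, with \<open>E\<close> of small diameter contained in \<open>{\<bar>u\<bar> \<ge> \<eta>}\<close>. The kernel \<open>\<Psi>\<close> is positive
  and integrable near its singularity, so \<open>B\<close> grows by a multiple of \<open>e\<^sup>2\<close>, whereas the coupling term in \<open>f\<close>
  keeps the growth of \<open>A\<close> below a multiple of \<open>e\<^bsup>p/(p-2)\<^esup>\<close>, and \<open>p/(p-2) > 2\<close>.

  For \<open>p \<ge> 4\<close> compare with the diagonal pair \<open>(v, v)\<close>, where \<open>v\<close> is a dilation of a nearly optimal function for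
  the form of frequency \<open>1\<close>. For \<open>0 \<le> b \<le> p - 1\<close> the transform \<open>h\<close> on the diagonal is computed by diagonal maximisers.
\<close>

section \<open>Lebesgue spaces\<close>

text \<open>For p >= 4 the exponent p/(p-2) is at most 2, so a small second component no longer
  guarantees a gain and a competitor far from the semitrivial pair is used. On the diagonal pair the
  coefficient of the potential is 2 \<open>kap p (a0 (1 + b0))\<close> instead of
  \<open>kap p a1\<close>, while the form nearly doubles. The quotient drops if 4
  \<open>kap p (a0 (1 + b0))\<close>^2 < 2^q \<open>kap p a1\<close>^2, and this unwinds to the
  factor 2^((p-2)/2) of the hypothesis on b.

  The main obstacle is that the Helmholtz operators are known only as extensions from Schwartz
  functions. A ground state has form q A > 0, which the dummy operator 0 cannot produce, so an
  extension exists for one of its frequencies; dilation carries it to all others. Values on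
  indicators are recovered by density, after truncating the kernel inside a small box. Dilation also
  normalises the frequency to 1, which makes \<delta> uniform in \<mu> and \<nu>. The strict
  inequality in the hypothesis leaves room for a nearly optimal function in place of a maximiser.

  The form has no cross terms between the two components, so filling the vanishing component only
  adds its own form.\<close>

lemma LqD:
  assumes "f \<in> Lq q"
  shows "f \<in> borel_measurable borel" "integrable lborel (\<lambda>x. \<bar>f x\<bar> powr q)"
  using assms by (auto simp: Lq_def)

lemma Lq_dominated:
  assumes "g \<in> Lq q" "f \<in> borel_measurable borel" "\<And>x. \<bar>f x\<bar> \<le> \<bar>g x\<bar>" "q > 0"
  shows "f \<in> Lq q"
proof -
  have [measurable]: "f \<in> borel_measurable borel" by fact
  have "integrable lborel (\<lambda>x. \<bar>f x\<bar> powr q)"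
    by (rule Bochner_Integration.integrable_bound[OF LqD(2)[OF assms(1)]])
       (use assms in \<open>auto intro!: powr_mono2\<close>)
  then show ?thesis by (simp add: Lq_def)
qed

lemma abs_add_powr_le:
  fixes a b q :: real
  assumes "q > 0"
  shows "\<bar>a + b\<bar> powr q \<le> 2 powr q * (\<bar>a\<bar> powr q + \<bar>b\<bar> powr q)"
proof -
  have "\<bar>a + b\<bar> powr q \<le> (2 * max \<bar>a\<bar> \<bar>b\<bar>) powr q"
    using assms by (intro powr_mono2) auto
  also have "\<dots> = 2 powr q * max \<bar>a\<bar> \<bar>b\<bar> powr q"
    by (simp add: powr_mult)
  also have "\<dots> \<le> 2 powr q * (\<bar>a\<bar> powr q + \<bar>b\<bar> powr q)"
    by (intro mult_left_mono) (auto simp: max_def)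
  finally show ?thesis .
qed

lemma Lq_add:
  assumes "f \<in> Lq q" "g \<in> Lq q" "q > 0"
  shows "(\<lambda>x. f x + g x) \<in> Lq q"
proof -
  have [measurable]: "f \<in> borel_measurable borel" "g \<in> borel_measurable borel"
    using LqD assms by auto
  have "integrable lborel (\<lambda>x. \<bar>f x + g x\<bar> powr q)"
  proof (rule Bochner_Integration.integrable_bound)
    show "integrable lborel (\<lambda>x. 2 powr q * (\<bar>f x\<bar> powr q + \<bar>g x\<bar> powr q))"
      using LqD assms by (intro integrable_mult_right Bochner_Integration.integrable_add) auto
    show "AE x in lborel. norm (\<bar>f x + g x\<bar> powr q) \<le> norm (2 powr q * (\<bar>f x\<bar> powr q + \<bar>g x\<bar> powr q))"
      using abs_add_powr_le[OF assms(3)] by (auto simp: abs_mult)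
  qed auto
  then show ?thesis by (simp add: Lq_def)
qed

lemma Lq_scale:
  assumes "f \<in> Lq q"
  shows "(\<lambda>x. c * f x) \<in> Lq q"
proof -
  have [measurable]: "f \<in> borel_measurable borel"
    using LqD assms by auto
  have "integrable lborel (\<lambda>x. \<bar>c\<bar> powr q * \<bar>f x\<bar> powr q)"
    using LqD[OF assms] by auto
  then show ?thesis by (simp add: Lq_def abs_mult powr_mult)
qed

lemma Lq_diff:
  assumes "f \<in> Lq q" "g \<in> Lq q" "q > 0"
  shows "(\<lambda>x. f x - g x) \<in> Lq q"
  using Lq_add[OF assms(1) Lq_scale[OF assms(2), of "-1"] assms(3)] by simp

lemma Lq_indicator:
  assumes "A \<in> sets borel" "emeasure lborel A < \<infinity>"
  shows "indicator A \<in> Lq q"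
proof -
  have *: "(\<lambda>x. \<bar>indicator A x\<bar> powr q) = (indicator A :: _ \<Rightarrow> real)"
    by (auto simp: indicator_def)
  show ?thesis unfolding Lq_def using assms * by (auto intro!: integrable_real_indicator)
qed

lemma Lq_zero [simp]: "(\<lambda>x. 0) \<in> Lq q"
  by (simp add: Lq_def)

lemma Lq_norm_nonneg [simp]: "Lq_norm q f \<ge> 0"
  by (simp add: Lq_norm_def)

lemma Lq_norm_powr:
  assumes "q > 0"
  shows "Lq_norm q f powr q = (LINT x|lborel. \<bar>f x\<bar> powr q)"
  using assms by (simp add: Lq_norm_def powr_powr)

lemma Lq_norm_scale:
  assumes "q > 0"
  shows "Lq_norm q (\<lambda>x. c * f x) = \<bar>c\<bar> * Lq_norm q f"
  using assms by (simp add: Lq_norm_def abs_mult powr_mult powr_powr)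

lemma Lq_norm_minus:
  "Lq_norm q (\<lambda>x. - f x) = Lq_norm q f"
  by (simp add: Lq_norm_def)

lemma Lq_norm_diff_commute:
  "Lq_norm q (\<lambda>x. f x - g x) = Lq_norm q (\<lambda>x. g x - f x)"
  by (simp add: Lq_norm_def abs_minus_commute)

lemma Lq_norm_zero: "q > 0 \<Longrightarrow> Lq_norm q (\<lambda>x. 0) = 0"
  by (simp add: Lq_norm_def)

lemma Lq_norm_cong_AE:
  assumes "f \<in> borel_measurable borel" "g \<in> borel_measurable borel" "AE x in lborel. f x = g x"
  shows "Lq_norm q f = Lq_norm q g"
proof -
  have [measurable]: "f \<in> borel_measurable borel" "g \<in> borel_measurable borel"
    by fact+
  have "(LINT x|lborel. \<bar>f x\<bar> powr q) = (LINT x|lborel. \<bar>g x\<bar> powr q)"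
    by (rule integral_cong_AE) (use assms(3) in auto)
  then show ?thesis by (simp add: Lq_norm_def)
qed

lemma Lq_norm_eq_0_iff:
  assumes "f \<in> Lq q" "q > 0"
  shows "Lq_norm q f = 0 \<longleftrightarrow> (AE x in lborel. f x = 0)"
proof -
  have "Lq_norm q f = 0 \<longleftrightarrow> (LINT x|lborel. \<bar>f x\<bar> powr q) = 0"
    using assms by (auto simp: Lq_norm_def)
  also have "\<dots> \<longleftrightarrow> (AE x in lborel. \<bar>f x\<bar> powr q = 0)"
    by (rule integral_nonneg_eq_0_iff_AE) (use LqD[OF assms(1)] in auto)
  finally show ?thesis by simp
qed

text \<open>Young's inequality applied to f and g divided by their norms; after integration the
  factor 1/q + 1/p = 1 remains. A vanishing norm makes the product zero almost everywhere.\<close>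

lemma Hoelder:
  assumes "p > 1" "q > 1" "1 / p + 1 / q = 1" and f: "f \<in> Lq q" and g: "g \<in> Lq p"
  shows "integrable lborel (\<lambda>x. f x * g x)"
    and "\<bar>LINT x|lborel. f x * g x\<bar> \<le> Lq_norm q f * Lq_norm p g"
proof -
  have [measurable]: "f \<in> borel_measurable borel" "g \<in> borel_measurable borel"
    using LqD f g by auto
  have pq: "p > 0" "q > 0" using assms by auto
  have ptw: "\<bar>u * v\<bar> \<le> \<bar>u\<bar> powr q / q + \<bar>v\<bar> powr p / p" for u v :: real
    using Youngs_inequality[of q p "\<bar>u\<bar>" "\<bar>v\<bar>"] assms by (simp add: abs_mult add.commute)
  have I: "integrable lborel (\<lambda>x. \<bar>f x\<bar> powr q / q + \<bar>g x\<bar> powr p / p)"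
    using LqD[OF f] LqD[OF g] by auto
  show int: "integrable lborel (\<lambda>x. f x * g x)"
    by (rule Bochner_Integration.integrable_bound[OF I]) (use pq ptw in \<open>auto simp: abs_mult\<close>)
  let ?F = "Lq_norm q f" and ?G = "Lq_norm p g"
  show "\<bar>LINT x|lborel. f x * g x\<bar> \<le> ?F * ?G"
  proof (cases "?F = 0 \<or> ?G = 0")
    case True
    then have "AE x in lborel. f x * g x = 0"
      using Lq_norm_eq_0_iff[OF f pq(2)] Lq_norm_eq_0_iff[OF g pq(1)] by auto
    then have "(LINT x|lborel. f x * g x) = 0"
      by (rule integral_eq_zero_AE)
    then show ?thesis by simp
  next
    case False
    then have pos: "?F > 0" "?G > 0" using Lq_norm_nonneg[of q f] Lq_norm_nonneg[of p g] by linarith+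
    have bd: "\<bar>f x * g x\<bar> \<le> ?F * ?G * (\<bar>f x\<bar> powr q / (q * ?F powr q) + \<bar>g x\<bar> powr p / (p * ?G powr p))" for x
    proof -
      have "\<bar>f x * g x\<bar> = ?F * ?G * \<bar>(f x / ?F) * (g x / ?G)\<bar>"
        using pos by (simp add: abs_mult)
      also have "\<dots> \<le> ?F * ?G * (\<bar>f x / ?F\<bar> powr q / q + \<bar>g x / ?G\<bar> powr p / p)"
        using pos by (intro mult_left_mono ptw) auto
      also have "\<dots> = ?F * ?G * (\<bar>f x\<bar> powr q / (q * ?F powr q) + \<bar>g x\<bar> powr p / (p * ?G powr p))"
        using pos by (simp add: powr_divide mult.commute)
      finally show ?thesis .
    qed
    have "\<bar>LINT x|lborel. f x * g x\<bar> \<le> (LINT x|lborel. \<bar>f x * g x\<bar>)"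
      by (rule integral_abs_bound)
    also have "\<dots> \<le> (LINT x|lborel. ?F * ?G * (\<bar>f x\<bar> powr q / (q * ?F powr q) + \<bar>g x\<bar> powr p / (p * ?G powr p)))"
      by (rule integral_mono) (use int bd LqD[OF f] LqD[OF g] in auto)
    also have "\<dots> = ?F * ?G * (?F powr q / (q * ?F powr q) + ?G powr p / (p * ?G powr p))"
      using LqD[OF f] LqD[OF g] by (simp add: Lq_norm_powr pq)
    also have "\<dots> = ?F * ?G * (1 / q + 1 / p)"
      using pos by simp
    finally show ?thesis using assms(3) by (simp add: add.commute)
  qed
qed

lemma convex_on_abs_powr:
  fixes l u v q :: real
  assumes "q \<ge> 1" "0 \<le> l" "l \<le> 1"
  shows "\<bar>l * u + (1 - l) * v\<bar> powr q \<le> l * \<bar>u\<bar> powr q + (1 - l) * \<bar>v\<bar> powr q"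
proof -
  have "\<bar>l * u + (1 - l) * v\<bar> \<le> l * \<bar>u\<bar> + (1 - l) * \<bar>v\<bar>"
    using assms abs_triangle_ineq[of "l * u" "(1 - l) * v"] by (simp add: abs_mult)
  then have "\<bar>l * u + (1 - l) * v\<bar> powr q \<le> (l * \<bar>u\<bar> + (1 - l) * \<bar>v\<bar>) powr q"
    using assms by (intro powr_mono2) auto
  also have "\<dots> \<le> l * \<bar>u\<bar> powr q + (1 - l) * \<bar>v\<bar> powr q"
  proof -
    \<comment> \<open>If u or v is 0, convexity reduces to m^q <= m for 0 <= m <= 1; these cases are
      split off from the convexity of the power on positive numbers.\<close>
    have *: "(m * w) powr q \<le> m * w powr q" if "0 \<le> m" "m \<le> 1" "0 \<le> w" for m w :: real
    proof -
      have "m powr q \<le> m"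
        using that assms(1) powr_mono'[of 1 q m] by (cases "m = 0") auto
      then show ?thesis using that by (simp add: powr_mult mult_right_mono)
    qed
    show ?thesis
    proof (cases "u = 0 \<or> v = 0")
      case True
      then show ?thesis
        using *[of l "\<bar>u\<bar>"] *[of "1 - l" "\<bar>v\<bar>"] assms by auto
    next
      case False
      then show ?thesis
        using convex_onD[OF powr_convex[OF assms(1)], of "1 - l" "\<bar>u\<bar>" "\<bar>v\<bar>"] assms by simp
    qed
  qed
  finally show ?thesis .
qed

text \<open>Minkowski's inequality from convexity alone: f + g is (F + G) times the convex
  combination of f / F and g / G with weights F / (F + G) and G / (F + G).\<close>

lemma Lq_norm_triangle:
  assumes "q \<ge> 1" and f: "f \<in> Lq q" and g: "g \<in> Lq q"
  shows "Lq_norm q (\<lambda>x. f x + g x) \<le> Lq_norm q f + Lq_norm q g"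
proof (rule field_le_epsilon)
  fix e :: real assume e: "e > 0"
  \<comment> \<open>The padding by e / 2 makes F and G positive, so division by them is legitimate
    even for functions of norm 0.\<close>
  define F where "F = Lq_norm q f + e / 2"
  define G where "G = Lq_norm q g + e / 2"
  have F: "F > 0" "Lq_norm q f \<le> F" and G: "G > 0" "Lq_norm q g \<le> G"
    using e Lq_norm_nonneg[of q f] Lq_norm_nonneg[of q g] by (auto simp: F_def G_def intro: add_nonneg_pos)
  have q: "q > 0" using assms by auto
  define l where "l = F / (F + G)"
  have l: "0 \<le> l" "l \<le> 1" "1 - l = G / (F + G)" using F G by (auto simp: l_def field_simps)
  have ptw: "\<bar>f x + g x\<bar> powr q \<le> (F + G) powr q * (l / F powr q * \<bar>f x\<bar> powr q + (1 - l) / G powr q * \<bar>g x\<bar> powr q)" for x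
  proof -
    have "f x + g x = (F + G) * (l * (f x / F) + (1 - l) * (g x / G))"
    proof -
      have "(F + G) * (l * (f x / F) + (1 - l) * (g x / G)) = (F + G) * l / F * f x + (F + G) * (1 - l) / G * g x"
        by (simp add: algebra_simps)
      also have "\<dots> = f x + g x"
        using F G unfolding l(3) unfolding l_def by simp
      finally show ?thesis by simp
    qed
    then have "\<bar>f x + g x\<bar> powr q = (F + G) powr q * \<bar>l * (f x / F) + (1 - l) * (g x / G)\<bar> powr q"
      using F G by (simp add: abs_mult powr_mult)
    also have "\<dots> \<le> (F + G) powr q * (l * \<bar>f x / F\<bar> powr q + (1 - l) * \<bar>g x / G\<bar> powr q)"
      by (intro mult_left_mono convex_on_abs_powr assms(1) l(1,2)) auto
    finally show ?thesis using F G by (simp add: powr_divide mult_ac)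
  qed
  have If: "(LINT x|lborel. \<bar>f x\<bar> powr q) \<le> F powr q"
    unfolding Lq_norm_powr[OF q, symmetric] using F q by (intro powr_mono2) auto
  have Ig: "(LINT x|lborel. \<bar>g x\<bar> powr q) \<le> G powr q"
    unfolding Lq_norm_powr[OF q, symmetric] using G q by (intro powr_mono2) auto
  have "(LINT x|lborel. \<bar>f x + g x\<bar> powr q) \<le> (LINT x|lborel. (F + G) powr q * (l / F powr q * \<bar>f x\<bar> powr q + (1 - l) / G powr q * \<bar>g x\<bar> powr q))"
    by (rule integral_mono) (use ptw LqD[OF f] LqD[OF g] LqD[OF Lq_add[OF f g q]] in auto)
  also have "\<dots> = (F + G) powr q * (l / F powr q * (LINT x|lborel. \<bar>f x\<bar> powr q) + (1 - l) / G powr q * (LINT x|lborel. \<bar>g x\<bar> powr q))"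
    using LqD[OF f] LqD[OF g] by simp
  also have "\<dots> \<le> (F + G) powr q * (l / F powr q * F powr q + (1 - l) / G powr q * G powr q)"
    using l(1,2) by (intro mult_left_mono add_mono If Ig) auto
  also have "\<dots> = (F + G) powr q"
    using F G by simp
  finally have "Lq_norm q (\<lambda>x. f x + g x) powr q \<le> (F + G) powr q"
    by (simp add: Lq_norm_powr[OF q])
  then have "Lq_norm q (\<lambda>x. f x + g x) \<le> F + G"
    using F G q by (smt (verit) powr_less_mono2 Lq_norm_nonneg)
  then show "Lq_norm q (\<lambda>x. f x + g x) \<le> Lq_norm q f + Lq_norm q g + e"
    by (simp add: F_def G_def)
qed

lemma Lq_norm_triangle_diff:
  assumes "q \<ge> 1" and "f \<in> Lq q" and "g \<in> Lq q"
  shows "Lq_norm q (\<lambda>x. f x - g x) \<le> Lq_norm q f + Lq_norm q g"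
  using Lq_norm_triangle[OF assms(1,2) Lq_scale[OF assms(3), of "-1"]] by (simp add: Lq_norm_minus)

lemma Lq_norm_reverse_triangle:
  assumes "q \<ge> 1" and f: "f \<in> Lq q" and g: "g \<in> Lq q"
  shows "\<bar>Lq_norm q f - Lq_norm q g\<bar> \<le> Lq_norm q (\<lambda>x. f x - g x)"
proof -
  have "q > 0" using assms by auto
  have "Lq_norm q f \<le> Lq_norm q (\<lambda>x. f x - g x) + Lq_norm q g"
    using Lq_norm_triangle[OF assms(1) Lq_diff[OF f g \<open>q > 0\<close>] g] by simp
  moreover have "Lq_norm q g \<le> Lq_norm q (\<lambda>x. g x - f x) + Lq_norm q f"
    using Lq_norm_triangle[OF assms(1) Lq_diff[OF g f \<open>q > 0\<close>] f] by simp
  ultimately show ?thesis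
    using Lq_norm_diff_commute[of q f g] by auto
qed

section \<open>Convergence in L^q and bounded operators\<close>

lemma Lq_dominated_convergence:
  fixes g :: "'a::euclidean_space \<Rightarrow> real"
  assumes "q > 0" and meas: "\<And>k::nat. G k \<in> borel_measurable borel" and g: "g \<in> borel_measurable borel"
    and "d \<in> Lq q" and dom: "\<And>k x. \<bar>G k x\<bar> \<le> \<bar>d x\<bar>"
    and lim: "AE x in lborel. (\<lambda>k. G k x) \<longlonglongrightarrow> g x"
  shows "(\<lambda>k. Lq_norm q (\<lambda>x. G k x - g x)) \<longlonglongrightarrow> 0"
proof -
  have [measurable]: "\<And>k::nat. G k \<in> borel_measurable borel" "g \<in> borel_measurable borel" by fact+
  have "(\<lambda>k. LINT x|lborel. \<bar>G k x - g x\<bar> powr q) \<longlonglongrightarrow> (LINT x|(lborel::'a measure). 0)"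
  proof (rule integral_dominated_convergence)
    show "integrable lborel (\<lambda>x. 2 powr q * \<bar>d x\<bar> powr q)"
      using LqD[OF assms(4)] by auto
    show "AE x in lborel. (\<lambda>k. \<bar>G k x - g x\<bar> powr q) \<longlonglongrightarrow> 0"
      using lim
    proof (rule AE_mp, intro AE_I2 impI)
      fix x assume "(\<lambda>k. G k x) \<longlonglongrightarrow> g x"
      then have "(\<lambda>k. \<bar>G k x - g x\<bar>) \<longlonglongrightarrow> 0"
        using LIM_zero tendsto_rabs_zero by blast
      then show "(\<lambda>k. \<bar>G k x - g x\<bar> powr q) \<longlonglongrightarrow> 0"
        using \<open>q > 0\<close> by (intro tendsto_zero_powrI[where b=q]) auto
    qed
    show "AE x in lborel. norm (\<bar>G k x - g x\<bar> powr q) \<le> 2 powr q * \<bar>d x\<bar> powr q" for k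
      using lim
    proof (rule AE_mp, intro AE_I2 impI)
      fix x assume "(\<lambda>k. G k x) \<longlonglongrightarrow> g x"
      then have "(\<lambda>k. \<bar>G k x\<bar>) \<longlonglongrightarrow> \<bar>g x\<bar>"
        by (rule tendsto_rabs)
      then have "\<bar>g x\<bar> \<le> \<bar>d x\<bar>"
        by (rule LIMSEQ_le_const2) (use dom in auto)
      then have "\<bar>G k x - g x\<bar> \<le> 2 * \<bar>d x\<bar>"
        using dom[of k x] by linarith
      then have "\<bar>G k x - g x\<bar> powr q \<le> (2 * \<bar>d x\<bar>) powr q"
        using \<open>q > 0\<close> by (intro powr_mono2) auto
      then show "norm (\<bar>G k x - g x\<bar> powr q) \<le> 2 powr q * \<bar>d x\<bar> powr q"
        by (simp add: powr_mult)
    qed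
  qed auto
  then have "(\<lambda>k. LINT x|lborel. \<bar>G k x - g x\<bar> powr q) \<longlonglongrightarrow> 0"
    by simp
  then show ?thesis unfolding Lq_norm_def
    using \<open>q > 0\<close> by (intro tendsto_zero_powrI[where b="1/q"]) auto
qed

lemma Lq_norm_tendsto_AE_subseq:
  assumes "q > 0" and "\<And>k::nat. G k \<in> Lq q" and lim: "(\<lambda>k. Lq_norm q (G k)) \<longlonglongrightarrow> 0"
  shows "\<exists>r. strict_mono r \<and> (AE x in lborel. (\<lambda>k. G (r k) x) \<longlonglongrightarrow> 0)"
proof -
  have "(\<lambda>k. Lq_norm q (G k) powr q) \<longlonglongrightarrow> 0"
    using \<open>q > 0\<close> by (intro tendsto_zero_powrI[where b=q] lim) auto
  then have "(\<lambda>k. LINT x|lborel. norm (\<bar>G k x\<bar> powr q)) \<longlonglongrightarrow> 0"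
    using \<open>q > 0\<close> by (simp add: Lq_norm_powr)
  from tendsto_L1_AE_subseq[OF _ this] obtain r where r: "strict_mono r"
     "AE x in lborel. (\<lambda>k. \<bar>G (r k) x\<bar> powr q) \<longlonglongrightarrow> 0"
    using LqD[OF assms(2)] by blast
  have "AE x in lborel. (\<lambda>k. G (r k) x) \<longlonglongrightarrow> 0"
    using r(2)
  proof (rule AE_mp, intro AE_I2 impI)
    fix x assume "(\<lambda>k. \<bar>G (r k) x\<bar> powr q) \<longlonglongrightarrow> 0"
    moreover have "(\<lambda>k. 1 / q) \<longlonglongrightarrow> 1 / q"
      by simp
    ultimately have "(\<lambda>k. (\<bar>G (r k) x\<bar> powr q) powr (1 / q)) \<longlonglongrightarrow> 0"
      by (rule tendsto_zero_powrI) (use \<open>q > 0\<close> in auto)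
    then show "(\<lambda>k. G (r k) x) \<longlonglongrightarrow> 0"
      using \<open>q > 0\<close> by (simp add: powr_powr tendsto_rabs_zero_iff)
  qed
  with r show ?thesis by blast
qed

text \<open>The part of \<open>conv_extension\<close> that does not mention the kernel. Linearity is
  required almost everywhere only, since functions stand for their classes.\<close>

definition bounded_op :: "real \<Rightarrow> real \<Rightarrow> (('a::euclidean_space \<Rightarrow> real) \<Rightarrow> 'a \<Rightarrow> real) \<Rightarrow> bool" where
  "bounded_op q p T \<longleftrightarrow>
     (\<forall>g\<in>Lq q. T g \<in> Lq p) \<and>
     (\<forall>f\<in>Lq q. \<forall>g\<in>Lq q. AE x in lborel. T (\<lambda>y. f y + g y) x = T f x + T g x) \<and>
     (\<forall>c. \<forall>g\<in>Lq q. AE x in lborel. T (\<lambda>y. c * g y) x = c * T g x) \<and>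
     (\<exists>C. \<forall>g\<in>Lq q. Lq_norm p (T g) \<le> C * Lq_norm q g)"

lemma bounded_opD:
  assumes "bounded_op q p T"
  shows "\<And>g. g \<in> Lq q \<Longrightarrow> T g \<in> Lq p"
    "\<And>f g. f \<in> Lq q \<Longrightarrow> g \<in> Lq q \<Longrightarrow> AE x in lborel. T (\<lambda>y. f y + g y) x = T f x + T g x"
    "\<And>c g. g \<in> Lq q \<Longrightarrow> AE x in lborel. T (\<lambda>y. c * g y) x = c * T g x"
  using assms by (auto simp: bounded_op_def)

lemma bounded_op_bound:
  assumes "bounded_op q p T"
  obtains C where "C > 0" "\<And>g. g \<in> Lq q \<Longrightarrow> Lq_norm p (T g) \<le> C * Lq_norm q g"
proof -
  obtain C where C: "\<And>g. g \<in> Lq q \<Longrightarrow> Lq_norm p (T g) \<le> C * Lq_norm q g"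
    using assms unfolding bounded_op_def by metis
  have "Lq_norm p (T g) \<le> (\<bar>C\<bar> + 1) * Lq_norm q g" if "g \<in> Lq q" for g
    using C[OF that] mult_right_mono[of C "\<bar>C\<bar> + 1" "Lq_norm q g"] Lq_norm_nonneg[of q g] by linarith
  then show ?thesis by (intro that[of "\<bar>C\<bar> + 1"]) auto
qed

lemma bounded_op_diff:
  assumes "bounded_op q p T" "f \<in> Lq q" "g \<in> Lq q"
  shows "AE x in lborel. T (\<lambda>y. f y - g y) x = T f x - T g x"
  using bounded_opD(2)[OF assms(1,2) Lq_scale[OF assms(3), of "-1"]] bounded_opD(3)[OF assms(1,3), of "-1"]
  by eventually_elim simp

text \<open>The norm statement serves limits of the quadratic form and uniqueness of extensions; the
  subsequence statement serves pointwise formulas for \<open>T g\<close>, which are unchanged by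
  passing to a subsequence.\<close>

lemma bounded_op_tendsto:
  assumes T: "bounded_op q p T" and G: "\<And>k::nat. G k \<in> Lq q" and g: "g \<in> Lq q"
    and "q > 0" "p > 0" and lim: "(\<lambda>k. Lq_norm q (\<lambda>x. G k x - g x)) \<longlonglongrightarrow> 0"
  shows "(\<lambda>k. Lq_norm p (\<lambda>x. T (G k) x - T g x)) \<longlonglongrightarrow> 0"
    and "\<exists>r. strict_mono r \<and> (AE x in lborel. (\<lambda>k. T (G (r k)) x) \<longlonglongrightarrow> T g x)"
proof -
  obtain C where C: "C > 0" "\<And>g. g \<in> Lq q \<Longrightarrow> Lq_norm p (T g) \<le> C * Lq_norm q g"
    using bounded_op_bound[OF T] by blast
  have d: "(\<lambda>y. G k y - g y) \<in> Lq q" for k using Lq_diff G g \<open>q > 0\<close> by blast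
  have TG: "T (G k) \<in> Lq p" "T g \<in> Lq p" for k using bounded_opD(1)[OF T] G g by auto
  have d': "(\<lambda>x. T (G k) x - T g x) \<in> Lq p" for k using Lq_diff[OF TG \<open>p > 0\<close>] by blast
  have eq: "Lq_norm p (\<lambda>x. T (G k) x - T g x) = Lq_norm p (T (\<lambda>y. G k y - g y))" for k
    by (rule Lq_norm_cong_AE[OF LqD(1)[OF d'] LqD(1)[OF bounded_opD(1)[OF T d]]])
       (use bounded_op_diff[OF T G g, of k] in eventually_elim, simp)
  show L: "(\<lambda>k. Lq_norm p (\<lambda>x. T (G k) x - T g x)) \<longlonglongrightarrow> 0"
  proof (rule tendsto_sandwich[OF _ _ tendsto_const])
    show "\<forall>\<^sub>F k in sequentially. Lq_norm p (\<lambda>x. T (G k) x - T g x) \<le> C * Lq_norm q (\<lambda>x. G k x - g x)"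
      unfolding eq using C(2)[OF d] by auto
    show "(\<lambda>k. C * Lq_norm q (\<lambda>x. G k x - g x)) \<longlonglongrightarrow> 0"
      using tendsto_mult_right_zero[OF lim] by simp
  qed auto
  obtain r where r: "strict_mono r" "AE x in lborel. (\<lambda>k. T (G (r k)) x - T g x) \<longlonglongrightarrow> 0"
    using Lq_norm_tendsto_AE_subseq[OF \<open>p > 0\<close> d' L] by blast
  have "AE x in lborel. (\<lambda>k. T (G (r k)) x) \<longlonglongrightarrow> T g x"
    using r(2) by eventually_elim (rule LIM_zero_cancel)
  with r show "\<exists>r. strict_mono r \<and> (AE x in lborel. (\<lambda>k. T (G (r k)) x) \<longlonglongrightarrow> T g x)"
    by blast
qed

section \<open>Density of smooth functions\<close>

text \<open>For P = 1 this is the classical smooth function exp(-1/x), flat at 0. Carrying a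
  polynomial in 1/x makes the family closed under differentiation, as the iterated partial
  derivatives in \<open>schwartz\<close> demand.\<close>

definition flat :: "real poly \<Rightarrow> real \<Rightarrow> real" where
  "flat P x = (if x > 0 then poly P (1 / x) * exp (- 1 / x) else 0)"

lemma tendsto_poly_exp_0: "((\<lambda>t::real. poly Q t * exp (- t)) \<longlongrightarrow> 0) at_top"
proof -
  have "((\<lambda>t::real. \<Sum>i\<le>degree Q. coeff Q i * (t ^ i / exp t)) \<longlongrightarrow> (\<Sum>i\<le>degree Q. coeff Q i * 0)) at_top"
    by (intro tendsto_sum tendsto_mult tendsto_const tendsto_power_div_exp_0)
  then show ?thesis
    by (simp add: poly_altdef exp_minus divide_inverse sum_distrib_right mult.assoc)
qed

text \<open>With t = 1/x the chain rule gives t^2 (P - P')(t) exp(-t), and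
  \<open>[:0, 0, 1:]\<close> is t^2. At 0 the difference quotient is t P(t) exp(-t) with t tending
  to infinity on the right, and 0 on the left.\<close>

lemma DERIV_flat: "(flat P has_real_derivative flat ([:0, 0, 1:] * (P - pderiv P)) x) (at x)"
proof -
  consider "x > 0" | "x < 0" | "x = 0" by linarith
  then show ?thesis
  proof cases
    case 1
    have D: "((\<lambda>x. poly P (1 / x) * exp (- 1 / x)) has_real_derivative flat ([:0, 0, 1:] * (P - pderiv P)) x) (at x)"
      using 1 unfolding flat_def
      by (auto intro!: derivative_eq_intros simp: power2_eq_square field_simps)
    have ev: "\<forall>\<^sub>F y in nhds x. flat P y = poly P (1 / y) * exp (- 1 / y)"
      using eventually_nhds_in_open[of "{0<..}" x] 1 by (auto simp: flat_def elim!: eventually_mono)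
    show ?thesis
      by (rule iffD2[OF DERIV_cong_ev[OF refl ev refl] D])
  next
    case 2
    have ev: "\<forall>\<^sub>F y in nhds x. flat P y = 0"
      using eventually_nhds_in_open[of "{..<0}" x] 2 by (auto simp: flat_def elim!: eventually_mono)
    have "((\<lambda>x. 0) has_real_derivative flat ([:0, 0, 1:] * (P - pderiv P)) x) (at x)"
      using 2 by (auto simp: flat_def)
    then show ?thesis
      by (rule iffD2[OF DERIV_cong_ev[OF refl ev refl]])
  next
    case 3
    have "((\<lambda>y. flat P y / y) \<longlongrightarrow> 0) (at 0)"
      unfolding filterlim_at_split
    proof
      show "((\<lambda>y. flat P y / y) \<longlongrightarrow> 0) (at_left 0)"
        by (rule tendsto_eventually) (auto simp: eventually_at_filter flat_def)
      have "((\<lambda>y. poly ([:0, 1:] * P) (inverse y) * exp (- inverse y)) \<longlongrightarrow> 0) (at_right (0::real))"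
        by (rule filterlim_compose[OF tendsto_poly_exp_0 filterlim_inverse_at_top_right])
      then show "((\<lambda>y. flat P y / y) \<longlongrightarrow> 0) (at_right 0)"
        by (rule Lim_transform_eventually)
           (auto simp: eventually_at_filter flat_def field_simps)
    qed
    then show ?thesis
      using 3 by (simp add: has_field_derivative_iff flat_def)
  qed
qed

text \<open>Closure under sums is forced by the product rule: the derivative of a product of two
  flat factors is a sum of two such products. For k > 0 every member vanishes outside the interval
  from c to d.\<close>

inductive_set bumps :: "real \<Rightarrow> real \<Rightarrow> real \<Rightarrow> (real \<Rightarrow> real) set" for k c d where
  bumps_mult: "(\<lambda>x. flat P (k * (x - c)) * flat Q (k * (d - x))) \<in> bumps k c d"
| bumps_add: "f \<in> bumps k c d \<Longrightarrow> g \<in> bumps k c d \<Longrightarrow> (\<lambda>x. f x + g x) \<in> bumps k c d"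

lemma flat_smult: "flat (smult a P) x = a * flat P x"
  by (simp add: flat_def)

lemma bumps_derivative:
  assumes "f \<in> bumps k c d"
  shows "\<exists>f'\<in>bumps k c d. \<forall>x. (f has_real_derivative f' x) (at x)"
  using assms
proof induction
  case (bumps_mult P Q)
  define P' where "P' = smult k ([:0, 0, 1:] * (P - pderiv P))"
  define Q' where "Q' = smult (- k) ([:0, 0, 1:] * (Q - pderiv Q))"
  let ?f' = "\<lambda>x. flat P' (k * (x - c)) * flat Q (k * (d - x)) + flat P (k * (x - c)) * flat Q' (k * (d - x))"
  have "?f' \<in> bumps k c d"
    by (intro bumps.intros)
  moreover have "((\<lambda>x. flat P (k * (x - c)) * flat Q (k * (d - x))) has_real_derivative ?f' x) (at x)" for x
  proof -
    have 1: "((\<lambda>x. flat P (k * (x - c))) has_real_derivative flat P' (k * (x - c))) (at x)"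
      unfolding P'_def flat_smult
      by (rule DERIV_cong[OF DERIV_chain2[OF DERIV_flat]]) (auto intro!: derivative_eq_intros)
    have 2: "((\<lambda>x. flat Q (k * (d - x))) has_real_derivative flat Q' (k * (d - x))) (at x)"
      unfolding Q'_def flat_smult
      by (rule DERIV_cong[OF DERIV_chain2[OF DERIV_flat]]) (auto intro!: derivative_eq_intros)
    show ?thesis
      by (rule DERIV_cong[OF DERIV_mult[OF 1 2]]) (simp add: algebra_simps)
  qed
  ultimately show ?case by (intro bexI[of _ ?f'] allI) auto
next
  case (bumps_add f g)
  then obtain f' g' where "f' \<in> bumps k c d" "g' \<in> bumps k c d"
    "\<And>x. (f has_real_derivative f' x) (at x)" "\<And>x. (g has_real_derivative g' x) (at x)"
    by blast
  then show ?case
    by (intro bexI[of _ "\<lambda>x. f' x + g' x"] allI DERIV_add bumps.bumps_add) auto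
qed

lemma bumps_vanish:
  assumes "f \<in> bumps k c d" "k > 0" "x \<notin> {c<..<d}"
  shows "f x = 0"
  using assms by induction (auto simp: flat_def zero_less_mult_iff)

definition bump_product :: "('n \<Rightarrow> real \<Rightarrow> real) \<Rightarrow> real ^ 'n::finite \<Rightarrow> real" where
  "bump_product \<phi> x = (\<Prod>i\<in>UNIV. \<phi> i (x $ i))"

lemma bump_product_derivative:
  fixes x :: "real ^ 'n"
  assumes "\<And>i. (\<phi> i has_real_derivative \<phi>' i) (at (x $ i))"
  shows "(bump_product \<phi> has_derivative (\<lambda>y. \<Sum>i\<in>UNIV. (\<phi>' i * y $ i) * (\<Prod>j\<in>UNIV - {i}. \<phi> j (x $ j)))) (at x)"
proof -
  have "((\<lambda>x. \<phi> i (x $ i)) has_derivative (\<lambda>y. \<phi>' i * y $ i)) (at x)" for i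
    using has_derivative_compose[OF bounded_linear_imp_has_derivative[OF bounded_linear_vec_nth[of i]], of "\<phi> i" "(*) (\<phi>' i)" x UNIV]
      assms[of i] by (simp add: has_field_derivative_def)
  then show ?thesis
    unfolding bump_product_def[abs_def] by (rule has_derivative_prod)
qed

text \<open>A partial derivative in direction i touches only the i-th factor and replaces it by its
  derivative, which is again a bump on the same interval.\<close>

lemma partials_bump_product:
  fixes c d :: "real ^ 'n"
  assumes "\<And>i. \<phi> i \<in> bumps k (c $ i) (d $ i)"
  shows "\<exists>\<psi>. (\<forall>i. \<psi> i \<in> bumps k (c $ i) (d $ i)) \<and> partials is (bump_product \<phi>) = bump_product \<psi>"
proof (induction "is")
  case Nil
  then show ?case using assms by auto
next
  case (Cons i "is")
  then obtain \<psi> where \<psi>: "\<And>i. \<psi> i \<in> bumps k (c $ i) (d $ i)" "partials is (bump_product \<phi>) = bump_product \<psi>"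
    by blast
  obtain \<psi>' where \<psi>': "\<And>i. \<psi>' i \<in> bumps k (c $ i) (d $ i)" "\<And>i x. (\<psi> i has_real_derivative \<psi>' i x) (at x)"
    using bumps_derivative[OF \<psi>(1)] by metis
  have "frechet_derivative (bump_product \<psi>) (at x) (axis i 1) = bump_product (\<psi>(i := \<psi>' i)) x" for x
  proof -
    have "frechet_derivative (bump_product \<psi>) (at x) (axis i 1) =
      (\<Sum>j\<in>UNIV. (\<psi>' j (x $ j) * axis i 1 $ j) * (\<Prod>l\<in>UNIV - {j}. \<psi> l (x $ l)))"
      using frechet_derivative_at[OF bump_product_derivative[of \<psi> "\<lambda>i. \<psi>' i (x $ i)" x, OF \<psi>'(2)], symmetric] by simp
    also have "\<dots> = (\<Sum>j\<in>UNIV. if j = i then \<psi>' j (x $ j) * (\<Prod>l\<in>UNIV - {j}. \<psi> l (x $ l)) else 0)"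
      by (intro sum.cong) (auto simp: axis_def)
    also have "\<dots> = \<psi>' i (x $ i) * (\<Prod>l\<in>UNIV - {i}. \<psi> l (x $ l))"
      by simp
    also have "\<dots> = bump_product (\<psi>(i := \<psi>' i)) x"
      unfolding bump_product_def by (subst prod.remove[of UNIV i]) (auto intro!: prod.cong)
    finally show ?thesis .
  qed
  then have "partials (i # is) (bump_product \<phi>) = bump_product (\<psi>(i := \<psi>' i))"
    using \<psi>(2) by auto
  moreover have "\<forall>j. (\<psi>(i := \<psi>' i)) j \<in> bumps k (c $ j) (d $ j)"
    using \<psi> \<psi>' by auto
  ultimately show ?case by blast
qed

text \<open>Every iterated partial derivative is again a bump product: continuous, hence bounded
  with any weight on the closed box, and zero outside it.\<close>

lemma schwartz_bump_product:
  fixes c d :: "real ^ 'n"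
  assumes \<phi>: "\<And>i. \<phi> i \<in> bumps k (c $ i) (d $ i)" and "k > 0"
  shows "schwartz (bump_product \<phi>)"
  unfolding schwartz_def
proof (intro allI conjI)
  fix "is" :: "'n list"
  obtain \<psi> where \<psi>: "\<And>i. \<psi> i \<in> bumps k (c $ i) (d $ i)" "partials is (bump_product \<phi>) = bump_product \<psi>"
    using partials_bump_product[of \<phi> k c d "is", OF \<phi>] by blast
  obtain \<psi>' where \<psi>': "\<And>i. \<psi>' i \<in> bumps k (c $ i) (d $ i)" "\<And>i x. (\<psi> i has_real_derivative \<psi>' i x) (at x)"
    using bumps_derivative[OF \<psi>(1)] by metis
  have diff: "bump_product \<psi> differentiable at x" for x
    using bump_product_derivative[of \<psi> "\<lambda>i. \<psi>' i (x $ i)" x, OF \<psi>'(2)] by (auto simp: differentiable_def)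
  then show "partials is (bump_product \<phi>) differentiable at x" for x
    by (simp add: \<psi>(2))
  fix m :: nat
  have "continuous_on (cbox c d) (\<lambda>x. norm x ^ m * \<bar>bump_product \<psi> x\<bar>)"
    using diff by (intro continuous_intros continuous_at_imp_continuous_on ballI differentiable_imp_continuous_within) auto
  then have "bounded ((\<lambda>x. norm x ^ m * \<bar>bump_product \<psi> x\<bar>) ` cbox c d)"
    by (intro compact_imp_bounded compact_continuous_image compact_cbox)
  then obtain C where C: "\<And>x. x \<in> cbox c d \<Longrightarrow> \<bar>norm x ^ m * \<bar>bump_product \<psi> x\<bar>\<bar> \<le> C"
    unfolding bounded_iff by auto
  have "norm x ^ m * \<bar>bump_product \<psi> x\<bar> \<le> max C 0" for x
  proof (cases "x \<in> cbox c d")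
    case True
    then show ?thesis using C[OF True] by auto
  next
    case False
    then obtain i where "x $ i < c $ i \<or> d $ i < x $ i"
      by (auto simp: mem_box_cart not_le)
    then have "\<psi> i (x $ i) = 0"
      by (intro bumps_vanish[OF \<psi>(1) \<open>k > 0\<close>]) auto
    then have "bump_product \<psi> x = 0"
      unfolding bump_product_def by (simp add: prod_zero_iff) blast
    then show ?thesis by simp
  qed
  then show "\<exists>C. \<forall>x. norm x ^ m * \<bar>partials is (bump_product \<phi>) x\<bar> \<le> C"
    unfolding \<psi>(2) by blast
qed

text \<open>\<open>Suc n\<close> is a steepness: exp(-1/((n + 1) t)) tends to 1 for every t > 0, so
  these Schwartz functions converge to the indicator of the open box while staying below it.\<close>

definition smooth_box :: "nat \<Rightarrow> real ^ 'n \<Rightarrow> real ^ 'n \<Rightarrow> real ^ 'n::finite \<Rightarrow> real" where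
  "smooth_box n c d = bump_product (\<lambda>i x. flat 1 (Suc n * (x - c $ i)) * flat 1 (Suc n * (d $ i - x)))"

lemma schwartz_smooth_box: "schwartz (smooth_box n c d)"
  unfolding smooth_box_def
  by (rule schwartz_bump_product[of _ "real (Suc n)" c d]) (auto intro: bumps_mult)

lemma flat_one_bounds: "0 \<le> flat 1 x" "flat 1 x \<le> 1"
  by (auto simp: flat_def)

lemma flat_one_tendsto: "(\<lambda>n. flat 1 (real (Suc n) * t)) \<longlonglongrightarrow> (if t > 0 then 1 else 0)"
proof (cases "t > 0")
  case True
  have "(\<lambda>n. exp (- inverse (real (Suc n)) * (1 / t))) \<longlonglongrightarrow> exp (- 0 * (1 / t))"
    by (intro tendsto_intros LIMSEQ_inverse_real_of_nat)
  moreover have "exp (- inverse (real (Suc n)) * (1 / t)) = flat 1 (real (Suc n) * t)" for n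
    using True by (simp add: flat_def field_simps del: of_nat_Suc)
  ultimately show ?thesis using True by simp
next
  case False
  then have "flat 1 (real (Suc n) * t) = 0" for n
    by (simp add: flat_def zero_less_mult_iff del: of_nat_Suc)
  then show ?thesis using False by simp
qed

lemma smooth_box_bounds: "0 \<le> smooth_box n c d x" "smooth_box n c d x \<le> indicator (box c d) x"
proof -
  show "0 \<le> smooth_box n c d x"
    by (auto simp: smooth_box_def bump_product_def intro!: prod_nonneg mult_nonneg_nonneg flat_one_bounds)
  show "smooth_box n c d x \<le> indicator (box c d) x"
  proof (cases "x \<in> box c d")
    case True
    have "smooth_box n c d x \<le> (\<Prod>i\<in>(UNIV::'a set). 1)"
      unfolding smooth_box_def bump_product_def
      by (intro prod_mono conjI mult_nonneg_nonneg mult_le_one flat_one_bounds)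
    then show ?thesis using True by simp
  next
    case False
    then obtain i where "x $ i \<le> c $ i \<or> d $ i \<le> x $ i"
      by (auto simp: mem_box_cart not_less)
    then have "flat 1 (Suc n * (x $ i - c $ i)) * flat 1 (Suc n * (d $ i - x $ i)) = 0"
      by (auto simp: flat_def zero_less_mult_iff simp del: of_nat_Suc)
    then have "smooth_box n c d x = 0"
      unfolding smooth_box_def bump_product_def by (simp add: prod_zero_iff del: of_nat_Suc) blast
    then show ?thesis by simp
  qed
qed

lemma smooth_box_tendsto: "(\<lambda>n. smooth_box n c d x) \<longlonglongrightarrow> indicator (box c d) x"
proof -
  have "(\<lambda>n. smooth_box n c d x) \<longlonglongrightarrow>
    (\<Prod>i\<in>UNIV. (if x $ i - c $ i > 0 then 1 else 0) * (if d $ i - x $ i > 0 then 1 else 0))"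
    unfolding smooth_box_def bump_product_def by (intro tendsto_prod tendsto_mult flat_one_tendsto)
  also have "(\<Prod>i\<in>UNIV. (if x $ i - c $ i > 0 then 1 else 0) * (if d $ i - x $ i > 0 then 1 else 0)) = (indicator (box c d) x :: real)"
  proof (cases "x \<in> box c d")
    case True
    then show ?thesis by (auto simp: mem_box_cart intro!: prod.neutral)
  next
    case False
    then obtain i where "x $ i \<le> c $ i \<or> d $ i \<le> x $ i"
      by (auto simp: mem_box_cart not_less)
    then have "(if x $ i - c $ i > 0 then 1 else 0) * (if d $ i - x $ i > 0 then 1 else 0) = (0::real)"
      by auto
    then have "(\<Prod>i\<in>UNIV. (if x $ i - c $ i > 0 then 1 else 0) * (if d $ i - x $ i > 0 then 1 else 0)) = (0::real)"
      by (intro prod_zero) (auto intro: exI[of _ i])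
    then show ?thesis using False by simp
  qed
  finally show ?thesis .
qed

lemma smooth_box_measurable: "smooth_box n c d \<in> borel_measurable borel"
proof -
  have "smooth_box n c d differentiable at x" for x
    using schwartz_smooth_box[of n c d] unfolding schwartz_def by (metis partials.simps(1))
  then have "continuous_on UNIV (smooth_box n c d)"
    by (auto intro!: continuous_at_imp_continuous_on differentiable_imp_continuous_within)
  then show ?thesis by (rule borel_measurable_continuous_onI)
qed

section \<open>Density of Schwartz functions as induction principles\<close>

definition box_bounded :: "'a::euclidean_space \<Rightarrow> 'a \<Rightarrow> ('a \<Rightarrow> real) set" where
  "box_bounded c d = {g \<in> borel_measurable borel. \<exists>M. \<forall>x. \<bar>g x\<bar> \<le> M * indicator (box c d) x}"

text \<open>A Dynkin argument: open boxes are an intersection-stable generator of the Borel sets.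
  Cutting everything with one fixed box keeps complements integrable and allows \<open>lim\<close>
  to assume pointwise convergence below a single majorant, the form in which a local convolution
  formula passes to the limit.\<close>

lemma box_indicator_induct:
  fixes P :: "(real ^ 'n \<Rightarrow> real) \<Rightarrow> bool" and c d :: "real ^ 'n"
  defines "K \<equiv> box_bounded c d"
  assumes smooth: "\<And>g. schwartz g \<Longrightarrow> g \<in> K \<Longrightarrow> P g"
    and add: "\<And>f g. f \<in> K \<Longrightarrow> g \<in> K \<Longrightarrow> P f \<Longrightarrow> P g \<Longrightarrow> P (\<lambda>x. f x + g x)"
    and scale: "\<And>f a. f \<in> K \<Longrightarrow> P f \<Longrightarrow> P (\<lambda>x. a * f x)"
    and lim: "\<And>g G. (\<And>k::nat. G k \<in> borel_measurable borel) \<Longrightarrow> (\<And>k x. \<bar>G k x\<bar> \<le> indicator (box c d) x) \<Longrightarrow>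
       (\<And>x. (\<lambda>k. G k x) \<longlonglongrightarrow> g x) \<Longrightarrow> (\<And>k. P (G k)) \<Longrightarrow> P g"
    and A: "A \<in> sets borel"
  shows "P (indicator (A \<inter> box c d))"
proof -
  have boxP: "P (indicator (box l u \<inter> box c d))" for l u :: "real ^ 'n"
  proof -
    obtain l' u' where lu: "box l u \<inter> box c d = box l' u'"
      using box_Int_box[of l u c d] by blast
    have sub: "box l' u' \<subseteq> box c d" using lu by auto
    have bd: "\<bar>smooth_box k l' u' x\<bar> \<le> indicator (box c d) x" for k x
      using smooth_box_bounds[of k l' u' x] sub
      by (cases "x \<in> box l' u'"; cases "x \<in> box c d") auto
    have "P (indicator (box l' u'))"
    proof (rule lim)
      show "smooth_box k l' u' \<in> borel_measurable borel" for k
        by (rule smooth_box_measurable)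
      show "\<bar>smooth_box k l' u' x\<bar> \<le> indicator (box c d) x" for k x by (rule bd)
      show "(\<lambda>k. smooth_box k l' u' x) \<longlonglongrightarrow> indicator (box l' u') x" for x
        by (rule smooth_box_tendsto)
      show "P (smooth_box k l' u')" for k
        by (rule smooth[OF schwartz_smooth_box])
           (unfold K_def box_bounded_def, intro CollectI conjI exI[of _ 1] allI, auto simp: smooth_box_measurable bd)
    qed
    then show ?thesis by (simp add: lu)
  qed
  have inK: "indicator (B \<inter> box c d) \<in> K" if "B \<in> sets borel" for B
    using that by (auto simp: K_def box_bounded_def indicator_def intro!: exI[of _ 1])
  have boxC: "P (indicator (box c d))"
    using boxP[of c d] by simp
  have A': "A \<in> sigma_sets UNIV (range (\<lambda>(a, b). box a b))"
    using A unfolding borel_eq_box by simp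
  have borel: "B \<in> sets borel" if "B \<in> sigma_sets UNIV (range (\<lambda>(a, b). box a b :: (real^'n) set))" for B
    using that unfolding borel_eq_box by simp
  have "Int_stable (range (\<lambda>(a, b). box a b :: (real^'n) set))"
    by (auto simp: Int_stable_def box_Int_box)
  then show ?thesis using subset_Pow_Union[of "range (\<lambda>(a, b). box a b :: (real^'n) set)", THEN subset_trans, OF Pow_mono[OF subset_UNIV]] A'
  proof (induction rule: sigma_sets_induct_disjoint)
    case (basic A)
    then show ?case using boxP by auto
  next
    case empty
    have "P (\<lambda>x. 0 * indicator (box c d) x)"
      by (rule scale[OF _ boxC]) (use inK[of UNIV] in auto)
    then show ?case by (simp add: indicator_def[abs_def])
  next
    case (compl A)
    have "P (\<lambda>x. indicator (box c d) x + (-1) * indicator (A \<inter> box c d) x)"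
    proof (rule add[OF _ _ boxC scale[OF _ compl(2)]])
      show "indicator (box c d) \<in> K" using inK[of UNIV] by simp
      show *: "indicator (A \<inter> box c d) \<in> K" using inK borel compl by blast
      show "(\<lambda>x. - 1 * indicator (A \<inter> box c d) x) \<in> K"
        using borel[OF compl(1)] by (auto simp: K_def box_bounded_def indicator_def intro!: exI[of _ 1])
    qed
    also have "(\<lambda>x. indicator (box c d) x + (-1) * indicator (A \<inter> box c d) x) = (indicator ((UNIV - A) \<inter> box c d) :: _ \<Rightarrow> real)"
      by (auto simp: indicator_def)
    finally show ?case .
  next
    case (union A)
    have fin: "P (indicator ((\<Union>i<n. A i) \<inter> box c d))" for n
    proof (induction n)
      case 0
      have "P (\<lambda>x. 0 * indicator (box c d) x)"
        by (rule scale[OF _ boxC]) (use inK[of UNIV] in auto)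
      then show ?case by (simp add: indicator_def[abs_def])
    next
      case (Suc n)
      have disj: "(\<Union>i<n. A i) \<inter> A n = {}"
      proof -
        have "A i \<inter> A n = {}" if "i < n" for i
          using disjoint_family_onD[OF union(1), of i n] that by simp
        then show ?thesis by blast
      qed
      have "P (\<lambda>x. indicator ((\<Union>i<n. A i) \<inter> box c d) x + indicator (A n \<inter> box c d) x)"
        by (rule add[OF _ _ Suc union(3)]; rule inK) (use union(2) borel in auto)
      also have "(\<lambda>x. indicator ((\<Union>i<n. A i) \<inter> box c d) x + indicator (A n \<inter> box c d) x) =
        (indicator ((\<Union>i<Suc n. A i) \<inter> box c d) :: _ \<Rightarrow> real)"
        using disj by (auto simp: indicator_def fun_eq_iff less_Suc_eq)
      finally show ?case .
    qed
    show ?case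
    proof (rule lim)
      show "indicator ((\<Union>i<k. A i) \<inter> box c d) \<in> borel_measurable borel" for k
      proof -
        have "(\<Union>i<k. A i) \<in> sets borel"
          using union(2) borel by (intro sets.finite_UN) auto
        then show ?thesis by auto
      qed
      show "\<bar>indicator ((\<Union>i<k. A i) \<inter> box c d) x\<bar> \<le> (indicator (box c d) x :: real)" for k x
        by (auto simp: indicator_def)
      show "P (indicator ((\<Union>i<k. A i) \<inter> box c d))" for k by (rule fin)
      show "(\<lambda>k. indicator ((\<Union>i<k. A i) \<inter> box c d) x) \<longlonglongrightarrow> (indicator ((\<Union>i. A i) \<inter> box c d) x :: real)" for x
      proof (cases "x \<in> (\<Union>i. A i) \<inter> box c d")
        case True
        then obtain i where i: "x \<in> A i" by auto
        have "\<forall>\<^sub>F k in sequentially. indicator ((\<Union>i<k. A i) \<inter> box c d) x = (indicator ((\<Union>i. A i) \<inter> box c d) x :: real)"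
          using eventually_gt_at_top[of i] by eventually_elim (use i True in \<open>auto simp: indicator_def\<close>)
        then show ?thesis by (rule tendsto_eventually)
      next
        case False
        then have "indicator ((\<Union>i<k. A i) \<inter> box c d) x = (0::real)" for k
          by (auto simp: indicator_def)
        then show ?thesis using False by simp
      qed
    qed
  qed
qed

text \<open>Density of compactly supported Schwartz functions in L^q, phrased as induction so that a
  property only has to survive sums, multiples and norm limits. The ladder is: Borel sets cut by a
  box, sets with indicator in L^q, nonnegative functions, differences of positive and negative
  parts.\<close>

lemma Lq_induct:
  fixes P :: "(real ^ 'n \<Rightarrow> real) \<Rightarrow> bool"
  assumes "q > 0"
    and smooth: "\<And>g c d M. schwartz g \<Longrightarrow> g \<in> Lq q \<Longrightarrow> (\<And>x. \<bar>g x\<bar> \<le> M * indicator (box c d) x) \<Longrightarrow> P g"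
    and add: "\<And>f g. f \<in> Lq q \<Longrightarrow> g \<in> Lq q \<Longrightarrow> P f \<Longrightarrow> P g \<Longrightarrow> P (\<lambda>x. f x + g x)"
    and scale: "\<And>f a. f \<in> Lq q \<Longrightarrow> P f \<Longrightarrow> P (\<lambda>x. a * f x)"
    and lim: "\<And>g G. (\<And>k::nat. G k \<in> Lq q) \<Longrightarrow> g \<in> Lq q \<Longrightarrow>
       (\<lambda>k. Lq_norm q (\<lambda>x. G k x - g x)) \<longlonglongrightarrow> 0 \<Longrightarrow> (\<And>k. P (G k)) \<Longrightarrow> P g"
    and f: "f \<in> Lq q"
  shows "P f"
proof -
  \<comment> \<open>Pointwise limits below a fixed L^q majorant are norm limits; all limits in this
    proof are taken in this form.\<close>
  have dom: "P g" if G: "\<And>k::nat. G k \<in> borel_measurable borel" and g: "g \<in> borel_measurable borel" and "d \<in> Lq q"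
     "\<And>k x. \<bar>G k x\<bar> \<le> \<bar>d x\<bar>" "\<And>x. \<bar>g x\<bar> \<le> \<bar>d x\<bar>" "\<And>x. (\<lambda>k. G k x) \<longlonglongrightarrow> g x" "\<And>k. P (G k)" for g G d
  proof (rule lim)
    show "G k \<in> Lq q" for k using Lq_dominated[OF that(3) G] that assms(1) by auto
    show "g \<in> Lq q" using Lq_dominated[OF that(3) g] that assms(1) by auto
    show "(\<lambda>k. Lq_norm q (\<lambda>x. G k x - g x)) \<longlonglongrightarrow> 0"
      by (rule Lq_dominated_convergence[OF assms(1) G g that(3,4)]) (use that in auto)
  qed (use that in auto)
  have boxed: "P (indicator (A \<inter> box c d))" if A: "A \<in> sets borel" for A and c d :: "real ^ 'n"
  proof (rule box_indicator_induct[OF _ _ _ _ A])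
    have C: "indicator (box c d) \<in> Lq q"
      by (rule Lq_indicator) (use emeasure_lborel_box_finite[of c d] in auto)
    have K: "g \<in> Lq q" if g: "g \<in> box_bounded c d" for g
    proof -
      obtain M where M: "\<And>x. \<bar>g x\<bar> \<le> M * indicator (box c d) x" and gm: "g \<in> borel_measurable borel"
        using g by (auto simp: box_bounded_def)
      have "\<bar>g x\<bar> \<le> \<bar>M * indicator (box c d) x\<bar>" for x
        using M[of x] by linarith
      then show ?thesis
        using Lq_dominated[OF Lq_scale[OF C, of M] gm] assms(1) by auto
    qed
    show "P g" if "schwartz g" "g \<in> box_bounded c d" for g
      using that K[OF that(2)] smooth[of g _ c d] unfolding box_bounded_def by blast
    show "P (\<lambda>x. f x + g x)" if "f \<in> box_bounded c d"
       "g \<in> box_bounded c d" "P f" "P g" for f g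
      using that K add by blast
    show "P (\<lambda>x. a * f x)" if "f \<in> box_bounded c d" "P f" for f a
      using that K scale by blast
    show "P g" if "\<And>k::nat. G k \<in> borel_measurable borel" "\<And>k x. \<bar>G k x\<bar> \<le> indicator (box c d) x"
      "\<And>x. (\<lambda>k. G k x) \<longlonglongrightarrow> g x" "\<And>k. P (G k)" for g and G :: "nat \<Rightarrow> real^'n \<Rightarrow> real"
    proof (rule dom[OF that(1) _ C])
      show "g \<in> borel_measurable borel" by (rule borel_measurable_LIMSEQ_real[OF that(3,1)])
      show "\<bar>g x\<bar> \<le> \<bar>indicator (box c d) x\<bar>" for x
        by (rule LIMSEQ_le_const2[OF tendsto_rabs[OF that(3)]]) (use that(2) in auto)
    qed (use that in auto)
  qed
  have zero: "P (\<lambda>x. 0)"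
    using boxed[of "{}" 0 0] by (simp add: indicator_def[abs_def])
  have ind: "P (indicator A)" if A: "A \<in> sets borel" "indicator A \<in> Lq q" for A
  proof (rule dom[OF _ _ A(2)])
    let ?B = "\<lambda>k::nat. box (- (real k *\<^sub>R One)) (real k *\<^sub>R One) :: (real ^ 'n) set"
    show "indicator (A \<inter> ?B k) \<in> borel_measurable borel" for k using A by auto
    show "P (indicator (A \<inter> ?B k))" for k by (rule boxed[OF A(1)])
    show "(\<lambda>k. indicator (A \<inter> ?B k) x) \<longlonglongrightarrow> (indicator A x :: real)" for x
    proof -
      obtain m :: nat where m: "x \<in> ?B m"
        using UN_box_eq_UNIV by blast
      have "\<forall>\<^sub>F k in sequentially. indicator (A \<inter> ?B k) x = (indicator A x :: real)"
        using eventually_ge_at_top[of m]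
      proof eventually_elim
        case (elim k)
        have "x \<in> ?B k" using m elim by (force simp: mem_box)
        then show ?case by (simp add: indicator_def)
      qed
      then show ?thesis by (rule tendsto_eventually)
    qed
  qed (use A in \<open>auto simp: indicator_def\<close>)
  have nonneg: "u \<in> Lq q \<longrightarrow> P u" if u: "u \<in> borel_measurable borel" "\<And>x. 0 \<le> u x" for u
    using u
  proof (induction rule: borel_measurable_induct_real)
    case (set A)
    then show ?case using ind by auto
  next
    case (mult u c)
    show ?case
    proof
      assume cu: "(\<lambda>x. c * u x) \<in> Lq q"
      \<comment> \<open>For c = 0, membership of c u in L^q says nothing about u, hence the separate
        appeal to the zero function.\<close>
      show "P (\<lambda>x. c * u x)"
      proof (cases "c = 0")
        case True
        then show ?thesis using zero by simp
      next
        case False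
        then have "u \<in> Lq q" using Lq_scale[OF cu, of "1 / c"] by simp
        then show ?thesis using scale mult by blast
      qed
    qed
  next
    case (add u v)
    show ?case
    proof
      assume s: "(\<lambda>x. v x + u x) \<in> Lq q"
      have "u \<in> Lq q" "v \<in> Lq q"
        using Lq_dominated[OF s, of u] Lq_dominated[OF s, of v] add assms(1) by auto
      then show "P (\<lambda>x. v x + u x)" using add assms(3) by blast
    qed
  next
    case (seq U)
    show ?case
    proof
      assume u: "u \<in> Lq q"
      have le: "U i x \<le> u x" for i x
        by (rule incseq_le[of "\<lambda>i. U i x"]) (use seq in \<open>auto simp: incseq_def le_fun_def\<close>)
      have u0: "0 \<le> u x" for x
        using order_trans[OF seq(2) le] .
      have bd: "\<bar>U k x\<bar> \<le> \<bar>u x\<bar>" for k x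
        using le[of k x] seq(2)[of k x] by simp
      show "P u"
      proof (rule dom[where d=u and G=U])
        show "P (U k)" for k
          using Lq_dominated[OF u _ bd[of k] assms(1)] seq by auto
      qed (use seq u LqD(1)[OF u] bd in auto)
    qed
  qed
  have [measurable]: "f \<in> borel_measurable borel" using LqD f by auto
  have p: "(\<lambda>x. max (f x) 0) \<in> Lq q" "(\<lambda>x. max (- f x) 0) \<in> Lq q"
    by (rule Lq_dominated[OF f]; use assms(1) in auto)+
  have "P (\<lambda>x. max (f x) 0 + (-1) * max (- f x) 0)"
    by (rule add[OF p(1) Lq_scale[OF p(2)] _ scale[OF p(2)]]) (use nonneg p in auto)
  moreover have "(\<lambda>x. max (f x) 0 + (-1) * max (- f x) 0) = f"
    by (auto simp: max_def)
  ultimately show ?thesis by simp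
qed

section \<open>Singularity of the Helmholtz kernel\<close>

text \<open>The reciprocal Gamma function is entire, so this derivative also makes sense at the
  poles of Gamma, where the leading coefficient of Y at positive integer orders is found.\<close>

abbreviation dG :: "real \<Rightarrow> real" where "dG \<equiv> deriv rGamma"

lemma DERIV_rGamma: "(rGamma has_real_derivative dG x) (at x)"
  using has_field_derivative_rGamma[of x] DERIV_imp_deriv by metis

lemma deriv_rGamma_rec: "dG x = rGamma (x + 1) + x * dG (x + 1)"
proof -
  have "((\<lambda>x. x * rGamma (x + 1)) has_real_derivative (rGamma (x + 1) + x * dG (x + 1))) (at x)"
    by (rule DERIV_cong[OF DERIV_mult[OF DERIV_ident DERIV_chain2[OF DERIV_rGamma]]])
       (auto intro!: derivative_eq_intros)
  then have "(rGamma has_real_derivative (rGamma (x + 1) + x * dG (x + 1))) (at x)"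
    by (simp add: rGamma_plus1)
  then show ?thesis using DERIV_rGamma DERIV_unique by blast
qed

text \<open>Compactness on [2,3], then induction over longer intervals: for y >= 2 the recurrences y
  rGamma(y+1) = rGamma y and y dG(y+1) = dG y - rGamma(y+1) divide by at least 2, so the constant
  does not grow.\<close>

lemma rGamma_deriv_bounded_ge2:
  "\<exists>M>0. \<forall>x\<ge>2. \<bar>rGamma x\<bar> \<le> M \<and> \<bar>dG x\<bar> \<le> M"
proof -
  have nz: "x \<notin> \<int>\<^sub>\<le>\<^sub>0" if "x \<ge> 2" for x :: real
    using that by (auto elim!: nonpos_Ints_cases)
  have "continuous_on {2..3} (\<lambda>x::real. rGamma x)"
    by (intro continuous_intros)
  then have "bounded (rGamma ` {2..3::real})"
    by (intro compact_imp_bounded compact_continuous_image) auto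
  then obtain M1 where "\<forall>y\<in>rGamma ` {2..3::real}. norm y \<le> M1"
    unfolding bounded_iff by blast
  then have M1: "\<And>x::real. x \<in> {2..3} \<Longrightarrow> \<bar>rGamma x\<bar> \<le> M1"
    by auto
  have "continuous_on {2..3} (\<lambda>x::real. - (rGamma x * Digamma x))"
    using nz by (intro continuous_on_minus continuous_on_mult continuous_on_rGamma continuous_on_Polygamma) auto
  then have "bounded ((\<lambda>x. - (rGamma x * Digamma x)) ` {2..3::real})"
    by (intro compact_imp_bounded compact_continuous_image) auto
  then obtain M2 where "\<forall>y\<in>(\<lambda>x. - (rGamma x * Digamma x)) ` {2..3::real}. norm y \<le> M2"
    unfolding bounded_iff by blast
  then have M2: "\<And>x::real. x \<in> {2..3} \<Longrightarrow> \<bar>- (rGamma x * Digamma x)\<bar> \<le> M2"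
    by auto
  have dG_eq: "dG x = - (rGamma x * Digamma x)" if "x \<ge> 2" for x :: real
    using has_field_derivative_rGamma_no_nonpos_int[OF nz[OF that]] DERIV_imp_deriv[of rGamma _ x] by simp
  define M where "M = max 1 (max M1 M2)"
  have base: "\<bar>rGamma x\<bar> \<le> M \<and> \<bar>dG x\<bar> \<le> M" if "2 \<le> x" "x \<le> 3" for x
    using M1[of x] M2[of x] dG_eq[of x] that by (auto simp: M_def)
  have "\<forall>x. 2 \<le> x \<and> x \<le> 3 + real k \<longrightarrow> \<bar>rGamma x\<bar> \<le> M \<and> \<bar>dG x\<bar> \<le> M" for k
  proof (induction k)
    case 0
    then show ?case using base by auto
  next
    case (Suc k)
    show ?case
    proof (intro allI impI)
      fix x assume x: "2 \<le> x \<and> x \<le> 3 + real (Suc k)"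
      show "\<bar>rGamma x\<bar> \<le> M \<and> \<bar>dG x\<bar> \<le> M"
      proof (cases "x \<le> 3")
        case True
        then show ?thesis using base x by auto
      next
        case False
        define y where "y = x - 1"
        have y: "y \<ge> 2" "y \<le> 3 + real k" "x = y + 1" using x False by (auto simp: y_def)
        have IH: "\<bar>rGamma y\<bar> \<le> M" "\<bar>dG y\<bar> \<le> M" using Suc y by auto
        have "y * rGamma x = rGamma y" using rGamma_plus1[of y] y by simp
        then have 1: "2 * \<bar>rGamma x\<bar> \<le> \<bar>rGamma y\<bar>"
        proof -
          have "2 * \<bar>rGamma x\<bar> \<le> y * \<bar>rGamma x\<bar>" using y(1) by (intro mult_right_mono) auto
          also have "\<dots> = \<bar>y * rGamma x\<bar>" using y(1) by (simp add: abs_mult)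
          finally show ?thesis using \<open>y * rGamma x = rGamma y\<close> by simp
        qed
        have "y * dG x = dG y - rGamma x" using deriv_rGamma_rec[of y] y by simp
        then have "y * \<bar>dG x\<bar> = \<bar>dG y - rGamma x\<bar>"
          using y(1) abs_mult[of y "dG x"] by simp
        moreover have "2 * \<bar>dG x\<bar> \<le> y * \<bar>dG x\<bar>" using y(1) by (intro mult_right_mono) auto
        ultimately have 2: "2 * \<bar>dG x\<bar> \<le> \<bar>dG y\<bar> + \<bar>rGamma x\<bar>" by linarith
        show ?thesis using 1 2 IH by linarith
      qed
    qed
  qed
  moreover have "\<exists>k. x \<le> 3 + real k" for x :: real
    using real_arch_simple[of x] by (metis add_increasing zero_le_numeral)
  ultimately have "\<forall>x\<ge>2. \<bar>rGamma x\<bar> \<le> M \<and> \<bar>dG x\<bar> \<le> M"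
    by meson
  moreover have "M > 0" by (simp add: M_def)
  ultimately show ?thesis by blast
qed

text \<open>The same recurrences read downwards: a unit step to the left costs at most the factor j
  + 3. Arbitrary left ends are required because Bessel functions of negative order enter Y.\<close>

lemma rGamma_deriv_bounded:
  "\<exists>M>0. \<forall>x\<ge>a. \<bar>rGamma x\<bar> \<le> M \<and> \<bar>dG x\<bar> \<le> M"
proof -
  have "\<exists>M>0. \<forall>x\<ge>2 - real j. \<bar>rGamma x\<bar> \<le> M \<and> \<bar>dG x\<bar> \<le> M" for j
  proof (induction j)
    case 0
    then show ?case using rGamma_deriv_bounded_ge2 by simp
  next
    case (Suc j)
    then obtain M where M: "M > 0" "\<And>x. x \<ge> 2 - real j \<Longrightarrow> \<bar>rGamma x\<bar> \<le> M \<and> \<bar>dG x\<bar> \<le> M" by blast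
    define L where "L = (real j + 3) * M"
    have "\<bar>rGamma x\<bar> \<le> L \<and> \<bar>dG x\<bar> \<le> L" if "x \<ge> 2 - real (Suc j)" for x
    proof (cases "x \<ge> 2 - real j")
      case True
      have "1 * M \<le> L" unfolding L_def using M(1) by (intro mult_right_mono) auto
      then show ?thesis using M(2)[OF True] by linarith
    next
      case False
      have x: "\<bar>x\<bar> \<le> real j + 2" using False that by auto
      have IH: "\<bar>rGamma (x + 1)\<bar> \<le> M" "\<bar>dG (x + 1)\<bar> \<le> M" using M(2)[of "x + 1"] that by auto
      have "\<bar>x\<bar> * \<bar>rGamma (x + 1)\<bar> \<le> (real j + 2) * M" "\<bar>x\<bar> * \<bar>dG (x + 1)\<bar> \<le> (real j + 2) * M"
        by (rule mult_mono[OF x IH(1)] mult_mono[OF x IH(2)]; simp)+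
      moreover have "\<bar>rGamma x\<bar> = \<bar>x\<bar> * \<bar>rGamma (x + 1)\<bar>"
        by (metis abs_mult rGamma_plus1)
      moreover have "\<bar>dG x\<bar> \<le> \<bar>rGamma (x + 1)\<bar> + \<bar>x\<bar> * \<bar>dG (x + 1)\<bar>"
        unfolding deriv_rGamma_rec[of x] using abs_triangle_ineq[of "rGamma (x + 1)" "x * dG (x + 1)"] by (simp add: abs_mult)
      moreover have "(real j + 2) * M + M = L" by (simp add: L_def algebra_simps)
      ultimately show ?thesis using IH M(1) by linarith
    qed
    moreover have "L > 0" using M(1) by (simp add: L_def)
    ultimately show ?case by blast
  qed
  moreover obtain j :: nat where j: "2 - a \<le> real j" using real_arch_simple by blast
  ultimately obtain M where M: "M > 0" "\<And>x. x \<ge> 2 - real j \<Longrightarrow> \<bar>rGamma x\<bar> \<le> M \<and> \<bar>dG x\<bar> \<le> M" by metis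
  then have "\<bar>rGamma x\<bar> \<le> M \<and> \<bar>dG x\<bar> \<le> M" if "x \<ge> a" for x
    using M(2)[of x] that j by simp
  with M(1) show ?thesis by blast
qed

section \<open>Bessel functions as functions of their order\<close>

definition bessel_dJ :: "real \<Rightarrow> real \<Rightarrow> real" where
  "bessel_dJ \<nu> z = (\<Sum>k. (-1) ^ k / fact k * ((z / 2) powr (\<nu> + 2 * real k) *
     (dG (\<nu> + real k + 1) + rGamma (\<nu> + real k + 1) * ln (z / 2))))"

lemma summable_exp_even: "summable (\<lambda>k. C * ((q::real) ^ (2 * k) / fact k))"
proof -
  have "(\<lambda>k. C * (inverse (fact k) * (q\<^sup>2) ^ k)) = (\<lambda>k. C * (q ^ (2 * k) / fact k))"
    by (rule ext) (metis divide_inverse mult.commute power_mult)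
  then show ?thesis
    using summable_mult[OF summable_exp[of "q\<^sup>2"], of C] by simp
qed

lemma powr_add_even: "q > 0 \<Longrightarrow> (q::real) powr (a + 2 * real k) = q powr a * q ^ (2 * k)"
  using powr_realpow[of q "2 * k"] by (simp add: powr_add)

text \<open>Termwise differentiation in the order, not in the argument. The derived series converges
  uniformly near \<alpha> by comparison with an exponential series, using the uniform bounds on
  \<open>rGamma\<close> and \<open>dG\<close>.\<close>

lemma DERIV_bessel_J_order:
  assumes "z > 0"
  shows "((\<lambda>\<alpha>. bessel_J \<alpha> z) has_real_derivative bessel_dJ \<alpha> z) (at \<alpha>)"
proof -
  define q where "q = z / 2"
  have q: "q > 0" using assms by (simp add: q_def)
  define S where "S = {\<alpha> - 1..\<alpha> + 1}"
  obtain M where M: "M > 0" "\<And>x. x \<ge> \<alpha> - 1 \<Longrightarrow> \<bar>rGamma x\<bar> \<le> M \<and> \<bar>dG x\<bar> \<le> M"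
    using rGamma_deriv_bounded[of "\<alpha> - 1"] by blast
  \<comment> \<open>q may lie on either side of 1, so the maximum of q^x over S sits at one of the
    two endpoints; the sum covers both cases.\<close>
  define Q where "Q = q powr (\<alpha> - 1) + q powr (\<alpha> + 1)"
  have Q: "q powr x \<le> Q" if "x \<in> S" for x
  proof (cases "q \<ge> 1")
    case True
    then have "q powr x \<le> q powr (\<alpha> + 1)" using that by (intro powr_mono) (auto simp: S_def)
    then show ?thesis unfolding Q_def using powr_non_neg[of q "\<alpha> - 1"] by linarith
  next
    case False
    then have "q powr x \<le> q powr (\<alpha> - 1)" using that q by (intro powr_mono') (auto simp: S_def)
    then show ?thesis unfolding Q_def using powr_non_neg[of q "\<alpha> + 1"] by linarith
  qed
  define f where "f k x = (-1) ^ k / fact k * rGamma (x + real k + 1) * q powr (x + 2 * real k)" for k x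
  define f' where "f' k x = (-1) ^ k / fact k * (q powr (x + 2 * real k) *
     (dG (x + real k + 1) + rGamma (x + real k + 1) * ln q))" for k x
  have der: "(f k has_field_derivative f' k x) (at x within S)" for k x
  proof -
    have "((\<lambda>x. rGamma (x + real k + 1)) has_real_derivative dG (x + real k + 1)) (at x)"
      by (rule DERIV_cong[OF DERIV_chain2[OF DERIV_rGamma]]) (auto intro!: derivative_eq_intros)
    moreover have "((\<lambda>x. q powr (x + 2 * real k)) has_real_derivative q powr (x + 2 * real k) * ln q) (at x)"
      using q by (auto intro!: derivative_eq_intros)
    ultimately have "((\<lambda>x. (-1) ^ k / fact k * (rGamma (x + real k + 1) * q powr (x + 2 * real k))) has_real_derivative
      (-1) ^ k / fact k * (dG (x + real k + 1) * q powr (x + 2 * real k) + q powr (x + 2 * real k) * ln q * rGamma (x + real k + 1))) (at x)"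
      by (intro DERIV_cmult DERIV_mult)
    moreover have "(\<lambda>x. (-1) ^ k / fact k * (rGamma (x + real k + 1) * q powr (x + 2 * real k))) = f k"
      by (rule ext) (simp add: f_def)
    moreover have "(-1) ^ k / fact k * (dG (x + real k + 1) * q powr (x + 2 * real k) + q powr (x + 2 * real k) * ln q * rGamma (x + real k + 1)) = f' k x"
      by (simp add: f'_def algebra_simps)
    ultimately show ?thesis
      by (simp only: has_field_derivative_at_within)
  qed
  have bd: "\<bar>rGamma (x + real k + 1)\<bar> \<le> M" "\<bar>dG (x + real k + 1)\<bar> \<le> M" if "x \<in> S" for x k
    using M(2)[of "x + real k + 1"] that by (auto simp: S_def)
  have unif: "uniformly_convergent_on S (\<lambda>n x. \<Sum>i<n. f' i x)"
  proof (rule Weierstrass_m_test'[OF _ summable_exp_even[of "Q * (M + M * \<bar>ln q\<bar>)" q]])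
    fix k x assume x: "x \<in> S"
    have "\<bar>dG (x + real k + 1) + rGamma (x + real k + 1) * ln q\<bar> \<le> M + M * \<bar>ln q\<bar>"
      using bd[OF x, of k] mult_right_mono[of "\<bar>rGamma (x + real k + 1)\<bar>" M "\<bar>ln q\<bar>"]
        abs_triangle_ineq[of "dG (x + real k + 1)" "rGamma (x + real k + 1) * ln q"] by (simp add: abs_mult)
    then have "(q powr x * q ^ (2 * k)) * \<bar>dG (x + real k + 1) + rGamma (x + real k + 1) * ln q\<bar> \<le> (Q * q ^ (2 * k)) * (M + M * \<bar>ln q\<bar>)"
      using q M(1) by (intro mult_mono mult_right_mono Q[OF x]) (auto simp: Q_def)
    then have "(q powr x * q ^ (2 * k)) * \<bar>dG (x + real k + 1) + rGamma (x + real k + 1) * ln q\<bar> / fact k \<le> (Q * q ^ (2 * k)) * (M + M * \<bar>ln q\<bar>) / fact k"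
      by (rule divide_right_mono) simp
    moreover have "norm (f' k x) = (q powr x * q ^ (2 * k)) * \<bar>dG (x + real k + 1) + rGamma (x + real k + 1) * ln q\<bar> / fact k"
      using q by (simp add: f'_def abs_mult powr_add_even)
    ultimately show "norm (f' k x) \<le> Q * (M + M * \<bar>ln q\<bar>) * (q ^ (2 * k) / fact k)"
      by (simp add: mult_ac)
  qed
  have summ: "summable (\<lambda>k. f k \<alpha>)"
  proof (rule summable_comparison_test'[OF summable_exp_even[of "M * q powr \<alpha>" q]])
    fix k :: nat assume "k \<ge> 0"
    have "\<bar>rGamma (\<alpha> + real k + 1)\<bar> * (q powr \<alpha> * q ^ (2 * k)) / fact k \<le> M * (q powr \<alpha> * q ^ (2 * k)) / fact k"
      using bd[of \<alpha> k] q by (intro divide_right_mono mult_right_mono) (auto simp: S_def)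
    then show "norm (f k \<alpha>) \<le> M * q powr \<alpha> * (q ^ (2 * k) / fact k)"
      using q by (simp add: f_def abs_mult powr_add_even)
  qed
  have "((\<lambda>x. \<Sum>n. f n x) has_field_derivative (\<Sum>n. f' n \<alpha>)) (at \<alpha>)"
    by (rule has_field_derivative_series'(2)[OF _ der unif _ summ]) (auto simp: S_def)
  then show ?thesis
    by (simp add: f_def f'_def q_def bessel_J_def[abs_def] bessel_dJ_def)
qed

text \<open>The first n terms of the series of order -n vanish, because the reciprocal Gamma
  function is 0 at nonpositive integers; shifting the index by n gives the series of order
  n.\<close>

lemma bessel_J_minus_nat:
  assumes "z > 0"
  shows "bessel_J (- real n) z = (-1) ^ n * bessel_J (real n) z"
proof -
  define q where "q = z / 2"
  have q: "q > 0" using assms by (simp add: q_def)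
  define f where "f \<beta> k = (-1) ^ k / fact k * rGamma (\<beta> + real k + 1) * q powr (\<beta> + 2 * real k)" for \<beta> k
  have summ: "summable (f \<beta>)" for \<beta>
  proof -
    obtain M where M: "M > 0" "\<And>x. x \<ge> \<beta> - 1 \<Longrightarrow> \<bar>rGamma x\<bar> \<le> M \<and> \<bar>dG x\<bar> \<le> M"
      using rGamma_deriv_bounded[of "\<beta> - 1"] by blast
    show ?thesis
    proof (rule summable_comparison_test'[OF summable_exp_even[of "M * q powr \<beta>" q]])
      fix k :: nat assume "k \<ge> 0"
      have "\<bar>rGamma (\<beta> + real k + 1)\<bar> * (q powr \<beta> * q ^ (2 * k)) / fact k \<le> M * (q powr \<beta> * q ^ (2 * k)) / fact k"
        using M(2)[of "\<beta> + real k + 1"] q by (intro divide_right_mono mult_right_mono) auto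
      then show "norm (f \<beta> k) \<le> M * q powr \<beta> * (q ^ (2 * k) / fact k)"
        using q by (simp add: f_def abs_mult powr_add_even)
    qed
  qed
  have G: "rGamma (real m + 1) = inverse (fact m)" for m
    using rGamma_of_int[of "int m + 1", where 'a=real] by simp
  have zero: "f (- real n) k = 0" if "k < n" for k
  proof -
    have "rGamma (of_int (int k + 1 - int n)) = (0::real)"
      using that by (subst rGamma_of_int) auto
    then show ?thesis by (simp add: f_def algebra_simps)
  qed
  have shift: "f (- real n) (k + n) = (-1) ^ n * f (real n) k" for k
  proof -
    have "f (- real n) (k + n) = (-1) ^ (k + n) / fact (k + n) * rGamma (real k + 1) * q powr (real n + 2 * real k)"
      by (simp add: f_def algebra_simps)
    also have "\<dots> = (-1) ^ n * ((-1) ^ k / fact k * rGamma (real (n + k) + 1) * q powr (real n + 2 * real k))"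
      unfolding G by (simp add: field_simps power_add add.commute)
    finally show ?thesis by (simp add: f_def)
  qed
  have "bessel_J (- real n) z = (\<Sum>k. f (- real n) k)"
    by (simp add: bessel_J_def f_def q_def)
  also have "\<dots> = (\<Sum>k. f (- real n) (k + n)) + (\<Sum>k<n. f (- real n) k)"
    by (rule suminf_split_initial_segment[OF summ])
  also have "\<dots> = (-1) ^ n * (\<Sum>k. f (real n) k)"
    using zero by (simp add: shift suminf_mult summ)
  finally show ?thesis by (simp add: bessel_J_def f_def q_def)
qed

text \<open>L'Hospital in the order: numerator and sine both vanish at the integer n, so the limit
  defining Y is the quotient of their derivatives. The cosine contributes nothing because its
  derivative there is 0.\<close>

lemma bessel_Y_nat:
  assumes "z > 0"
  shows "bessel_Y (real n) z = (bessel_dJ (real n) z + (-1) ^ n * bessel_dJ (- real n) z) / pi"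
proof -
  define N where "N \<alpha> = bessel_J \<alpha> z * cos (\<alpha> * pi) - bessel_J (- \<alpha>) z" for \<alpha>
  have c: "cos (real n * pi) = (-1) ^ n"
    using cos_npi by simp
  have N0: "N (real n) = 0"
    by (simp add: N_def c bessel_J_minus_nat[OF assms])
  have dm: "((\<lambda>\<alpha>. bessel_J (- \<alpha>) z) has_real_derivative - bessel_dJ (- real n) z) (at (real n))"
    by (rule DERIV_cong[OF DERIV_chain2[OF DERIV_bessel_J_order[OF assms]]]) (auto intro!: derivative_eq_intros)
  have dc: "((\<lambda>\<alpha>. cos (\<alpha> * pi)) has_real_derivative 0) (at (real n))"
    by (auto intro!: derivative_eq_intros)
  have dN: "(N has_real_derivative ((-1) ^ n * bessel_dJ (real n) z + bessel_dJ (- real n) z)) (at (real n))"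
    unfolding N_def[abs_def]
    by (rule DERIV_cong[OF DERIV_diff[OF DERIV_mult[OF DERIV_bessel_J_order[OF assms] dc] dm]]) (simp add: c)
  have ds: "((\<lambda>\<alpha>. sin (\<alpha> * pi)) has_real_derivative (-1) ^ n * pi) (at (real n))"
    using c by (auto intro!: derivative_eq_intros)
  have "((\<lambda>\<alpha>. ((N \<alpha> - N (real n)) / (\<alpha> - real n)) / ((sin (\<alpha> * pi) - sin (real n * pi)) / (\<alpha> - real n)))
     \<longlongrightarrow> ((-1) ^ n * bessel_dJ (real n) z + bessel_dJ (- real n) z) / ((-1) ^ n * pi)) (at (real n))"
    using dN ds unfolding has_field_derivative_iff by (intro tendsto_divide) auto
  moreover have "\<forall>\<^sub>F \<alpha> in at (real n). ((N \<alpha> - N (real n)) / (\<alpha> - real n)) / ((sin (\<alpha> * pi) - sin (real n * pi)) / (\<alpha> - real n)) = N \<alpha> / sin (\<alpha> * pi)"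
    by (auto simp: eventually_at_filter N0)
  ultimately have "((\<lambda>\<alpha>. N \<alpha> / sin (\<alpha> * pi)) \<longlongrightarrow> ((-1) ^ n * bessel_dJ (real n) z + bessel_dJ (- real n) z) / ((-1) ^ n * pi)) (at (real n))"
    by (rule Lim_transform_eventually)
  then have "Lim (at (real n)) (\<lambda>\<alpha>. N \<alpha> / sin (\<alpha> * pi)) = ((-1) ^ n * bessel_dJ (real n) z + bessel_dJ (- real n) z) / ((-1) ^ n * pi)"
    by (intro tendsto_Lim) auto
  also have "\<dots> = (bessel_dJ (real n) z + (-1) ^ n * bessel_dJ (- real n) z) / pi"
    by (cases "even n") (auto simp: field_simps)
  finally show ?thesis
    by (simp add: bessel_Y_def N_def)
qed

text \<open>The cosine vanishes at half-integers and the sine is a sign, so only J of negative order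
  survives. These are the orders that belong to odd dimensions.\<close>

lemma bessel_Y_half:
  "bessel_Y (real k + 1 / 2) z = - ((-1) ^ k * bessel_J (- (real k + 1 / 2)) z)"
proof -
  have "real k + 1 / 2 \<notin> \<int>"
  proof
    assume "real k + 1 / 2 \<in> \<int>"
    then obtain m :: int where "real k + 1 / 2 = of_int m" by (metis Ints_cases)
    then have "of_int (2 * int k + 1) = (of_int (2 * m) :: real)" by simp
    then have "2 * int k + 1 = 2 * m" by (simp only: of_int_eq_iff)
    then show False by presburger
  qed
  moreover have "cos ((real k + 1 / 2) * pi) = 0" "sin ((real k + 1 / 2) * pi) = (-1) ^ k"
    using sin_npi[of k] cos_npi[of k] by (auto simp: distrib_right sin_add cos_add)
  ultimately show ?thesis
    by (cases "even k") (auto simp: bessel_Y_def)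
qed

section \<open>Behaviour of Bessel functions at small arguments\<close>

lemma suminf_tail_bound:
  fixes g :: "nat \<Rightarrow> real"
  assumes "0 < q" "q \<le> 1" and "C \<ge> 0" and bd: "\<And>k. \<bar>g k\<bar> \<le> C * (q ^ (2 * k) / fact k)"
  shows "\<bar>(\<Sum>k. g k) - g 0\<bar> \<le> 3 * C * q\<^sup>2"
proof -
  have sg: "summable g"
    by (rule summable_comparison_test'[OF summable_exp_even[of C q], of 0]) (use bd in auto)
  \<comment> \<open>The majorant sums to C exp(q^2); without its first term C (exp(q^2) - 1) is
    left, which is of order q^2 for q <= 1.\<close>
  have e: "(\<lambda>k. C * (q ^ (2 * k) / fact k)) sums (C * exp (q\<^sup>2))"
  proof -
    have "(\<lambda>k. C * ((q\<^sup>2) ^ k /\<^sub>R fact k)) = (\<lambda>k. C * (q ^ (2 * k) / fact k))"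
      by (rule ext) (metis divide_inverse_commute power_mult real_scaleR_def)
    then show ?thesis using sums_mult[OF exp_converges[of "q\<^sup>2"], of C] by simp
  qed
  have s1: "(\<lambda>k. C * (q ^ (2 * Suc k) / fact (Suc k))) sums (C * exp (q\<^sup>2) - C)"
    using sums_Suc_iff[of "\<lambda>k. C * (q ^ (2 * k) / fact k)" "C * exp (q\<^sup>2) - C"] e by simp
  have "(\<Sum>k. g k) - g 0 = (\<Sum>k. g (Suc k))"
    using suminf_split_head[OF sg] by simp
  then have "\<bar>(\<Sum>k. g k) - g 0\<bar> \<le> (\<Sum>k. C * (q ^ (2 * Suc k) / fact (Suc k)))"
    using norm_suminf_le[of "\<lambda>k. g (Suc k)" "\<lambda>k. C * (q ^ (2 * Suc k) / fact (Suc k))"] bd s1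
    by (simp add: sums_iff del: power_Suc mult_Suc_right fact_Suc)
  also have "\<dots> = C * (exp (q\<^sup>2) - 1)"
    using s1 by (simp add: sums_iff algebra_simps)
  also have "exp (q\<^sup>2) - 1 \<le> 3 * q\<^sup>2"
  proof -
    have "q\<^sup>2 \<le> 1" using assms by (simp add: power_le_one)
    then have "exp (q\<^sup>2) \<le> 1 + q\<^sup>2 + (q\<^sup>2)\<^sup>2"
      by (intro exp_bound) auto
    moreover have "(q\<^sup>2)\<^sup>2 \<le> q\<^sup>2"
      using mult_left_le[OF \<open>q\<^sup>2 \<le> 1\<close> zero_le_power2[of q]] unfolding power2_eq_square[of "q\<^sup>2"] .
    ultimately show ?thesis using zero_le_power2[of q] by linarith
  qed
  then have "C * (exp (q\<^sup>2) - 1) \<le> C * (3 * q\<^sup>2)"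
    using assms(3) by (rule mult_left_mono)
  finally show ?thesis by simp
qed

lemma bessel_J_leading:
  "\<exists>C\<ge>0. \<forall>z. 0 < z \<and> z \<le> 2 \<longrightarrow> \<bar>bessel_J \<beta> z - rGamma (\<beta> + 1) * (z / 2) powr \<beta>\<bar> \<le> C * (z / 2) powr (\<beta> + 2)"
proof -
  obtain M where M: "M > 0" "\<And>x. x \<ge> \<beta> + 1 \<Longrightarrow> \<bar>rGamma x\<bar> \<le> M \<and> \<bar>dG x\<bar> \<le> M"
    using rGamma_deriv_bounded[of "\<beta> + 1"] by blast
  have "\<bar>bessel_J \<beta> z - rGamma (\<beta> + 1) * (z / 2) powr \<beta>\<bar> \<le> 3 * M * (z / 2) powr (\<beta> + 2)" if z: "0 < z" "z \<le> 2" for z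
  proof -
    define q where "q = z / 2"
    have q: "0 < q" "q \<le> 1" using z by (auto simp: q_def)
    define g where "g k = (-1) ^ k / fact k * rGamma (\<beta> + real k + 1) * q powr (\<beta> + 2 * real k)" for k
    have "\<bar>(\<Sum>k. g k) - g 0\<bar> \<le> 3 * (M * q powr \<beta>) * q\<^sup>2"
    proof (rule suminf_tail_bound[OF q])
      fix k
      have "\<bar>rGamma (\<beta> + real k + 1)\<bar> * (q powr \<beta> * q ^ (2 * k)) / fact k \<le> M * (q powr \<beta> * q ^ (2 * k)) / fact k"
        using M(2)[of "\<beta> + real k + 1"] q by (intro divide_right_mono mult_right_mono) auto
      then show "\<bar>g k\<bar> \<le> M * q powr \<beta> * (q ^ (2 * k) / fact k)"
        using q by (simp add: g_def abs_mult powr_add_even)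
    qed (use M in auto)
    moreover have "bessel_J \<beta> z = (\<Sum>k. g k)" by (simp add: bessel_J_def g_def q_def)
    moreover have "g 0 = rGamma (\<beta> + 1) * q powr \<beta>" by (simp add: g_def)
    moreover have "q powr (\<beta> + 2) = q powr \<beta> * q\<^sup>2"
      using powr_add_even[OF q(1), of \<beta> 1] by simp
    ultimately show ?thesis by (simp add: q_def mult_ac)
  qed
  then show ?thesis using M(1) by (intro exI[of _ "3 * M"]) auto
qed

lemma bessel_dJ_leading:
  "\<exists>C\<ge>0. \<forall>z. 0 < z \<and> z \<le> 2 \<longrightarrow> \<bar>bessel_dJ \<beta> z - (z / 2) powr \<beta> * (dG (\<beta> + 1) + rGamma (\<beta> + 1) * ln (z / 2))\<bar>
     \<le> C * (1 + \<bar>ln (z / 2)\<bar>) * (z / 2) powr (\<beta> + 2)"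
proof -
  obtain M where M: "M > 0" "\<And>x. x \<ge> \<beta> + 1 \<Longrightarrow> \<bar>rGamma x\<bar> \<le> M \<and> \<bar>dG x\<bar> \<le> M"
    using rGamma_deriv_bounded[of "\<beta> + 1"] by blast
  have "\<bar>bessel_dJ \<beta> z - (z / 2) powr \<beta> * (dG (\<beta> + 1) + rGamma (\<beta> + 1) * ln (z / 2))\<bar>
     \<le> 3 * M * (1 + \<bar>ln (z / 2)\<bar>) * (z / 2) powr (\<beta> + 2)" if z: "0 < z" "z \<le> 2" for z
  proof -
    define q where "q = z / 2"
    have q: "0 < q" "q \<le> 1" using z by (auto simp: q_def)
    define g where "g k = (-1) ^ k / fact k * (q powr (\<beta> + 2 * real k) *
     (dG (\<beta> + real k + 1) + rGamma (\<beta> + real k + 1) * ln q))" for k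
    have "\<bar>(\<Sum>k. g k) - g 0\<bar> \<le> 3 * (M * (1 + \<bar>ln q\<bar>) * q powr \<beta>) * q\<^sup>2"
    proof (rule suminf_tail_bound[OF q])
      fix k
      have b: "\<bar>rGamma (\<beta> + real k + 1)\<bar> \<le> M" "\<bar>dG (\<beta> + real k + 1)\<bar> \<le> M"
        using M(2)[of "\<beta> + real k + 1"] by auto
      have "\<bar>rGamma (\<beta> + real k + 1) * ln q\<bar> \<le> M * \<bar>ln q\<bar>"
        unfolding abs_mult by (rule mult_right_mono[OF b(1)]) simp
      then have "\<bar>dG (\<beta> + real k + 1) + rGamma (\<beta> + real k + 1) * ln q\<bar> \<le> M * (1 + \<bar>ln q\<bar>)"
        unfolding distrib_left using b by linarith
      then have "\<bar>dG (\<beta> + real k + 1) + rGamma (\<beta> + real k + 1) * ln q\<bar> * (q powr \<beta> * q ^ (2 * k)) / fact k \<le> M * (1 + \<bar>ln q\<bar>) * (q powr \<beta> * q ^ (2 * k)) / fact k"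
        using q by (intro divide_right_mono mult_right_mono) auto
      moreover have "\<bar>g k\<bar> = \<bar>dG (\<beta> + real k + 1) + rGamma (\<beta> + real k + 1) * ln q\<bar> * (q powr \<beta> * q ^ (2 * k)) / fact k"
        unfolding g_def powr_add_even[OF q(1)] using q by (simp add: abs_mult)
      ultimately show "\<bar>g k\<bar> \<le> M * (1 + \<bar>ln q\<bar>) * q powr \<beta> * (q ^ (2 * k) / fact k)"
        by (simp only: mult.assoc times_divide_eq_right)
    qed (use M in auto)
    moreover have "bessel_dJ \<beta> z = (\<Sum>k. g k)" by (simp add: bessel_dJ_def g_def q_def)
    moreover have "g 0 = q powr \<beta> * (dG (\<beta> + 1) + rGamma (\<beta> + 1) * ln q)" by (simp add: g_def)
    moreover have "q powr (\<beta> + 2) = q powr \<beta> * q\<^sup>2"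
      using powr_add_even[OF q(1), of \<beta> 1] by simp
    ultimately show ?thesis unfolding q_def by (simp only: mult.assoc)
  qed
  then show ?thesis using M(1) by (intro exI[of _ "3 * M"]) auto
qed

lemma bessel_J_measurable: "(\<lambda>z. bessel_J \<beta> z) \<in> borel_measurable borel"
  unfolding bessel_J_def[abs_def] by measurable

lemma bessel_dJ_measurable: "(\<lambda>z. bessel_dJ \<beta> z) \<in> borel_measurable borel"
  unfolding bessel_dJ_def[abs_def] by measurable

text \<open>At integer orders Y is defined by a limit in the order. The explicit formulas, one for
  each parity of N, are measurable but hold only for positive arguments, hence the auxiliary
  function.\<close>

lemma bessel_Y_measurable:
  fixes N :: nat
  shows "\<exists>Y\<in>borel_measurable borel. \<forall>z>0. bessel_Y (real N / 2) z = Y z"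
proof (cases "even N")
  case True
  then obtain n where n: "real N / 2 = real n" by (auto elim!: evenE)
  have [measurable]: "(\<lambda>z. bessel_dJ (real n) z) \<in> borel_measurable borel" "(\<lambda>z. bessel_dJ (- real n) z) \<in> borel_measurable borel"
    by (rule bessel_dJ_measurable)+
  show ?thesis unfolding n
    by (rule bexI[of _ "\<lambda>z. (bessel_dJ (real n) z + (-1) ^ n * bessel_dJ (- real n) z) / pi"])
       (use bessel_Y_nat in auto)
next
  case False
  then obtain k where "N = 2 * k + 1" by (auto elim!: oddE)
  then have k: "real N / 2 = real k + 1 / 2" by simp
  have [measurable]: "(\<lambda>z. bessel_J (- (real k + 1 / 2)) z) \<in> borel_measurable borel"
    by (rule bessel_J_measurable)
  show ?thesis unfolding k
    by (rule bexI[of _ "\<lambda>z. - ((-1) ^ k * bessel_J (- (real k + 1 / 2)) z)"])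
       (use bessel_Y_half in \<open>auto simp del: minus_add_distrib\<close>)
qed

text \<open>Half a power of q is given away to absorb the logarithms of integer orders. This is the
  origin of the exponents \<open>1 / 2\<close> and \<open>- \<nu> - 1 / 2\<close> below, and of 3/2
  - N for the kernel.\<close>

lemma log_le_inverse_sqrt:
  fixes q :: real
  assumes "0 < q" "q \<le> 1"
  shows "1 + \<bar>ln q\<bar> \<le> 2 * q powr (- 1 / 2)"
proof -
  have "ln (q powr (- 1 / 2)) \<le> q powr (- 1 / 2) - 1"
    using assms by (intro ln_le_minus_one) auto
  then have "- ln q \<le> 2 * q powr (- 1 / 2) - 2"
    using assms by (simp add: ln_powr)
  moreover have "\<bar>ln q\<bar> = - ln q"
    using assms by simp
  ultimately show ?thesis by linarith
qed

text \<open>Applied to \<open>F q = - Y\<^sub>\<nu>(2 q)\<close> for \<open>\<nu> > 0\<close>; the logarithmic case \<open>\<nu> = 0\<close> is separate.\<close>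

lemma singular_bounds:
  fixes F :: "real \<Rightarrow> real"
  assumes "\<nu> \<ge> 0" "L > 0" "C \<ge> 0"
    and bd: "\<And>q. 0 < q \<Longrightarrow> q \<le> 1 \<Longrightarrow> \<bar>F q - L * q powr (- \<nu>)\<bar> \<le> C * q powr (1 / 2) * q powr (- \<nu>)"
  shows "\<exists>r>0. \<exists>m>0. \<exists>K. \<forall>q. 0 < q \<and> q < r \<longrightarrow> m \<le> F q \<and> F q \<le> K * q powr (- \<nu> - 1 / 2)"
proof -
  \<comment> \<open>Chosen so that (C + 1) sqrt q <= L / 2 below r: the error is at most half of the
    leading term. The summand 1 guards against C = 0.\<close>
  define r where "r = min 1 ((L / (2 * (C + 1)))\<^sup>2)"
  have r: "r > 0" "r \<le> 1" using assms by (auto simp: r_def)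
  have "L / 2 \<le> F q \<and> F q \<le> (2 * L) * q powr (- \<nu> - 1 / 2)" if q: "0 < q" "q < r" for q
  proof -
    have q1: "q \<le> 1" using q r by linarith
    have "q powr (1 / 2) = sqrt q" using q by (simp add: powr_half_sqrt)
    also have "\<dots> \<le> sqrt ((L / (2 * (C + 1)))\<^sup>2)"
      using q by (intro real_sqrt_le_mono) (auto simp: r_def)
    also have "\<dots> = L / (2 * (C + 1))" using assms by simp
    finally have "(C + 1) * q powr (1 / 2) \<le> L / 2"
      using assms by (simp add: field_simps)
    moreover have "C * q powr (1 / 2) \<le> (C + 1) * q powr (1 / 2)" by (intro mult_right_mono) auto
    ultimately have "C * q powr (1 / 2) \<le> L / 2" by linarith
    then have "C * q powr (1 / 2) * q powr (- \<nu>) \<le> L / 2 * q powr (- \<nu>)"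
      by (intro mult_right_mono) auto
    then have *: "L / 2 * q powr (- \<nu>) \<le> F q" "F q \<le> 2 * L * q powr (- \<nu>)"
    proof -
      have "0 \<le> L * q powr (- \<nu>)" using assms(2) by simp
      then show "L / 2 * q powr (- \<nu>) \<le> F q" "F q \<le> 2 * L * q powr (- \<nu>)"
        using bd[OF q(1) q1] \<open>C * q powr (1 / 2) * q powr (- \<nu>) \<le> L / 2 * q powr (- \<nu>)\<close>
        unfolding abs_le_iff by simp_all
    qed
    have "1 \<le> q powr (- \<nu>)"
      using powr_mono'[of "- \<nu>" 0 q] q q1 assms(1) by simp
    then have "L / 2 * 1 \<le> L / 2 * q powr (- \<nu>)" using assms(2) by (intro mult_left_mono) auto
    moreover have "q powr (- \<nu>) \<le> q powr (- \<nu> - 1 / 2)"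
      using q q1 by (intro powr_mono') auto
    then have "2 * L * q powr (- \<nu>) \<le> 2 * L * q powr (- \<nu> - 1 / 2)"
      using assms(2) by (intro mult_left_mono) auto
    ultimately show ?thesis using * by linarith
  qed
  moreover have "L / 2 > 0" using assms(2) by simp
  ultimately show ?thesis using r(1) by blast
qed

text \<open>Gamma changes sign at each step to the left of 1/2. The sign (-1)^k compensates the one
  in \<open>bessel_Y_half\<close> and makes the leading coefficient of -Y positive.\<close>

lemma rGamma_half_sign: "(-1) ^ k * rGamma (1 / 2 - real k) > 0"
proof (induction k)
  case 0
  then show ?case using Gamma_real_pos[of "1/2"] by (simp add: rGamma_inverse_Gamma)
next
  case (Suc k)
  have "rGamma (1 / 2 - real (Suc k)) = (- 1 / 2 - real k) * rGamma (1 / 2 - real k)"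
  proof -
    have "- 1 / 2 - real k + 1 = 1 / 2 - real k" "1 / 2 - real (Suc k) = - 1 / 2 - real k" by simp_all
    then show ?thesis using rGamma_plus1[of "- 1 / 2 - real k"] by metis
  qed
  then have "(-1) ^ Suc k * rGamma (1 / 2 - real (Suc k)) = (1 / 2 + real k) * ((-1) ^ k * rGamma (1 / 2 - real k))"
    by (simp only: power_Suc) (simp add: algebra_simps del: of_nat_Suc)
  then show ?case using Suc by simp
qed

lemma bessel_Y_half_small:
  "\<exists>r>0. \<exists>m>0. \<exists>K. \<forall>q. 0 < q \<and> q < r \<longrightarrow> m \<le> - bessel_Y (real k + 1 / 2) (2 * q) \<and>
     - bessel_Y (real k + 1 / 2) (2 * q) \<le> K * q powr (- (real k + 1 / 2) - 1 / 2)"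
proof -
  obtain C where C: "C \<ge> 0" "\<And>z. 0 < z \<Longrightarrow> z \<le> 2 \<Longrightarrow>
     \<bar>bessel_J (- (real k + 1 / 2)) z - rGamma (- (real k + 1 / 2) + 1) * (z / 2) powr (- (real k + 1 / 2))\<bar>
      \<le> C * (z / 2) powr (- (real k + 1 / 2) + 2)"
    using bessel_J_leading[of "- (real k + 1 / 2)"] by blast
  show ?thesis
  proof (rule singular_bounds[of _ "(-1) ^ k * rGamma (1 / 2 - real k)" C])
    fix q :: real assume q: "0 < q" "q \<le> 1"
    let ?\<nu> = "real k + 1 / 2"
    have "- bessel_Y ?\<nu> (2 * q) - (-1) ^ k * rGamma (1 / 2 - real k) * q powr (- ?\<nu>) =
      (-1) ^ k * (bessel_J (- ?\<nu>) (2 * q) - rGamma (- ?\<nu> + 1) * q powr (- ?\<nu>))"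
      unfolding bessel_Y_half by (simp add: algebra_simps)
    then have "\<bar>- bessel_Y ?\<nu> (2 * q) - (-1) ^ k * rGamma (1 / 2 - real k) * q powr (- ?\<nu>)\<bar> =
      \<bar>bessel_J (- ?\<nu>) (2 * q) - rGamma (- ?\<nu> + 1) * q powr (- ?\<nu>)\<bar>"
      by (simp only: abs_mult) (simp add: power_abs)
    also have "\<dots> \<le> C * q powr (- ?\<nu> + 2)"
      using C(2)[of "2 * q"] q by simp
    also have "\<dots> \<le> C * (q powr (1 / 2) * q powr (- ?\<nu>))"
      using q C(1) by (intro mult_left_mono) (auto simp flip: powr_add intro!: powr_mono')
    finally show "\<bar>- bessel_Y ?\<nu> (2 * q) - (-1) ^ k * rGamma (1 / 2 - real k) * q powr (- ?\<nu>)\<bar> \<le> C * q powr (1 / 2) * q powr (- ?\<nu>)"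
      by (simp add: mult.assoc)
  qed (use rGamma_half_sign C in auto)
qed

text \<open>With \<nu> = n + 1 the reciprocal Gamma function vanishes at 1 - \<nu> = -n, so the
  logarithm drops out of the leading term of order -\<nu>; its coefficient n!/pi comes from the
  derivative (-1)^n n! at that zero. The contribution of order +\<nu> has size q^\<nu> (1 + |ln q|)
  and joins the error.\<close>

lemma bessel_Y_pos_nat_small:
  "\<exists>r>0. \<exists>m>0. \<exists>K. \<forall>q. 0 < q \<and> q < r \<longrightarrow> m \<le> - bessel_Y (real (Suc n)) (2 * q) \<and>
     - bessel_Y (real (Suc n)) (2 * q) \<le> K * q powr (- real (Suc n) - 1 / 2)"
proof -
  define \<nu> where "\<nu> = real (Suc n)"
  have \<nu>: "\<nu> \<ge> 1" by (simp add: \<nu>_def)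
  obtain C where C: "C \<ge> 0" "\<And>z. 0 < z \<Longrightarrow> z \<le> 2 \<Longrightarrow>
     \<bar>bessel_dJ \<nu> z - (z / 2) powr \<nu> * (dG (\<nu> + 1) + rGamma (\<nu> + 1) * ln (z / 2))\<bar>
     \<le> C * (1 + \<bar>ln (z / 2)\<bar>) * (z / 2) powr (\<nu> + 2)"
    using bessel_dJ_leading[of \<nu>] by blast
  obtain D where D: "D \<ge> 0" "\<And>z. 0 < z \<Longrightarrow> z \<le> 2 \<Longrightarrow>
     \<bar>bessel_dJ (- \<nu>) z - (z / 2) powr (- \<nu>) * (dG (- \<nu> + 1) + rGamma (- \<nu> + 1) * ln (z / 2))\<bar>
     \<le> D * (1 + \<bar>ln (z / 2)\<bar>) * (z / 2) powr (- \<nu> + 2)"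
    using bessel_dJ_leading[of "- \<nu>"] by blast
  define E where "E = \<bar>dG (\<nu> + 1)\<bar> + \<bar>rGamma (\<nu> + 1)\<bar>"
  have E: "E \<ge> 0" by (simp add: E_def)
  have g0: "rGamma (- \<nu> + 1) = 0"
    unfolding \<nu>_def using rGamma_of_int[of "- int n", where 'a=real] by simp
  have g1: "dG (- \<nu> + 1) = (-1) ^ n * fact n"
    unfolding \<nu>_def using DERIV_imp_deriv[OF has_field_derivative_rGamma_nonpos_int[of n, where 'a=real]] by simp
  have "0 \<le> 2 * (E + C) + 2 * D" using E C(1) D(1) by (intro add_nonneg_nonneg mult_nonneg_nonneg) auto
  then have nonneg: "0 \<le> \<nu>" "0 < fact n / pi" "0 \<le> (2 * (E + C) + 2 * D) / pi"
    using \<nu> by (linarith, simp, intro divide_nonneg_pos pi_gt_zero)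
  show ?thesis unfolding \<nu>_def[symmetric]
  proof (rule singular_bounds[OF nonneg])
    fix q :: real assume q: "0 < q" "q \<le> 1"
    define l where "l = 1 + \<bar>ln q\<bar>"
    have l: "l \<ge> 1" "l \<le> 2 * q powr (- 1 / 2)" using log_le_inverse_sqrt[OF q] by (auto simp: l_def)
    have A: "\<bar>bessel_dJ \<nu> (2 * q)\<bar> \<le> (2 * (E + C)) * (q powr (1 / 2) * q powr (- \<nu>))"
    proof -
      have "\<bar>dG (\<nu> + 1) + rGamma (\<nu> + 1) * ln q\<bar> \<le> E * l"
      proof -
        have "\<bar>dG (\<nu> + 1) + rGamma (\<nu> + 1) * ln q\<bar> \<le> \<bar>dG (\<nu> + 1)\<bar> * 1 + \<bar>rGamma (\<nu> + 1)\<bar> * \<bar>ln q\<bar>"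
          using abs_triangle_ineq[of "dG (\<nu> + 1)" "rGamma (\<nu> + 1) * ln q"] by (simp only: abs_mult mult_1_right)
        also have "\<dots> \<le> \<bar>dG (\<nu> + 1)\<bar> * l + \<bar>rGamma (\<nu> + 1)\<bar> * l"
          by (intro add_mono mult_left_mono) (auto simp: l_def)
        finally show ?thesis by (simp only: E_def distrib_right)
      qed
      then have "q powr \<nu> * \<bar>dG (\<nu> + 1) + rGamma (\<nu> + 1) * ln q\<bar> \<le> q powr \<nu> * (E * l)"
        by (intro mult_left_mono) auto
      moreover have "\<bar>bessel_dJ \<nu> (2 * q)\<bar> \<le> q powr \<nu> * \<bar>dG (\<nu> + 1) + rGamma (\<nu> + 1) * ln q\<bar> + C * l * q powr (\<nu> + 2)"
      proof -
        have "\<bar>bessel_dJ \<nu> (2 * q) - q powr \<nu> * (dG (\<nu> + 1) + rGamma (\<nu> + 1) * ln q)\<bar> \<le> C * l * q powr (\<nu> + 2)"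
          using C(2)[of "2 * q"] q by (simp add: l_def)
        moreover have "\<bar>q powr \<nu> * (dG (\<nu> + 1) + rGamma (\<nu> + 1) * ln q)\<bar> = q powr \<nu> * \<bar>dG (\<nu> + 1) + rGamma (\<nu> + 1) * ln q\<bar>"
          by (simp only: abs_mult) simp
        ultimately show ?thesis by linarith
      qed
      moreover have "C * l * q powr (\<nu> + 2) \<le> C * l * q powr \<nu>"
        using C(1) l q by (intro mult_left_mono powr_mono') auto
      ultimately have "\<bar>bessel_dJ \<nu> (2 * q)\<bar> \<le> q powr \<nu> * (E * l) + C * l * q powr \<nu>"
        by linarith
      also have "\<dots> = (E + C) * (l * q powr \<nu>)"
        by (simp add: algebra_simps)
      also have "\<dots> \<le> (E + C) * ((2 * q powr (- 1 / 2)) * q powr \<nu>)"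
        using E C(1) l by (intro mult_left_mono mult_right_mono) auto
      also have "\<dots> = (2 * (E + C)) * q powr (- 1 / 2 + \<nu>)"
        by (simp only: powr_add mult_ac)
      also have "\<dots> \<le> (2 * (E + C)) * q powr (1 / 2 + - \<nu>)"
        using \<nu> E C(1) q by (intro mult_left_mono powr_mono') auto
      finally show ?thesis by (simp only: powr_add)
    qed
    have B: "\<bar>bessel_dJ (- \<nu>) (2 * q) - q powr (- \<nu>) * ((-1) ^ n * fact n)\<bar> \<le> (2 * D) * (q powr (1 / 2) * q powr (- \<nu>))"
    proof -
      have "\<bar>bessel_dJ (- \<nu>) (2 * q) - q powr (- \<nu>) * ((-1) ^ n * fact n)\<bar> \<le> D * l * q powr (- \<nu> + 2)"
        using D(2)[of "2 * q"] q unfolding g0 g1 l_def by simp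
      also have "\<dots> \<le> D * (2 * q powr (- 1 / 2)) * q powr (- \<nu> + 2)"
        using D(1) l by (intro mult_left_mono mult_right_mono) auto
      also have "\<dots> = (2 * D) * q powr (- 1 / 2 + (- \<nu> + 2))"
        by (simp only: powr_add mult_ac)
      also have "\<dots> \<le> (2 * D) * q powr (1 / 2 + - \<nu>)"
        using D(1) q by (intro mult_left_mono powr_mono') auto
      finally show ?thesis by (simp only: powr_add)
    qed
    have "- bessel_Y \<nu> (2 * q) - fact n / pi * q powr (- \<nu>) =
       (- bessel_dJ \<nu> (2 * q) + (-1) ^ n * (bessel_dJ (- \<nu>) (2 * q) - q powr (- \<nu>) * ((-1) ^ n * fact n))) / pi"
    proof -
      have alg: "- ((X + - s * Z) / pi) - F / pi * Q = (- X + s * (Z - Q * (s * F))) / pi" if "s * s = 1" for X s Z F Q :: real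
      proof -
        have "s * (Z - Q * (s * F)) = s * Z - (s * s) * (Q * F)" by (simp add: algebra_simps)
        then show ?thesis unfolding that by (simp add: field_simps)
      qed
      have "bessel_Y \<nu> (2 * q) = (bessel_dJ \<nu> (2 * q) + - ((-1) ^ n) * bessel_dJ (- \<nu>) (2 * q)) / pi"
        unfolding \<nu>_def using bessel_Y_nat[of "2 * q" "Suc n"] q by simp
      moreover have "(-1) ^ n * (-1) ^ n = (1::real)"
        by (simp flip: power_mult_distrib)
      ultimately show ?thesis by (simp only: alg)
    qed
    also have "\<bar>\<dots>\<bar> = \<bar>- bessel_dJ \<nu> (2 * q) + (-1) ^ n * (bessel_dJ (- \<nu>) (2 * q) - q powr (- \<nu>) * ((-1) ^ n * fact n))\<bar> / pi"
      by simp
    also have "\<dots> \<le> ((2 * (E + C)) * (q powr (1 / 2) * q powr (- \<nu>)) + (2 * D) * (q powr (1 / 2) * q powr (- \<nu>))) / pi"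
    proof (intro divide_right_mono order_trans[OF abs_triangle_ineq] add_mono)
      show "\<bar>- bessel_dJ \<nu> (2 * q)\<bar> \<le> 2 * (E + C) * (q powr (1 / 2) * q powr - \<nu>)" using A by simp
      show "\<bar>(-1) ^ n * (bessel_dJ (- \<nu>) (2 * q) - q powr (- \<nu>) * ((-1) ^ n * fact n))\<bar> \<le> 2 * D * (q powr (1 / 2) * q powr - \<nu>)"
      proof -
        have "\<bar>(-1) ^ n * Z\<bar> = \<bar>Z\<bar>" for Z :: real by (simp add: abs_mult)
        then show ?thesis using B by (simp only:)
      qed
    qed simp
    finally have fin: "\<bar>- bessel_Y \<nu> (2 * q) - fact n / pi * q powr (- \<nu>)\<bar> \<le> (2 * (E + C) * (q powr (1 / 2) * q powr - \<nu>) + 2 * D * (q powr (1 / 2) * q powr - \<nu>)) / pi" .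
    show "\<bar>- bessel_Y \<nu> (2 * q) - fact n / pi * q powr (- \<nu>)\<bar> \<le> (2 * (E + C) + 2 * D) / pi * q powr (1 / 2) * q powr (- \<nu>)"
    proof -
      have alg: "(2 * (E + C) * (X * Y) + 2 * D * (X * Y)) / pi = (2 * (E + C) + 2 * D) / pi * X * Y" for X Y :: real
        by (simp add: field_simps)
      show ?thesis using fin by (simp only: alg)
    qed
  qed
qed

text \<open>At order 0 both derivative terms coincide, so -Y is -2/pi times
  \<open>bessel_dJ 0\<close>, which differs from ln q by a bounded amount.\<close>

lemma bessel_Y_0_small:
  "\<exists>r>0. \<exists>m>0. \<exists>K. \<forall>q. 0 < q \<and> q < r \<longrightarrow> m \<le> - bessel_Y 0 (2 * q) \<and>
     - bessel_Y 0 (2 * q) \<le> K * q powr (- 1 / 2)"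
proof -
  obtain C where C: "C \<ge> 0" "\<And>z. 0 < z \<Longrightarrow> z \<le> 2 \<Longrightarrow>
     \<bar>bessel_dJ 0 z - (z / 2) powr 0 * (dG (0 + 1) + rGamma (0 + 1) * ln (z / 2))\<bar>
     \<le> C * (1 + \<bar>ln (z / 2)\<bar>) * (z / 2) powr (0 + 2)"
    using bessel_dJ_leading[of 0] by blast
  define E where "E = \<bar>dG 1\<bar> + 2 * C"
  have E: "E \<ge> 0" using C(1) by (simp add: E_def)
  have key: "\<bar>bessel_dJ 0 (2 * q) - ln q\<bar> \<le> E" if q: "0 < q" "q \<le> 1" for q
  proof -
    have "\<bar>bessel_dJ 0 (2 * q) - (dG 1 + ln q)\<bar> \<le> C * (1 + \<bar>ln q\<bar>) * q powr 2"
      using C(2)[of "2 * q"] q by simp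
    also have "\<dots> \<le> C * (2 * q powr (- 1 / 2)) * q powr 2"
      using log_le_inverse_sqrt[OF q] C(1) by (intro mult_left_mono mult_right_mono) auto
    also have "\<dots> = 2 * C * q powr (- 1 / 2 + 2)" by (simp only: powr_add mult_ac)
    also have "\<dots> \<le> 2 * C * 1"
      using q C(1) by (intro mult_left_mono) (auto intro!: powr_le1)
    finally show ?thesis by (auto simp: E_def abs_le_iff)
  qed
  \<comment> \<open>Below this radius -ln q is at least E + 1 and so exceeds the bounded remainder E
    by 1.\<close>
  define r where "r = exp (- (E + 1))"
  have r: "0 < r" "r \<le> 1" using E by (auto simp: r_def)
  have "2 / pi \<le> - bessel_Y 0 (2 * q) \<and> - bessel_Y 0 (2 * q) \<le> 2 / pi * (2 * (1 + E)) * q powr (- 1 / 2)" if q: "0 < q" "q < r" for q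
  proof -
    have q1: "q \<le> 1" using q r by linarith
    have Y: "- bessel_Y 0 (2 * q) = 2 / pi * (- bessel_dJ 0 (2 * q))"
      using bessel_Y_nat[of "2 * q" 0] q by simp
    have "ln q \<le> ln r" using q r by simp
    then have lnq: "ln q \<le> - (E + 1)" by (simp add: r_def)
    have k: "\<bar>bessel_dJ 0 (2 * q) - ln q\<bar> \<le> E" using key[OF q(1) q1] .
    have "1 \<le> - bessel_dJ 0 (2 * q)" using k lnq by linarith
    then have 1: "2 / pi * 1 \<le> 2 / pi * (- bessel_dJ 0 (2 * q))"
      by (intro mult_left_mono) auto
    have "- bessel_dJ 0 (2 * q) \<le> E + \<bar>ln q\<bar>" using k by linarith
    also have "\<dots> \<le> (1 + E) * (1 + \<bar>ln q\<bar>)"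
      using E mult_nonneg_nonneg[OF E abs_ge_zero[of "ln q"]] by (simp add: algebra_simps)
    also have "\<dots> \<le> (1 + E) * (2 * q powr (- 1 / 2))"
      using log_le_inverse_sqrt[OF q(1) q1] E by (intro mult_left_mono) auto
    finally have "2 / pi * (- bessel_dJ 0 (2 * q)) \<le> 2 / pi * ((1 + E) * (2 * q powr (- 1 / 2)))"
      by (intro mult_left_mono) auto
    moreover have "2 / pi * ((1 + E) * (2 * q powr (- 1 / 2))) = 2 / pi * (2 * (1 + E)) * q powr (- 1 / 2)"
      by (simp only: mult.assoc mult.left_commute[of 2])
    ultimately show ?thesis using 1 unfolding Y by linarith
  qed
  moreover have "2 / pi > 0" by simp
  ultimately show ?thesis using r(1) by blast
qed

lemma bessel_Y_small:
  fixes N :: nat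
  shows "\<exists>r>0. \<exists>m>0. \<exists>K. \<forall>q. 0 < q \<and> q < r \<longrightarrow> m \<le> - bessel_Y (real N / 2) (2 * q) \<and>
     - bessel_Y (real N / 2) (2 * q) \<le> K * q powr (- (real N / 2) - 1 / 2)"
proof (cases "even N")
  case True
  then obtain n where n: "real N / 2 = real n" by (auto elim!: evenE)
  show ?thesis
  proof (cases n)
    case 0
    then show ?thesis using bessel_Y_0_small n by simp
  next
    case (Suc m)
    then show ?thesis using bessel_Y_pos_nat_small[of m] unfolding n by simp
  qed
next
  case False
  then obtain k where "N = 2 * k + 1" by (auto elim!: oddE)
  then have k: "real N / 2 = real k + 1 / 2" by simp
  show ?thesis unfolding k by (rule bessel_Y_half_small)
qed

section \<open>Positivity and local integrability of the kernel near its singularity\<close>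

lemma Psi_eq_bessel_Y:
  fixes x :: "real ^ 'n"
  shows "Psi l x = - ((l / (4 * pi\<^sup>2 * (norm x)\<^sup>2)) powr ((real CARD('n) - 2) / 4)) / 4
      * bessel_Y ((real CARD('n) - 2) / 2) (sqrt l * norm x)"
  by (simp add: Psi_def Phi_def hankel1_def)

lemma Psi_measurable:
  assumes "CARD('n) \<ge> 2" "l > 0"
  shows "Psi l \<in> borel_measurable (borel :: (real ^ 'n) measure)"
proof -
  have N: "(real CARD('n) - 2) / 2 = real (CARD('n) - 2) / 2" using assms by simp
  obtain Y where Y [measurable]: "Y \<in> borel_measurable borel" and
    Y': "\<And>z. z > 0 \<Longrightarrow> bessel_Y ((real CARD('n) - 2) / 2) z = Y z"
    using bessel_Y_measurable[of "CARD('n) - 2"] unfolding N by blast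
  define K where "K x = - ((l / (4 * pi\<^sup>2 * (norm x)\<^sup>2)) powr ((real CARD('n) - 2) / 4)) / 4 * Y (sqrt l * norm x)" for x :: "real ^ 'n"
  have [measurable]: "K \<in> borel_measurable borel" unfolding K_def[abs_def] by measurable
  define k0 where "k0 = Psi l (0 :: real ^ 'n)"
  have "Psi l x = (if x = 0 then k0 else K x)" for x :: "real ^ 'n"
  proof (cases "x = 0")
    case False
    then have "bessel_Y ((real CARD('n) - 2) / 2) (sqrt l * norm x) = Y (sqrt l * norm x)"
      using assms(2) by (intro Y') simp
    then show ?thesis using False unfolding K_def Psi_eq_bessel_Y[of l x] by simp
  qed (simp add: k0_def)
  then have eq: "(Psi l :: real ^ 'n \<Rightarrow> real) = (\<lambda>x. if x = 0 then k0 else K x)"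
    by (rule ext)
  have "{x :: real ^ 'n. x = 0} \<in> sets borel" by simp
  then show ?thesis unfolding eq
    by (intro measurable_If measurable_const \<open>K \<in> borel_measurable borel\<close>) simp_all
qed

text \<open>A constant lower bound suffices for a positive form on small sets. The upper exponent is
  -2 \<nu> - 1/2 = 3/2 - N: one \<nu> from the prefactor, the rest from Y. It lies above -N, which
  gives local integrability.\<close>

lemma Psi_small:
  assumes "CARD('n) \<ge> 2" "l > 0"
  shows "\<exists>r>0. \<exists>m>0. \<exists>C. \<forall>x::real ^ 'n. 0 < norm x \<and> norm x < r \<longrightarrow>
     m \<le> Psi l x \<and> Psi l x \<le> C * norm x powr (3 / 2 - real CARD('n))"
proof -
  define \<nu> where "\<nu> = (real CARD('n) - 2) / 2"
  have \<nu>: "\<nu> = real (CARD('n) - 2) / 2" "\<nu> \<ge> 0" using assms by (auto simp: \<nu>_def)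
  obtain r m K where r: "r > 0" and m: "m > 0" and
    Y: "\<And>q. 0 < q \<Longrightarrow> q < r \<Longrightarrow> m \<le> - bessel_Y \<nu> (2 * q)"
       "\<And>q. 0 < q \<Longrightarrow> q < r \<Longrightarrow> - bessel_Y \<nu> (2 * q) \<le> K * q powr (- \<nu> - 1 / 2)"
    using bessel_Y_small[of "CARD('n) - 2"] unfolding \<nu>(1)[symmetric] by blast
  define s where "s = sqrt l"
  have s: "s > 0" "s\<^sup>2 = l" using assms by (auto simp: s_def)
  \<comment> \<open>The first bound puts q = s |x| / 2 into the range of the Bessel estimates; the
    second makes s / (2 pi |x|) at least 1, and with it the prefactor.\<close>
  define r' where "r' = min (2 * r / s) (s / (2 * pi))"
  have r': "r' > 0" using r s by (auto simp: r'_def)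
  define C where "C = (s / (2 * pi)) powr \<nu> / 4 * K * (s / 2) powr (- \<nu> - 1 / 2)"
  have "m / 4 \<le> Psi l x \<and> Psi l x \<le> C * norm x powr (3 / 2 - real CARD('n))"
    if x: "0 < norm x" "norm x < r'" for x :: "real ^ 'n"
  proof -
    define c where "c = (s / (2 * pi * norm x)) powr \<nu>"
    have "l / (4 * pi\<^sup>2 * (norm x)\<^sup>2) = (s / (2 * pi * norm x)) powr 2"
    proof -
      have "l / (4 * pi\<^sup>2 * (norm x)\<^sup>2) = (s / (2 * pi * norm x))\<^sup>2"
        using s by (simp add: power_divide power_mult_distrib)
      also have "\<dots> = (s / (2 * pi * norm x)) powr 2"
        using s x by (subst powr_numeral) auto
      finally show ?thesis .
    qed
    then have "(l / (4 * pi\<^sup>2 * (norm x)\<^sup>2)) powr ((real CARD('n) - 2) / 4) = c"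
    proof -
      have "2 * ((real CARD('n) - 2) / 4) = \<nu>" by (simp add: \<nu>_def)
      then show ?thesis using \<open>l / (4 * pi\<^sup>2 * (norm x)\<^sup>2) = (s / (2 * pi * norm x)) powr 2\<close>
        unfolding c_def by (simp only: powr_powr)
    qed
    then have P: "Psi l x = c / 4 * (- bessel_Y \<nu> (2 * (s * norm x / 2)))"
      by (simp add: Psi_eq_bessel_Y \<nu>_def s_def)
    have q: "0 < s * norm x / 2" "s * norm x / 2 < r"
      using x s by (auto simp: r'_def field_simps)
    have "1 \<le> s / (2 * pi * norm x)"
      using x s by (auto simp: r'_def field_simps)
    then have c1: "1 \<le> c" unfolding c_def using \<nu>(2) by (rule ge_one_powr_ge_zero)
    have "1 / 4 * m \<le> c / 4 * (- bessel_Y \<nu> (2 * (s * norm x / 2)))"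
      using c1 m Y(1)[OF q] by (intro mult_mono) auto
    moreover have "c / 4 * (- bessel_Y \<nu> (2 * (s * norm x / 2))) \<le> c / 4 * (K * (s * norm x / 2) powr (- \<nu> - 1 / 2))"
      using c1 Y(2)[OF q] by (intro mult_left_mono) auto
    moreover have "c / 4 * (K * (s * norm x / 2) powr (- \<nu> - 1 / 2)) = C * norm x powr (3 / 2 - real CARD('n))"
    proof -
      have "c = (s / (2 * pi)) powr \<nu> * norm x powr (- \<nu>)"
        unfolding c_def using s x by (simp add: powr_divide powr_mult powr_minus_divide)
      moreover have "(s * norm x / 2) powr (- \<nu> - 1 / 2) = (s / 2) powr (- \<nu> - 1 / 2) * norm x powr (- \<nu> - 1 / 2)"
        using s x powr_mult[of "s / 2" "norm x" "- \<nu> - 1 / 2"] by simp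
      moreover have "norm x powr (- \<nu>) * norm x powr (- \<nu> - 1 / 2) = norm x powr (3 / 2 - real CARD('n))"
      proof -
        have "norm x powr (- \<nu>) * norm x powr (- \<nu> - 1 / 2) = norm x powr (- \<nu> + (- \<nu> - 1 / 2))"
          by (rule powr_add[symmetric])
        also have "- \<nu> + (- \<nu> - 1 / 2) = 3 / 2 - real CARD('n)" by (simp add: \<nu>_def field_simps)
        finally show ?thesis .
      qed
      moreover have "P * U / 4 * (K * (S * V)) = P / 4 * K * S * (U * V)" for P U S V :: real
        by simp
      ultimately show ?thesis unfolding C_def by metis
    qed
    ultimately show ?thesis unfolding P by simp
  qed
  moreover have "m / 4 > 0" using m by simp
  ultimately show ?thesis using r' by blast
qed

section \<open>The Legendre transform of the nonlinearity\<close>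

text \<open>The Legendre transform of \<open>A/p \<bar>s\<bar>\<^sup>p\<close> is \<open>kap p A \<bar>s\<bar>\<^bsup>p'\<^esup>\<close>.\<close>

definition kap :: "real \<Rightarrow> real \<Rightarrow> real" where
  "kap p A = (p - 1) / p * A powr (- 1 / (p - 1))"

lemma conj_exp_bounds:
  assumes "p > 1"
  shows "conj_exp p > 1" "1 / p + 1 / conj_exp p = 1" "conj_exp p - 1 = 1 / (p - 1)"
  using assms by (auto simp: conj_exp_def field_simps)

lemma kap_pos: "p > 1 \<Longrightarrow> A > 0 \<Longrightarrow> kap p A > 0"
  by (simp add: kap_def)

lemma kap_antimono: "p > 1 \<Longrightarrow> A > 0 \<Longrightarrow> A \<le> B \<Longrightarrow> kap p B \<le> kap p A"
  unfolding kap_def by (intro mult_left_mono powr_mono2') auto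

text \<open>Young's inequality for A^(1/p) |s| and A^(-1/p) |\<sigma>|; this distribution of A
  reproduces the term A/p |s|^p exactly.\<close>

lemma Young_kap:
  fixes s \<sigma> :: real
  assumes "p > 1" "A > 0"
  shows "s * \<sigma> - A / p * \<bar>s\<bar> powr p \<le> kap p A * \<bar>\<sigma>\<bar> powr conj_exp p"
proof -
  let ?q = "conj_exp p"
  note q = conj_exp_bounds[OF assms(1)]
  have "s * \<sigma> \<le> \<bar>s\<bar> * \<bar>\<sigma>\<bar>" by (metis abs_ge_self abs_mult)
  also have "\<dots> = (A powr (1 / p) * \<bar>s\<bar>) * (A powr (- 1 / p) * \<bar>\<sigma>\<bar>)"
    using assms(2) by (simp add: powr_minus field_simps)
  also have "\<dots> \<le> (A powr (1 / p) * \<bar>s\<bar>) powr p / p + (A powr (- 1 / p) * \<bar>\<sigma>\<bar>) powr ?q / ?q"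
    using assms q by (intro Youngs_inequality) auto
  also have "(A powr (1 / p) * \<bar>s\<bar>) powr p / p = A / p * \<bar>s\<bar> powr p"
    using assms by (simp add: powr_mult powr_powr)
  also have "(A powr (- 1 / p) * \<bar>\<sigma>\<bar>) powr ?q / ?q = kap p A * \<bar>\<sigma>\<bar> powr ?q"
  proof -
    have "- 1 / p * ?q = - 1 / (p - 1)" using assms(1) by (simp add: conj_exp_def field_simps)
    then have "(A powr (- 1 / p) * \<bar>\<sigma>\<bar>) powr ?q = A powr (- 1 / (p - 1)) * \<bar>\<sigma>\<bar> powr ?q"
      by (simp add: powr_mult powr_powr)
    then show ?thesis using assms(1) by (simp add: kap_def conj_exp_def)
  qed
  finally show ?thesis by linarith
qed

lemma Young_kap_eq:
  fixes \<sigma> :: real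
  assumes "p > 1" "A > 0"
  shows "\<exists>s. s * \<sigma> - A / p * \<bar>s\<bar> powr p = kap p A * \<bar>\<sigma>\<bar> powr conj_exp p"
proof (cases "\<sigma> = 0")
  case True
  then show ?thesis by (intro exI[of _ 0]) simp
next
  case False
  let ?q = "conj_exp p" and ?r = "1 / (p - 1)"
  \<comment> \<open>The stationary point of the concave expression: it solves A |s|^(p-1) sgn s =
    \<sigma>.\<close>
  define s where "s = sgn \<sigma> * (\<bar>\<sigma>\<bar> / A) powr ?r"
  have "s * \<sigma> = \<bar>\<sigma>\<bar> powr 1 * (\<bar>\<sigma>\<bar> / A) powr ?r"
    using False by (simp add: s_def sgn_if)
  also have "\<dots> = \<bar>\<sigma>\<bar> powr (1 + ?r) * A powr (- 1 / (p - 1))"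
    using assms(2) by (simp add: powr_divide powr_add powr_minus_divide)
  also have "1 + ?r = ?q" using assms by (simp add: conj_exp_def field_simps)
  finally have 1: "s * \<sigma> = \<bar>\<sigma>\<bar> powr ?q * A powr (- 1 / (p - 1))" .
  have "\<bar>s\<bar> powr p = (\<bar>\<sigma>\<bar> / A) powr (?r * p)"
    using False by (simp add: s_def abs_mult powr_powr)
  also have "?r * p = ?q" using assms by (simp add: conj_exp_def field_simps)
  also have "(\<bar>\<sigma>\<bar> / A) powr ?q = \<bar>\<sigma>\<bar> powr ?q * A powr (- ?q)"
    using assms(2) by (simp add: powr_divide powr_minus_divide)
  finally have "A * \<bar>s\<bar> powr p = \<bar>\<sigma>\<bar> powr ?q * (A powr 1 * A powr (- ?q))"
    using assms(2) by simp
  also have "A powr 1 * A powr (- ?q) = A powr (- 1 / (p - 1))"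
    unfolding powr_add[symmetric] using assms(1) by (simp add: conj_exp_def field_simps)
  finally have 2: "A / p * \<bar>s\<bar> powr p = \<bar>\<sigma>\<bar> powr ?q * A powr (- 1 / (p - 1)) / p"
    by simp
  have "s * \<sigma> - A / p * \<bar>s\<bar> powr p = \<bar>\<sigma>\<bar> powr ?q * A powr (- 1 / (p - 1)) - \<bar>\<sigma>\<bar> powr ?q * A powr (- 1 / (p - 1)) / p"
    by (simp only: 1 2)
  also have "\<dots> = kap p A * \<bar>\<sigma>\<bar> powr ?q"
    using assms(1) by (simp add: kap_def field_simps)
  finally show ?thesis by blast
qed

section \<open>Diagonal pairs minimise the coupled nonlinearity at fixed sum\<close>

lemma cosh_powr_le:
  fixes y m :: real
  assumes "m \<ge> 1"
  shows "cosh y powr m \<le> cosh (m * y)"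
proof -
  have "((1 - 1 / 2) *\<^sub>R exp y + (1 / 2) *\<^sub>R exp (- y)) powr m \<le> (1 - 1 / 2) * exp y powr m + (1 / 2) * exp (- y) powr m"
    by (rule convex_onD[OF powr_convex[OF assms]]) auto
  then show ?thesis by (simp add: cosh_field_def exp_powr_real field_simps)
qed

text \<open>After division by cosh^p the difference has derivative p (cosh((p-1) y) cosh^(-p-1) y -
  cosh^(-2) y). This is nonnegative by \<open>cosh_powr_le\<close> with m = p - 1, which is at least
  1 because p >= 2.\<close>

lemma sinh_mult_ge:
  fixes y p :: real
  assumes "p \<ge> 2" "y \<ge> 0"
  shows "p * cosh y powr (p - 1) * sinh y \<le> sinh (p * y)"
proof -
  define \<psi> where "\<psi> y = sinh (p * y) * cosh y powr (- p) - p * (sinh y / cosh y)" for y :: real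
  have "\<psi> 0 \<le> \<psi> y"
  proof (rule DERIV_nonneg_imp_nondecreasing[OF assms(2)])
    fix x :: real assume "0 \<le> x" "x \<le> y"
    have c: "cosh x > 0" by simp
    have D: "(\<psi> has_real_derivative (p * cosh (p * x) * cosh x powr (- p) + sinh (p * x) * (- p * cosh x powr (- p - 1) * sinh x)
       - p * ((cosh x * cosh x - sinh x * sinh x) / (cosh x * cosh x)))) (at x)"
      unfolding \<psi>_def[abs_def] using c
      by (auto intro!: derivative_eq_intros simp: powr_diff) (simp add: algebra_simps)
    have "cosh x * cosh x - sinh x * sinh x = 1"
      using cosh_square_eq[of x] by (simp add: power2_eq_square)
    moreover have "cosh (p * x) * cosh x powr (- p) = cosh (p * x) * cosh x * cosh x powr (- p - 1)"
      using c by (simp add: powr_diff)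
    ultimately have "p * cosh (p * x) * cosh x powr (- p) + sinh (p * x) * (- p * cosh x powr (- p - 1) * sinh x)
       - p * ((cosh x * cosh x - sinh x * sinh x) / (cosh x * cosh x)) =
      p * ((cosh (p * x) * cosh x - sinh (p * x) * sinh x) * cosh x powr (- p - 1) - 1 / (cosh x * cosh x))"
      by (simp add: algebra_simps)
    also have "cosh (p * x) * cosh x - sinh (p * x) * sinh x = cosh ((p - 1) * x)"
      by (simp add: left_diff_distrib cosh_diff)
    also have "p * (cosh ((p - 1) * x) * cosh x powr (- p - 1) - 1 / (cosh x * cosh x)) \<ge> 0"
    proof -
      have "1 / (cosh x * cosh x) = cosh x powr (- 2)"
        using c by (simp add: powr_minus powr_numeral power2_eq_square divide_inverse)
      also have "\<dots> = cosh x powr (p - 1) * cosh x powr (- p - 1)"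
        by (simp flip: powr_add)
      also have "\<dots> \<le> cosh ((p - 1) * x) * cosh x powr (- p - 1)"
        using assms by (intro mult_right_mono cosh_powr_le) auto
      finally show ?thesis using assms by simp
    qed
    finally show "\<exists>z. (\<psi> has_real_derivative z) (at x) \<and> 0 \<le> z"
      using D by blast
  qed
  then have "p * (sinh y / cosh y) \<le> sinh (p * y) * cosh y powr (- p)"
    by (simp add: \<psi>_def)
  then have "p * (sinh y / cosh y) * cosh y powr p \<le> sinh (p * y) * cosh y powr (- p) * cosh y powr p"
    by (rule mult_right_mono) simp
  moreover have "cosh y powr (- p) * cosh y powr p = 1"
    by (simp flip: powr_add)
  moreover have "cosh y powr (p - 1) = cosh y powr p / cosh y"
    by (simp add: powr_diff)
  ultimately show ?thesis by (simp add: mult.assoc mult.commute[of "sinh y"])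
qed

text \<open>The extremal case b = p - 1 of the diagonal inequality in the variable y = ln(s/t)/2.
  Both sides equal p at y = 0, and the difference increases by \<open>sinh_mult_ge\<close>.\<close>

lemma cosh_powr_mult_le:
  fixes y p :: real
  assumes "p \<ge> 2" "y \<ge> 0"
  shows "p * cosh y powr p \<le> cosh (p * y) + p - 1"
proof -
  define \<phi> where "\<phi> y = cosh (p * y) - p * cosh y powr p" for y :: real
  have "\<phi> 0 \<le> \<phi> y"
  proof (rule DERIV_nonneg_imp_nondecreasing[OF assms(2)])
    fix x :: real assume x: "0 \<le> x" "x \<le> y"
    have "(\<phi> has_real_derivative (p * (sinh (p * x) - p * cosh x powr (p - 1) * sinh x))) (at x)"
      unfolding \<phi>_def[abs_def]
      by (auto intro!: derivative_eq_intros simp: algebra_simps powr_diff)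
    moreover have "p * (sinh (p * x) - p * cosh x powr (p - 1) * sinh x) \<ge> 0"
      using sinh_mult_ge[OF assms(1) x(1)] assms by (intro mult_nonneg_nonneg) auto
    ultimately show "\<exists>z. (\<phi> has_real_derivative z) (at x) \<and> 0 \<le> z" by blast
  qed
  then show ?thesis by (simp add: \<phi>_def)
qed

text \<open>Comes from 2^x = 2 exp((x-1) ln 2) and ln 2 >= 1/2. With x = p - 1 it yields 2 + 2b <=
  2p <= 2^p, the diagonal inequality on the axes s = 0 and t = 0.\<close>

lemma two_powr_ge:
  fixes x :: real
  assumes "x \<ge> 1"
  shows "x + 1 \<le> 2 powr x"
proof -
  have l: "1 / 2 \<le> ln (2::real)" using ln_2_less_1 ln2_ge_two_thirds by linarith
  define L where "L = (x - 1) * ln 2"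
  have "(x - 1) * (1 / 2) \<le> L" unfolding L_def using l assms by (intro mult_left_mono) auto
  moreover have "1 + L \<le> exp L" by (rule exp_ge_add_one_self)
  moreover have "2 powr x = 2 * exp L"
    by (simp add: L_def powr_def left_diff_distrib exp_diff)
  moreover have "x + 1 = 2 * (1 + (x - 1) * (1 / 2))" by (simp add: field_simps)
  ultimately show ?thesis by (smt (verit))
qed

text \<open>With s = g e^y, t = g e^(-y) and g = sqrt(s t) the claim becomes (1 + b) cosh^p y <=
  cosh(p y) + b. For b = p - 1 this is \<open>cosh_powr_mult_le\<close>; for smaller b the
  difference is the nonnegative (p - 1 - b)(cosh^p y - 1). Expansion to second order at y = 0 shows
  that the bound on b is sharp.\<close>

lemma diagonal_minimises:
  fixes s t p b :: real
  assumes p: "p \<ge> 2" and b: "0 \<le> b" "b \<le> p - 1" and st: "s \<ge> 0" "t \<ge> 0"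
  shows "(2 + 2 * b) * ((s + t) / 2) powr p \<le> s powr p + 2 * b * s powr (p / 2) * t powr (p / 2) + t powr p"
proof -
  have zero: "(2 + 2 * b) * (s / 2) powr p \<le> s powr p" if "s \<ge> 0" for s :: real
  proof -
    have "2 powr p = 2 powr (p - 1) * 2" by (simp add: powr_diff)
    then have "2 + 2 * b \<le> 2 powr p" using two_powr_ge[of "p - 1"] p b by linarith
    then have "(2 + 2 * b) * (s powr p / 2 powr p) \<le> 2 powr p * (s powr p / 2 powr p)"
      by (intro mult_right_mono) auto
    then show ?thesis using that by (simp add: powr_divide)
  qed
  have main: "(2 + 2 * b) * ((s + t) / 2) powr p \<le> s powr p + 2 * b * s powr (p / 2) * t powr (p / 2) + t powr p"
    if st: "0 < t" "t \<le> s" for s t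
  proof -
    define g where "g = sqrt (s * t)"
    define y where "y = ln (s / t) / 2"
    have y: "y \<ge> 0" using st by (simp add: y_def)
    have g: "g > 0" using st by (simp add: g_def)
    have gy: "g * exp y = s" "g * exp (- y) = t"
    proof -
      have e: "exp y = sqrt (s / t)"
        using st by (simp add: y_def ln_sqrt[symmetric])
      show "g * exp y = s" "g * exp (- y) = t"
        using st unfolding exp_minus e g_def by (simp_all add: real_sqrt_mult real_sqrt_divide field_simps)
    qed
    have m: "(s + t) / 2 = g * cosh y"
      using gy by (simp add: cosh_field_def algebra_simps)
    have sp: "s powr p + t powr p = 2 * (g powr p * cosh (p * y))"
    proof -
      have "s powr p = g powr p * exp (p * y)" "t powr p = g powr p * exp (- (p * y))"
        using g by (auto simp flip: gy simp: powr_mult exp_powr_real mult.commute)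
      then show ?thesis by (simp add: cosh_field_def algebra_simps)
    qed
    have "s powr (p / 2) * t powr (p / 2) = (s * t) powr (p / 2)"
      using st by (simp add: powr_mult)
    also have "\<dots> = g powr p"
      using st by (simp add: g_def powr_half_sqrt[symmetric] powr_powr)
    finally have stp: "s powr (p / 2) * t powr (p / 2) = g powr p" .
    define C where "C = cosh y powr p"
    have C: "C \<ge> 1" unfolding C_def using p by (intro ge_one_powr_ge_zero) (auto simp: cosh_real_ge_1)
    have "p * C \<le> cosh (p * y) + p - 1" unfolding C_def by (rule cosh_powr_mult_le[OF p y])
    moreover have "0 \<le> (p - 1 - b) * (C - 1)" using b C by simp
    ultimately have "(2 + 2 * b) * C \<le> 2 * cosh (p * y) + 2 * b" by (simp add: algebra_simps)
    then have "g powr p * ((2 + 2 * b) * C) \<le> g powr p * (2 * cosh (p * y) + 2 * b)"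
      by (intro mult_left_mono) auto
    moreover have "(2 + 2 * b) * ((s + t) / 2) powr p = g powr p * ((2 + 2 * b) * C)"
      unfolding m using g by (simp add: powr_mult C_def)
    moreover have "s powr p + 2 * b * s powr (p / 2) * t powr (p / 2) + t powr p = g powr p * (2 * cosh (p * y) + 2 * b)"
      using sp stp by (simp add: algebra_simps)
    ultimately show ?thesis by linarith
  qed
  consider "t = 0" | "s = 0" | "0 < t" "t \<le> s" | "0 < s" "s \<le> t" using st by linarith
  then show ?thesis
  proof cases
    case 1
    then show ?thesis using zero[OF st(1)] p by simp
  next
    case 2
    then show ?thesis using zero[OF st(2)] p by simp
  next
    case 3
    then show ?thesis by (rule main)
  next
    case 4
    then show ?thesis using main[OF 4] by (simp add: add.commute mult_ac)
  qed
qed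

section \<open>Pointwise estimates for the Legendre transform at a fixed point x\<close>

locale nonlinearity =
  fixes a b :: "real ^ 'n \<Rightarrow> real" and p :: real and x :: "real ^ 'n"
  assumes p: "p > 2" and a: "a x > 0" and b: "b x \<ge> 0"
begin

abbreviation "f \<equiv> f_nl a b p x"
abbreviation "h \<equiv> h_nl a b p x"
abbreviation "p' \<equiv> conj_exp p"

lemma f_ge: "f s t \<ge> a x / p * \<bar>s\<bar> powr p + a x / p * \<bar>t\<bar> powr p"
proof -
  have "0 \<le> a x / p * (2 * b x * \<bar>s\<bar> powr (p / 2) * \<bar>t\<bar> powr (p / 2))"
    using p a b by (intro mult_nonneg_nonneg) auto
  then show ?thesis unfolding f_nl_def by (simp add: algebra_simps)
qed

lemma f_zero_right: "f s 0 = a x / p * \<bar>s\<bar> powr p"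
  using p by (simp add: f_nl_def)

lemma integrand_le: "s * s' + t * t' - f s t \<le> kap p (a x) * \<bar>s'\<bar> powr p' + kap p (a x) * \<bar>t'\<bar> powr p'"
  using f_ge[of s t] Young_kap[of p "a x" s s'] Young_kap[of p "a x" t t'] p a by linarith

lemma integrand_le_h: "s * s' + t * t' - f s t \<le> h s' t'"
proof -
  have "bdd_above (range (\<lambda>(s, t). s * s' + t * t' - f s t))"
    using integrand_le by (intro bdd_aboveI2) auto
  then show ?thesis
    unfolding h_nl_def using cSUP_upper[of "(s, t)" UNIV "\<lambda>(s, t). s * s' + t * t' - f s t"] by simp
qed

lemma h_le:
  assumes "\<And>s t. s * s' + t * t' - f s t \<le> C"
  shows "h s' t' \<le> C"
  unfolding h_nl_def by (rule cSUP_least) (use assms in auto)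

lemma h_nonneg: "0 \<le> h s' t'"
  using integrand_le_h[of 0 s' 0 t'] p by (simp add: f_nl_def)

lemma h_upper: "h s' t' \<le> kap p (a x) * (\<bar>s'\<bar> powr p' + \<bar>t'\<bar> powr p')"
  by (rule h_le) (use integrand_le in \<open>simp add: distrib_left\<close>)

lemma h_sym: "h s' t' = h t' s'"
proof -
  have "h s' t' \<le> h t' s'" for s' t'
  proof (rule h_le)
    fix s t
    have "f s t = f t s" by (simp add: f_nl_def mult_ac)
    then show "s * s' + t * t' - f s t \<le> h t' s'"
      using integrand_le_h[of t t' s s'] by simp
  qed
  then show ?thesis using antisym by blast
qed

lemma h_ge_left: "kap p (a x) * \<bar>s'\<bar> powr p' \<le> h s' t'"
proof -
  obtain s where "s * s' - a x / p * \<bar>s\<bar> powr p = kap p (a x) * \<bar>s'\<bar> powr p'"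
    using Young_kap_eq[of p "a x" s'] p a by auto
  then show ?thesis using integrand_le_h[of s s' 0 t'] by (simp add: f_zero_right)
qed

text \<open>Averages the two bounds obtained by testing the supremum with t = 0 and with s = 0; it
  makes the potential coercive in both components.\<close>

lemma h_lower: "kap p (a x) / 2 * (\<bar>s'\<bar> powr p' + \<bar>t'\<bar> powr p') \<le> h s' t'"
  using h_ge_left[of s' t'] h_ge_left[of t' s'] h_sym[of s' t'] by (simp add: algebra_simps)

lemma h_zero_right: "h s' 0 = kap p (a x) * \<bar>s'\<bar> powr p'"
  using h_upper[of s' 0] h_ge_left[of s' 0] by simp

text \<open>One inequality is proved for every nonzero factor by rescaling the test pair; applied to
  1/c it gives the reverse one.\<close>

lemma h_homogeneous: "h (c * s') (c * t') = \<bar>c\<bar> powr p' * h s' t'"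
proof (cases "c = 0")
  case True
  then show ?thesis using h_zero_right[of 0] by simp
next
  case False
  have le: "h (c * s') (c * t') \<le> \<bar>c\<bar> powr p' * h s' t'" if c: "c \<noteq> 0" for c s' t'
  proof (rule h_le)
    fix s t
    \<comment> \<open>The test pair (k s, k t) has to multiply f by |c|^(-p'). As (p' - 1) p = p',
      this fixes |k| = |c|^(-(p' - 1)), and then |c|^p' k = c.\<close>
    define k where "k = sgn c * \<bar>c\<bar> powr (- (p' - 1))"
    have ck: "c = \<bar>c\<bar> powr p' * k"
    proof -
      have "\<bar>c\<bar> powr p' * k = sgn c * (\<bar>c\<bar> powr p' * \<bar>c\<bar> powr (- (p' - 1)))" by (simp add: k_def)
      also have "\<dots> = sgn c * \<bar>c\<bar>" unfolding powr_add[symmetric] using c by simp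
      finally show ?thesis by (simp add: sgn_mult_abs)
    qed
    have qp: "- (p' - 1) * p = - p'" using p by (simp add: conj_exp_def field_simps)
    have k: "\<bar>k\<bar> powr p = \<bar>c\<bar> powr (- p')"
      using c qp by (simp add: k_def abs_mult powr_powr)
    have k2: "\<bar>k\<bar> powr (p / 2) * \<bar>k\<bar> powr (p / 2) = \<bar>k\<bar> powr p"
      by (simp flip: powr_add)
    have "f (k * s) (k * t) = \<bar>k\<bar> powr p * f s t"
    proof -
      have "\<bar>k * s\<bar> powr (p / 2) * \<bar>k * t\<bar> powr (p / 2) = \<bar>k\<bar> powr p * (\<bar>s\<bar> powr (p / 2) * \<bar>t\<bar> powr (p / 2))"
        unfolding k2[symmetric] by (simp add: abs_mult powr_mult)
      moreover have "\<bar>k * s\<bar> powr p = \<bar>k\<bar> powr p * \<bar>s\<bar> powr p" "\<bar>k * t\<bar> powr p = \<bar>k\<bar> powr p * \<bar>t\<bar> powr p"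
        by (simp_all add: abs_mult powr_mult)
      ultimately show ?thesis unfolding f_nl_def by (simp add: algebra_simps)
    qed
    then have "\<bar>c\<bar> powr p' * f (k * s) (k * t) = f s t"
      using c by (simp add: k flip: powr_add)
    then have "s * (c * s') + t * (c * t') - f s t = \<bar>c\<bar> powr p' * ((k * s) * s' + (k * t) * t' - f (k * s) (k * t))"
      by (subst (1 2) ck) (simp add: algebra_simps)
    also have "\<dots> \<le> \<bar>c\<bar> powr p' * h s' t'"
      by (intro mult_left_mono integrand_le_h) auto
    finally show "s * (c * s') + t * (c * t') - f s t \<le> \<bar>c\<bar> powr p' * h s' t'" .
  qed
  have "h s' t' = h (1 / c * (c * s')) (1 / c * (c * t'))" using False by simp
  also have "\<dots> \<le> \<bar>1 / c\<bar> powr p' * h (c * s') (c * t')"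
    using False by (intro le) auto
  finally have "\<bar>c\<bar> powr p' * h s' t' \<le> h (c * s') (c * t')"
    using False by (simp add: powr_divide field_simps)
  then show ?thesis using le[OF False, of s' t'] by simp
qed

text \<open>On the diagonal the linear term sees only s + t, and at fixed |s| + |t| the nonlinearity
  is smallest at the mean. What remains is twice a scalar Young inequality with coefficient A (1 +
  B).\<close>

lemma h_diagonal:
  assumes "0 < A" "A \<le> a x" "0 \<le> B" "B \<le> p - 1" "B \<le> b x"
  shows "h s' s' \<le> 2 * kap p (A * (1 + B)) * \<bar>s'\<bar> powr p'"
proof (rule h_le)
  fix s t :: real
  define m where "m = (\<bar>s\<bar> + \<bar>t\<bar>) / 2"
  have "s * s' + t * s' \<le> 2 * (m * \<bar>s'\<bar>)"
    using abs_ge_self[of "s * s'"] abs_ge_self[of "t * s'"] by (simp add: m_def abs_mult algebra_simps)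
  moreover have "A / p * ((2 + 2 * B) * m powr p) \<le> f s t"
  proof -
    have "A / p * ((2 + 2 * B) * m powr p) \<le> A / p * (\<bar>s\<bar> powr p + 2 * B * \<bar>s\<bar> powr (p / 2) * \<bar>t\<bar> powr (p / 2) + \<bar>t\<bar> powr p)"
      unfolding m_def using p assms by (intro mult_left_mono diagonal_minimises) auto
    also have "\<dots> \<le> a x / p * (\<bar>s\<bar> powr p + 2 * b x * \<bar>s\<bar> powr (p / 2) * \<bar>t\<bar> powr (p / 2) + \<bar>t\<bar> powr p)"
      using p a assms by (intro mult_mono divide_right_mono add_mono mult_right_mono order_refl add_nonneg_nonneg) auto
    finally show ?thesis by (simp add: f_nl_def)
  qed
  moreover have "m * \<bar>s'\<bar> - A * (1 + B) / p * \<bar>m\<bar> powr p \<le> kap p (A * (1 + B)) * \<bar>\<bar>s'\<bar>\<bar> powr p'"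
    using p assms by (intro Young_kap) auto
  moreover have "\<bar>m\<bar> = m" by (simp add: m_def)
  moreover have "A / p * ((2 + 2 * B) * m powr p) = 2 * (A * (1 + B) / p * m powr p)"
    by (simp add: algebra_simps add_divide_distrib)
  ultimately show "s * s' + t * s' - f s t \<le> 2 * kap p (A * (1 + B)) * \<bar>s'\<bar> powr p'"
    by (simp only: abs_abs)
qed

end

text \<open>Where \<open>\<bar>s'\<bar> \<ge> \<eta>\<close>, maximisers of the Legendre transform have \<open>s\<close> bounded away from \<open>0\<close>, so that
  the coupling term \<open>\<bar>t\<bar>\<^bsup>p/2\<^esup>\<close> controls the linear term \<open>t * t'\<close>.\<close>

lemma h_perturbation:
  fixes p A0 A1 B0 \<eta> :: real
  assumes "2 < p" "p < 4" "0 < A0" "A0 \<le> A1" "0 < B0" "\<eta> > 0"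
  shows "\<exists>\<tau>>0. \<exists>K\<ge>0. \<forall>a b (x::real ^ 'n) s' t'. A0 \<le> a x \<longrightarrow> a x \<le> A1 \<longrightarrow> B0 \<le> b x \<longrightarrow> \<eta> \<le> \<bar>s'\<bar> \<longrightarrow> \<bar>t'\<bar> \<le> \<tau>
    \<longrightarrow> h_nl a b p x s' t' \<le> h_nl a b p x s' 0 + K * \<bar>t'\<bar> powr (p / (p - 2))"
proof -
  define q where "q = conj_exp p"
  have q: "q > 1" using conj_exp_bounds[of p] assms by (auto simp: q_def)
  \<comment> \<open>The lower bound \<open>kap p A1\<close> |s'|^q for \<open>h s' 0\<close> is
    spent in two halves: if |s| < \<sigma>, the term s s' uses at most one half, and |t'| <= \<tau>
    keeps the gain from t below g, hence within the other half.\<close>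
  define g where "g = kap p A1 / 2 * \<eta> powr q"
  define \<sigma> where "\<sigma> = kap p A1 / 2 * \<eta> powr (q - 1)"
  have pos: "g > 0" "\<sigma> > 0" "kap p A0 > 0" using assms by (auto simp: g_def \<sigma>_def kap_pos)
  define \<tau> where "\<tau> = (g / kap p A0) powr (1 / q)"
  \<comment> \<open>m is the power of |t| in the coupling term; its conjugate exponent p/(p-2) is
    the power of |t'| in the conclusion.\<close>
  define m where "m = p / 2"
  define c where "c = 2 * A0 * B0 / p * \<sigma> powr m"
  have c: "c > 0" using assms pos by (simp add: c_def)
  have m: "m > 1" "conj_exp m = p / (p - 2)" using assms by (auto simp: m_def conj_exp_def field_simps)
  define K where "K = kap m (m * c)"
  have K: "K > 0" using m c by (simp add: K_def kap_pos)
  have "h_nl a b p x s' t' \<le> h_nl a b p x s' 0 + K * \<bar>t'\<bar> powr (p / (p - 2))"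
    if ax: "A0 \<le> a x" "a x \<le> A1" "B0 \<le> b x" "\<eta> \<le> \<bar>s'\<bar>" "\<bar>t'\<bar> \<le> \<tau>" for a b and x :: "real ^ 'n" and s' t'
  proof -
    interpret nonlinearity a b p x
      using assms ax by unfold_locales auto
    show ?thesis
    proof (rule h_le)
      fix s t
      show "s * s' + t * t' - f s t \<le> h s' 0 + K * \<bar>t'\<bar> powr (p / (p - 2))"
      proof (cases "\<bar>s\<bar> \<ge> \<sigma>")
        case True
        have "c * \<bar>t\<bar> powr m \<le> a x / p * (2 * b x * \<bar>s\<bar> powr (p / 2) * \<bar>t\<bar> powr (p / 2))"
        proof -
          have "(2 * A0 * B0 / p * \<sigma> powr m) * \<bar>t\<bar> powr m \<le> (2 * a x * b x / p * \<bar>s\<bar> powr m) * \<bar>t\<bar> powr m"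
            using assms ax pos True m by (intro mult_right_mono mult_mono divide_right_mono powr_mono2 mult_nonneg_nonneg) auto
          then show ?thesis by (simp add: c_def m_def mult_ac)
        qed
        moreover have "a x / p * (2 * b x * \<bar>s\<bar> powr (p / 2) * \<bar>t\<bar> powr (p / 2)) + a x / p * \<bar>s\<bar> powr p \<le> f s t"
          using assms a by (simp add: f_nl_def distrib_left)
        moreover have "s * s' - a x / p * \<bar>s\<bar> powr p \<le> h s' 0"
          using integrand_le_h[of s s' 0 0] by (simp add: f_zero_right)
        moreover have "t * t' - m * c / m * \<bar>t\<bar> powr m \<le> K * \<bar>t'\<bar> powr conj_exp m"
          unfolding K_def using m c by (intro Young_kap) auto
        ultimately show ?thesis using m by simp
      next
        case False
        have s': "\<bar>s'\<bar> > 0" using ax assms by linarith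
        have k1: "kap p A1 \<le> kap p (a x)" using assms ax by (intro kap_antimono) auto
        have k0: "kap p (a x) \<le> kap p A0" using assms ax by (intro kap_antimono) auto
        have kp: "kap p A1 > 0" using assms by (intro kap_pos) auto
        have "\<sigma> * \<bar>s'\<bar> \<le> kap p A1 / 2 * \<bar>s'\<bar> powr q"
        proof -
          have "\<eta> powr (q - 1) * \<bar>s'\<bar> \<le> \<bar>s'\<bar> powr (q - 1) * \<bar>s'\<bar>"
            using ax q assms by (intro mult_right_mono powr_mono2) auto
          also have "\<dots> = \<bar>s'\<bar> powr q" using s' by (simp add: powr_diff)
          finally show ?thesis using kp by (simp add: \<sigma>_def)
        qed
        moreover have "s * s' \<le> \<sigma> * \<bar>s'\<bar>"
        proof -
          have "s * s' \<le> \<bar>s\<bar> * \<bar>s'\<bar>" by (metis abs_ge_self abs_mult)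
          also have "\<dots> \<le> \<sigma> * \<bar>s'\<bar>" using False by (intro mult_right_mono) auto
          finally show ?thesis .
        qed
        moreover have "g \<le> kap p A1 / 2 * \<bar>s'\<bar> powr q"
          unfolding g_def using kp ax q assms by (intro mult_left_mono powr_mono2) auto
        moreover have "kap p A1 * \<bar>s'\<bar> powr q \<le> h s' 0"
          unfolding h_zero_right using k1 by (simp add: q_def mult_right_mono)
        moreover have "t * t' - a x / p * \<bar>t\<bar> powr p \<le> g"
        proof -
          have "t * t' - a x / p * \<bar>t\<bar> powr p \<le> kap p (a x) * \<bar>t'\<bar> powr q"
            unfolding q_def using assms a by (intro Young_kap) auto
          also have "\<dots> \<le> kap p A0 * \<tau> powr q"
            using k0 ax q pos by (intro mult_mono powr_mono2) auto
          also have "\<tau> powr q = g / kap p A0" using q pos by (simp add: \<tau>_def powr_powr)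
          finally show ?thesis using pos by simp
        qed
        moreover have "a x / p * \<bar>t\<bar> powr p \<le> f s t"
          using f_ge[of s t] a p by (smt (verit) divide_nonneg_nonneg mult_nonneg_nonneg powr_ge_zero)
        moreover have "0 \<le> K * \<bar>t'\<bar> powr (p / (p - 2))" using K by simp
        ultimately show ?thesis by linarith
      qed
    qed
  qed
  moreover have "\<tau> > 0" using pos by (simp add: \<tau>_def)
  ultimately show ?thesis using K by (intro exI[of _ \<tau>] exI[of _ K] conjI) auto
qed

section \<open>Mountain pass level\<close>

text \<open>The real supremum of an unbounded set is unspecified but depends only on the set of
  upper bounds, which is empty. So it is one and the same number for all such sets, and h stays
  measurable across points where its supremum is infinite.\<close>

lemma unbounded_Sup_real_const:
  assumes "\<not> bdd_above (X :: real set)" "\<not> bdd_above (Y :: real set)"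
  shows "Sup X = Sup Y"
proof -
  have "(\<lambda>z. \<forall>x\<in>W. x \<le> z) = (\<lambda>z. False)" if "\<not> bdd_above W" for W :: "real set"
    using that by (auto simp: bdd_above_def fun_eq_iff)
  then show ?thesis using assms by (simp add: Sup_real_def)
qed

text \<open>Continuity in (s, t) reduces the uncountable supremum to a countable dense set, taken in
  the extended reals. Where that supremum is infinite, h equals the constant Z.\<close>

lemma h_nl_measurable:
  fixes a b u v :: "real ^ 'n \<Rightarrow> real"
  assumes [measurable]: "a \<in> borel_measurable borel" "b \<in> borel_measurable borel"
    "u \<in> borel_measurable borel" "v \<in> borel_measurable borel" and "p > 0"
  shows "(\<lambda>x. h_nl a b p x (u x) (v x)) \<in> borel_measurable borel"
proof -
  define \<phi> where "\<phi> x r = fst r * u x + snd r * v x - f_nl a b p x (fst r) (snd r)" for x and r :: "real \<times> real"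
  obtain D :: "(real \<times> real) set" where D: "countable D" "\<And>X. open X \<Longrightarrow> X \<noteq> {} \<Longrightarrow> \<exists>d\<in>D. d \<in> X"
    using countable_dense_setE by blast
  have Dne: "D \<noteq> {}" using D(2)[of UNIV] by auto
  define e where "e x = (SUP r\<in>D. ereal (\<phi> x r))" for x
  have [measurable]: "(\<lambda>x. \<phi> x r) \<in> borel_measurable borel" for r
    unfolding \<phi>_def f_nl_def by measurable
  have [measurable]: "e \<in> borel_measurable borel"
    unfolding e_def by (rule borel_measurable_SUP[OF D(1)]) measurable
  have cont: "continuous_on UNIV (\<phi> x)" for x
  proof -
    have pw: "continuous_on UNIV (\<lambda>r. \<bar>g r\<bar> powr c)" if "continuous_on UNIV g" "c > 0" for g :: "real \<times> real \<Rightarrow> real" and c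
      using that by (intro continuous_on_powr' continuous_on_rabs continuous_on_const) auto
    have "continuous_on UNIV (\<lambda>r :: real \<times> real. \<bar>fst r\<bar> powr c)" "continuous_on UNIV (\<lambda>r :: real \<times> real. \<bar>snd r\<bar> powr c)" if "c > 0" for c :: real
      using pw[OF continuous_on_fst[OF continuous_on_id] that] pw[OF continuous_on_snd[OF continuous_on_id] that]
      by auto
    then show ?thesis
      unfolding \<phi>_def[abs_def] f_nl_def using \<open>p > 0\<close>
      by (intro continuous_on_diff continuous_on_add continuous_on_mult continuous_on_const
          continuous_on_fst continuous_on_snd continuous_on_id) auto
  qed
  have le_e: "ereal (\<phi> x z) \<le> e x" for x z
  proof (rule ccontr)
    assume "\<not> ereal (\<phi> x z) \<le> e x"
    then obtain c where c: "e x < ereal c" "ereal c < ereal (\<phi> x z)"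
      using ereal_dense2[of "e x" "ereal (\<phi> x z)"] by (metis not_le)
    have "open (\<phi> x -` {c<..})"
      by (rule open_vimage[OF open_greaterThan cont])
    moreover have "z \<in> \<phi> x -` {c<..}" using c by auto
    ultimately obtain d where "d \<in> D" "c < \<phi> x d"
      using D(2)[of "\<phi> x -` {c<..}"] by (metis empty_iff greaterThan_iff vimageD)
    moreover have "ereal (\<phi> x d) \<le> e x"
      unfolding e_def using \<open>d \<in> D\<close> by (rule SUP_upper)
    ultimately show False using c by (metis ereal_less_eq(3) less_le_trans less_imp_le not_less order_trans)
  qed
  have h: "h_nl a b p x (u x) (v x) = Sup (range (\<phi> x))" for x
    unfolding h_nl_def \<phi>_def by (simp add: case_prod_beta)
  define Z where "Z = Sup (UNIV :: real set)"
  have "h_nl a b p x (u x) (v x) = (if e x < \<infinity> then real_of_ereal (e x) else Z)" for x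
  proof (cases "e x < \<infinity>")
    case True
    obtain d where "d \<in> D" using Dne by auto
    have "e x \<noteq> -\<infinity>" using le_e[of x undefined] by auto
    then have er: "e x = ereal (real_of_ereal (e x))" using True by (cases "e x") auto
    have ub: "\<phi> x z \<le> real_of_ereal (e x)" for z
      using le_e[of x z] er by (metis ereal_less_eq(3))
    then have bdd: "bdd_above (range (\<phi> x))" by (rule bdd_aboveI2)
    have "Sup (range (\<phi> x)) \<le> real_of_ereal (e x)"
      using ub by (intro cSUP_least) auto
    moreover have "e x \<le> ereal (Sup (range (\<phi> x)))"
      unfolding e_def using bdd by (intro SUP_least) (auto intro: cSUP_upper)
    then have "real_of_ereal (e x) \<le> Sup (range (\<phi> x))"
      by (subst (asm) er) simp
    ultimately show ?thesis using True by (simp add: h)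
  next
    case False
    have "\<not> bdd_above (range (\<phi> x))"
    proof
      assume "bdd_above (range (\<phi> x))"
      then obtain M where "\<And>z. \<phi> x z \<le> M" by (auto simp: bdd_above_def)
      then have "e x \<le> ereal M" unfolding e_def by (intro SUP_least) auto
      then show False using False by auto
    qed
    moreover have "\<not> bdd_above (UNIV :: real set)"
      by (metis bdd_above_def gt_ex iso_tuple_UNIV_I not_less)
    ultimately have "Sup (range (\<phi> x)) = Z"
      unfolding Z_def by (rule unbounded_Sup_real_const)
    then show ?thesis using False by (simp add: h)
  qed
  then show ?thesis by simp
qed

lemma powr_bernoulli:
  fixes y \<theta> :: real
  assumes "y \<ge> 0" "0 < \<theta>" "\<theta> < 1"
  shows "y powr \<theta> \<le> 1 - \<theta> + \<theta> * y"
proof (cases "y = 0")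
  case False
  then show ?thesis
    using Youngs_inequality_0[of \<theta> "1 - \<theta>" y 1] assms by simp
qed (use assms in auto)

text \<open>The value of \<open>t\<^sup>q A - t\<^sup>2 B / 2\<close> at its maximum point \<open>t = (q A / B)\<^bsup>1/(2-q)\<^esup>\<close>.\<close>

lemma ray_maximum:
  fixes A B q t :: real
  assumes "1 < q" "q < 2" "A \<ge> 0" "B > 0" "t \<ge> 0"
  shows "t powr q * A - t\<^sup>2 * B / 2 \<le> (1 - q / 2) * A * (q * A / B) powr (q / (2 - q))"
proof (cases "A = 0")
  case True
  then show ?thesis using assms by simp
next
  case False
  then have A: "A > 0" using assms by simp
  define s where "s = (q * A / B) powr (1 / (2 - q))"
  have s: "s > 0" using A assms by (simp add: s_def)
  have sq: "s powr q = (q * A / B) powr (q / (2 - q))" by (simp add: s_def powr_powr)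
  have s2q: "s powr (2 - q) = q * A / B" using assms A by (simp add: s_def powr_powr)
  have "s powr q * s powr (2 - q) = s powr 2" by (simp flip: powr_add)
  then have s2: "s powr q * (q * A) = s\<^sup>2 * B"
    using s assms unfolding s2q by (simp add: powr_numeral field_simps)
  \<comment> \<open>The tangent of y^(q/2) at y = 1, taken at y = (t/s)^2, turns t^q into a
    quadratic in t; the choice of s makes its quadratic part cancel t^2 B / 2.\<close>
  have "t powr q = s powr q * ((t / s)\<^sup>2) powr (q / 2)"
  proof -
    have "((t / s)\<^sup>2) powr (q / 2) = (t / s) powr q"
    proof (cases "t = 0")
      case False
      then have "(t / s)\<^sup>2 = (t / s) powr 2" using assms s by (simp add: powr_numeral)
      then show ?thesis by (simp add: powr_powr)
    qed simp
    then show ?thesis using assms s by (simp add: powr_divide)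
  qed
  also have "\<dots> \<le> s powr q * (1 - q / 2 + q / 2 * (t / s)\<^sup>2)"
    using assms by (intro mult_left_mono powr_bernoulli) auto
  finally have "t powr q * A \<le> s powr q * (1 - q / 2 + q / 2 * (t / s)\<^sup>2) * A"
    using assms by (intro mult_right_mono) auto
  also have "\<dots> = (1 - q / 2) * A * s powr q + (s powr q * (q * A)) * (t / s)\<^sup>2 / 2"
    by (simp add: algebra_simps)
  also have "\<dots> = (1 - q / 2) * A * s powr q + t\<^sup>2 * B / 2"
    unfolding s2 using s by (simp add: power_divide)
  finally show ?thesis by (simp add: sq)
qed

text \<open>Raising the comparison of ray maxima to the power 2 - q clears the exponent q / (2 - q).
  With B = q A, as at a critical point, the conclusion reads A^2 / B^q <= A'^2 / B'^q.\<close>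

lemma quotient_comparison:
  fixes A A' B' q :: real
  assumes "1 < q" "q < 2" "A > 0" "A' \<ge> 0" "B' > 0"
    and le: "(1 - q / 2) * A \<le> (1 - q / 2) * A' * (q * A' / B') powr (q / (2 - q))"
  shows "A\<^sup>2 * B' powr q \<le> A'\<^sup>2 * (q * A) powr q"
proof -
  have "A \<le> A' * (q * A' / B') powr (q / (2 - q))"
    using le assms(2) by (simp add: mult.assoc)
  then have "A powr (2 - q) \<le> (A' * (q * A' / B') powr (q / (2 - q))) powr (2 - q)"
    using assms by (intro powr_mono2) auto
  also have "\<dots> = A' powr (2 - q) * (q * A' / B') powr q"
    using assms by (simp add: powr_mult powr_powr)
  also have "\<dots> = (A' powr (2 - q) * A' powr q) * (q powr q / B' powr q)"
    using assms by (simp add: powr_mult powr_divide)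
  also have "A' powr (2 - q) * A' powr q = A'\<^sup>2"
    using assms by (cases "A' = 0") (auto simp: powr_numeral simp flip: powr_add)
  finally have "A powr (2 - q) * (A powr q * B' powr q) \<le> (A'\<^sup>2 * (q powr q / B' powr q)) * (A powr q * B' powr q)"
    by (rule mult_right_mono) simp
  also have "\<dots> = A'\<^sup>2 * (q * A) powr q"
    using assms by (simp add: powr_mult)
  also have "A powr (2 - q) * (A powr q * B' powr q) = A\<^sup>2 * B' powr q"
    using assms by (simp add: powr_numeral flip: mult.assoc powr_add)
  finally show ?thesis .
qed

lemma AE_lborel_constD:
  assumes "AE x in (lborel :: 'a::euclidean_space measure). P"
  shows P
proof (rule ccontr)
  assume "\<not> P"
  then have "AE x in (lborel :: 'a measure). False" using assms by auto
  then have "emeasure (lborel :: 'a measure) UNIV = 0"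
    by (simp add: AE_iff_measurable[OF _ refl])
  then show False by simp
qed

section \<open>The dual functional under almost everywhere bounds on the coefficients\<close>

locale dual_problem =
  fixes a b :: "real ^ 'n \<Rightarrow> real" and p a0 a1 :: real
  assumes p: "p > 2"
    and a_measurable: "a \<in> borel_measurable borel" and b_measurable: "b \<in> borel_measurable borel"
    and a0: "a0 > 0" and a_bounds: "AE x in lborel. a0 \<le> a x \<and> a x \<le> a1"
    and b_bounds: "AE x in lborel. 0 \<le> b x"
begin

abbreviation "q \<equiv> conj_exp p"

lemma q: "1 < q" "q < 2" "q > 0" "1 / p + 1 / q = 1"
  using p by (auto simp: conj_exp_def field_simps)

lemma a0_le_a1: "a0 \<le> a1"
proof -
  have "AE x in (lborel :: (real ^ 'n) measure). a0 \<le> a1"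
    using a_bounds by eventually_elim simp
  then show ?thesis by (rule AE_lborel_constD)
qed

lemma nonlinearity_AE: "AE x in lborel. nonlinearity a b p x"
  using a_bounds b_bounds by eventually_elim (use p a0 in unfold_locales, auto)

definition potential :: "'n field_pair \<Rightarrow> real" where
  "potential w = (LINT x|lborel. h_nl a b p x (fst w x) (snd w x))"

definition form :: "real \<Rightarrow> (real ^ 'n \<Rightarrow> real) \<Rightarrow> real" where
  "form l g = (LINT x|lborel. g x * Psi_op p l g x)"

text \<open>True for the dummy operator 0 as well, so the variational framework is available before
  an extension is known to exist.\<close>

lemma Psi_op_bounded: "bounded_op q p (Psi_op p l :: (real ^ 'n \<Rightarrow> real) \<Rightarrow> _)"
proof (cases "\<exists>T. conv_extension p (Psi l :: real ^ 'n \<Rightarrow> real) T")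
  case True
  then have "conv_extension p (Psi l :: real ^ 'n \<Rightarrow> real) (Psi_op p l)"
    unfolding Psi_op_def using someI_ex[OF True] by simp
  then show ?thesis unfolding conv_extension_def bounded_op_def by blast
next
  case False
  then have eq: "(Psi_op p l :: (real ^ 'n \<Rightarrow> real) \<Rightarrow> _) = (\<lambda>g x. 0)" by (simp add: Psi_op_def)
  show ?thesis unfolding bounded_op_def eq using p
    by (auto simp: Lq_norm_zero intro!: exI[of _ 0])
qed

lemma form_integrable: "(g :: real ^ 'n \<Rightarrow> real) \<in> Lq q \<Longrightarrow> integrable lborel (\<lambda>x. g x * Psi_op p l g x)"
proof -
  assume g: "g \<in> Lq q"
  have "p > 1" using p by simp
  then show ?thesis by (rule Hoelder(1)[OF _ q(1,4) g bounded_opD(1)[OF Psi_op_bounded g]])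
qed

lemma form_bound: "\<exists>C>0. \<forall>g\<in>Lq q. \<bar>form l g\<bar> \<le> C * (Lq_norm q g)\<^sup>2"
proof -
  obtain C where C: "C > 0" "\<And>g :: real ^ 'n \<Rightarrow> real. g \<in> Lq q \<Longrightarrow> Lq_norm p (Psi_op p l g) \<le> C * Lq_norm q g"
    using bounded_op_bound[OF Psi_op_bounded] by blast
  have "\<bar>form l g\<bar> \<le> C * (Lq_norm q g)\<^sup>2" if g: "g \<in> Lq q" for g
  proof -
    have "\<bar>form l g\<bar> \<le> Lq_norm q g * Lq_norm p (Psi_op p l g)"
      unfolding form_def using p q g by (intro Hoelder(2) bounded_opD(1)[OF Psi_op_bounded]) auto
    also have "\<dots> \<le> Lq_norm q g * (C * Lq_norm q g)"
      using C(2)[OF g] by (intro mult_left_mono) auto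
    finally show ?thesis by (simp add: power2_eq_square mult_ac)
  qed
  with C(1) show ?thesis by blast
qed

lemma form_scale:
  assumes g: "g \<in> Lq q"
  shows "form l (\<lambda>x. c * g x) = c\<^sup>2 * form l g"
proof -
  note T = bounded_opD[OF Psi_op_bounded]
  have [measurable]: "g \<in> borel_measurable borel" "Psi_op p l g \<in> borel_measurable borel"
    "Psi_op p l (\<lambda>x. c * g x) \<in> borel_measurable borel"
    using LqD(1)[OF g] LqD(1)[OF T(1)[OF g]] LqD(1)[OF T(1)[OF Lq_scale[OF g]]] by auto
  have "form l (\<lambda>x. c * g x) = (LINT x|lborel. c\<^sup>2 * (g x * Psi_op p l g x))"
    unfolding form_def
    by (rule integral_cong_AE) (measurable, use T(3)[OF g, of l c] in eventually_elim, simp add: power2_eq_square)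
  then show ?thesis by (simp add: form_def)
qed

lemma form_zero:
  assumes "AE x in lborel. g x = 0"
  shows "form l g = 0"
  unfolding form_def by (rule integral_eq_zero_AE) (use assms in eventually_elim, simp)

lemma potential_bounds:
  assumes w: "w \<in> Lq_pair q"
  shows "integrable lborel (\<lambda>x. h_nl a b p x (fst w x) (snd w x))"
    and "kap p a1 / 2 * (Lq_norm q (fst w) powr q + Lq_norm q (snd w) powr q) \<le> potential w"
proof -
  have uv: "fst w \<in> Lq q" "snd w \<in> Lq q" using w by (auto simp: Lq_pair_def)
  note I = LqD(2)[OF uv(1)] LqD(2)[OF uv(2)]
  have [measurable]: "fst w \<in> borel_measurable borel" "snd w \<in> borel_measurable borel" using LqD uv by auto
  have m [measurable]: "(\<lambda>x. h_nl a b p x (fst w x) (snd w x)) \<in> borel_measurable borel"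
    by (rule h_nl_measurable[OF a_measurable b_measurable]) (use p in auto)
  have I2: "integrable lborel (\<lambda>x. c * (\<bar>fst w x\<bar> powr q + \<bar>snd w x\<bar> powr q))" for c
    using I by auto
  show int: "integrable lborel (\<lambda>x. h_nl a b p x (fst w x) (snd w x))"
  proof (rule Bochner_Integration.integrable_bound[OF I2[of "kap p a0"]])
    show "AE x in lborel. norm (h_nl a b p x (fst w x) (snd w x)) \<le> norm (kap p a0 * (\<bar>fst w x\<bar> powr q + \<bar>snd w x\<bar> powr q))"
      using nonlinearity_AE a_bounds
    proof eventually_elim
      case (elim x)
      interpret nonlinearity a b p x by fact
      have "kap p (a x) * (\<bar>fst w x\<bar> powr q + \<bar>snd w x\<bar> powr q) \<le> kap p a0 * (\<bar>fst w x\<bar> powr q + \<bar>snd w x\<bar> powr q)"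
        using elim p a0 by (intro mult_right_mono kap_antimono) auto
      then show ?case using h_nonneg[of "fst w x" "snd w x"] h_upper[of "fst w x" "snd w x"] by simp
    qed
  qed simp
  have "(LINT x|lborel. kap p a1 / 2 * (\<bar>fst w x\<bar> powr q + \<bar>snd w x\<bar> powr q)) \<le> potential w"
    unfolding potential_def
  proof (rule integral_mono_AE[OF I2 int])
    show "AE x in lborel. kap p a1 / 2 * (\<bar>fst w x\<bar> powr q + \<bar>snd w x\<bar> powr q) \<le> h_nl a b p x (fst w x) (snd w x)"
      using nonlinearity_AE a_bounds
    proof eventually_elim
      case (elim x)
      interpret nonlinearity a b p x by fact
      have "kap p a1 / 2 * (\<bar>fst w x\<bar> powr q + \<bar>snd w x\<bar> powr q) \<le> kap p (a x) / 2 * (\<bar>fst w x\<bar> powr q + \<bar>snd w x\<bar> powr q)"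
        using elim p a0 by (intro mult_right_mono divide_right_mono kap_antimono) auto
      then show ?case using h_lower[of "fst w x" "snd w x"] by simp
    qed
  qed
  then show "kap p a1 / 2 * (Lq_norm q (fst w) powr q + Lq_norm q (snd w) powr q) \<le> potential w"
    using I by (simp add: Lq_norm_powr q)
qed

lemma potential_nonneg: "w \<in> Lq_pair q \<Longrightarrow> potential w \<ge> 0"
  using potential_bounds(2)[of w] kap_pos[of p a1] p a0 a0_le_a1
  by (smt (verit) divide_nonneg_pos mult_nonneg_nonneg powr_ge_zero)

lemma pair_scale_Lq: "w \<in> Lq_pair q \<Longrightarrow> pair_scale c w \<in> Lq_pair q"
  by (auto simp: Lq_pair_def pair_scale_def Lq_scale)

lemma potential_scale: "w \<in> Lq_pair q \<Longrightarrow> potential (pair_scale c w) = \<bar>c\<bar> powr q * potential w"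
proof -
  assume w: "w \<in> Lq_pair q"
  have "potential (pair_scale c w) = (LINT x|lborel. \<bar>c\<bar> powr q * h_nl a b p x (fst w x) (snd w x))"
    unfolding potential_def
  proof (rule integral_cong_AE)
    show "AE x in lborel. h_nl a b p x (fst (pair_scale c w) x) (snd (pair_scale c w) x) = \<bar>c\<bar> powr q * h_nl a b p x (fst w x) (snd w x)"
      using nonlinearity_AE
    proof eventually_elim
      case (elim x)
      interpret nonlinearity a b p x by fact
      show ?case by (simp add: pair_scale_def h_homogeneous)
    qed
  qed (use potential_bounds(1)[OF w] potential_bounds(1)[OF pair_scale_Lq[OF w, of c]] in auto)
  then show ?thesis by (simp add: potential_def)
qed

lemma dual_J_eq:
  assumes "w \<in> Lq_pair q"
  shows "dual_J a b p \<mu> \<nu> w = potential w - (form \<mu> (fst w) + form \<nu> (snd w)) / 2"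
proof -
  have "fst w \<in> Lq q" "snd w \<in> Lq q" using assms by (auto simp: Lq_pair_def)
  then show ?thesis
    by (simp add: dual_J_def potential_def form_def Bochner_Integration.integral_add[OF form_integrable form_integrable])
qed

lemma dual_J_scale:
  assumes w: "w \<in> Lq_pair q"
  shows "dual_J a b p \<mu> \<nu> (pair_scale c w) = \<bar>c\<bar> powr q * potential w - c\<^sup>2 * (form \<mu> (fst w) + form \<nu> (snd w)) / 2"
  using dual_J_eq[OF pair_scale_Lq[OF w]] potential_scale[OF w] w
  by (simp add: pair_scale_def Lq_pair_def mem_Times_iff form_scale algebra_simps)

section \<open>Mountain pass geometry and the quotient inequality for ground states\<close>

lemma pair_norm_nonneg: "pair_norm q w \<ge> 0"
  by (simp add: pair_norm_def)

lemma pair_norm_scale: "pair_norm q (pair_scale c w) = \<bar>c\<bar> * pair_norm q w"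
  by (simp add: pair_norm_def pair_scale_def Lq_norm_scale q distrib_left)

text \<open>The potential is at least of order n^q in the norm n, the form at most of order n^2. As
  q < 2, the potential wins near 0.\<close>

lemma dual_J_small:
  "\<exists>\<rho>>0. \<exists>\<alpha>>0. \<forall>w\<in>Lq_pair q. (pair_norm q w \<le> \<rho> \<longrightarrow> dual_J a b p \<mu> \<nu> w \<ge> 0) \<and>
     (pair_norm q w = \<rho> \<longrightarrow> dual_J a b p \<mu> \<nu> w \<ge> \<alpha>)"
proof -
  obtain C1 where C1: "C1 > 0" "\<And>g. g \<in> Lq q \<Longrightarrow> \<bar>form \<mu> g\<bar> \<le> C1 * (Lq_norm q g)\<^sup>2"
    using form_bound[of \<mu>] by blast
  obtain C2 where C2: "C2 > 0" "\<And>g. g \<in> Lq q \<Longrightarrow> \<bar>form \<nu> g\<bar> \<le> C2 * (Lq_norm q g)\<^sup>2"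
    using form_bound[of \<nu>] by blast
  define C where "C = C1 + C2"
  define k where "k = kap p a1 / 2 * (1 / 2) powr q"
  have k: "k > 0" using p a0 a0_le_a1 by (simp add: k_def kap_pos)
  have C: "C > 0" using C1 C2 by (simp add: C_def)
  have low: "k * n powr q - C / 2 * n\<^sup>2 \<le> dual_J a b p \<mu> \<nu> w" if w: "w \<in> Lq_pair q" and n: "n = pair_norm q w" for w n
  proof -
    let ?u = "Lq_norm q (fst w)" and ?v = "Lq_norm q (snd w)"
    have uv: "fst w \<in> Lq q" "snd w \<in> Lq q" using w by (auto simp: Lq_pair_def)
    have n': "n = ?u + ?v" using n by (simp add: pair_norm_def)
    have "(n * (1 / 2)) powr q \<le> max ?u ?v powr q"
      using q by (intro powr_mono2) (auto simp: n' max_def)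
    also have "\<dots> \<le> ?u powr q + ?v powr q" by (auto simp: max_def)
    finally have "n powr q * (1 / 2) powr q \<le> ?u powr q + ?v powr q"
      unfolding powr_mult .
    then have "kap p a1 / 2 * (n powr q * (1 / 2) powr q) \<le> kap p a1 / 2 * (?u powr q + ?v powr q)"
      using kap_pos[of p a1] p a0 a0_le_a1 by (intro mult_left_mono) auto
    then have 1: "k * n powr q \<le> potential w"
      using potential_bounds(2)[OF w] by (simp add: k_def mult_ac)
    have "form \<mu> (fst w) \<le> C1 * n\<^sup>2"
    proof -
      have "form \<mu> (fst w) \<le> C1 * ?u\<^sup>2" using C1(2)[OF uv(1)] by linarith
      also have "\<dots> \<le> C1 * n\<^sup>2" using C1(1) by (intro mult_left_mono power_mono) (auto simp: n')
      finally show ?thesis .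
    qed
    moreover have "form \<nu> (snd w) \<le> C2 * n\<^sup>2"
    proof -
      have "form \<nu> (snd w) \<le> C2 * ?v\<^sup>2" using C2(2)[OF uv(2)] by linarith
      also have "\<dots> \<le> C2 * n\<^sup>2" using C2(1) by (intro mult_left_mono power_mono) (auto simp: n')
      finally show ?thesis .
    qed
    ultimately have "form \<mu> (fst w) + form \<nu> (snd w) \<le> C * n\<^sup>2" by (simp add: C_def distrib_right)
    then have "(form \<mu> (fst w) + form \<nu> (snd w)) / 2 \<le> C * n\<^sup>2 / 2" by (rule divide_right_mono) simp
    moreover have "C / 2 * n\<^sup>2 = C * n\<^sup>2 / 2" by simp
    ultimately show ?thesis unfolding dual_J_eq[OF w] using 1 by linarith
  qed
  \<comment> \<open>Solves C \<rho>^(2-q) = k, so for n <= \<rho> the quadratic term uses at most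
    half of k n^q.\<close>
  define \<rho> where "\<rho> = (k / C) powr (1 / (2 - q))"
  have \<rho>: "\<rho> > 0" using k C by (simp add: \<rho>_def)
  have half: "k / 2 * n powr q \<le> k * n powr q - C / 2 * n\<^sup>2" if n: "0 \<le> n" "n \<le> \<rho>" for n
  proof (cases "n = 0")
    case False
    have "n\<^sup>2 = n powr q * n powr (2 - q)"
      using n False by (simp add: powr_numeral flip: powr_add)
    also have "\<dots> \<le> n powr q * \<rho> powr (2 - q)"
      using n q by (intro mult_left_mono powr_mono2) auto
    also have "\<rho> powr (2 - q) = k / C" using k C q by (simp add: \<rho>_def powr_powr)
    finally have "C / 2 * n\<^sup>2 \<le> C / 2 * (n powr q * (k / C))"
      using C by (intro mult_left_mono) auto
    then show ?thesis using C by (simp add: mult.commute)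
  qed simp
  define \<alpha> where "\<alpha> = k / 2 * \<rho> powr q"
  have "\<alpha> > 0" using k \<rho> by (simp add: \<alpha>_def)
  moreover have "dual_J a b p \<mu> \<nu> w \<ge> 0" if "w \<in> Lq_pair q" "pair_norm q w \<le> \<rho>" for w
  proof -
    have "0 \<le> k / 2 * pair_norm q w powr q" using k by simp
    then show ?thesis using low[OF that(1) refl] half[OF pair_norm_nonneg that(2)] by linarith
  qed
  moreover have "dual_J a b p \<mu> \<nu> w \<ge> \<alpha>" if "w \<in> Lq_pair q" "pair_norm q w = \<rho>" for w
    using low[OF that(1) refl] half[of \<rho>] \<rho> that(2) by (simp add: \<alpha>_def)
  ultimately show ?thesis using \<rho> by blast
qed

lemma continuous_path_norm:
  assumes \<gamma>: "continuous_path q \<gamma>"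
  shows "continuous_on {0..1} (\<lambda>t. pair_norm q (\<gamma> t))"
  unfolding continuous_on_def
proof
  fix t :: real assume t: "t \<in> {0..1}"
  have L: "\<gamma> s \<in> Lq_pair q" if "s \<in> {0..1}" for s :: real using \<gamma> that by (auto simp: continuous_path_def)
  have lim: "((\<lambda>s. pair_norm q (pair_add (\<gamma> s) (pair_scale (-1) (\<gamma> t)))) \<longlongrightarrow> 0) (at t within {0..1})"
    using \<gamma> t by (auto simp: continuous_path_def)
  show "((\<lambda>t. pair_norm q (\<gamma> t)) \<longlongrightarrow> pair_norm q (\<gamma> t)) (at t within {0..1})"
  proof (rule LIM_zero_cancel, rule tendsto_0_le[OF lim])
    show "\<forall>\<^sub>F s in at t within {0..1}. norm (pair_norm q (\<gamma> s) - pair_norm q (\<gamma> t)) \<le>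
       norm (pair_norm q (pair_add (\<gamma> s) (pair_scale (-1) (\<gamma> t)))) * 1"
      unfolding eventually_at_filter
    proof (intro always_eventually allI impI)
      fix s :: real assume s: "s \<in> {0..1}"
      have m: "fst (\<gamma> s) \<in> Lq q" "snd (\<gamma> s) \<in> Lq q" "fst (\<gamma> t) \<in> Lq q" "snd (\<gamma> t) \<in> Lq q"
        using L[OF s] L[OF t] by (auto simp: Lq_pair_def)
      show "norm (pair_norm q (\<gamma> s) - pair_norm q (\<gamma> t)) \<le>
       norm (pair_norm q (pair_add (\<gamma> s) (pair_scale (-1) (\<gamma> t)))) * 1"
        using Lq_norm_reverse_triangle[OF _ m(1) m(3)] Lq_norm_reverse_triangle[OF _ m(2) m(4)] q
        by (simp add: pair_norm_def pair_add_def pair_scale_def)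
    qed
  qed
qed

text \<open>A path that ends where J < 0 has left the ball on which J >= 0, so by the intermediate
  value theorem its norm takes the value \<rho>. Strict positivity of the level excludes the zero
  pair as a ground state.\<close>

lemma mp_level_pos: "\<exists>\<alpha>>0. ereal \<alpha> \<le> mp_level a b p \<mu> \<nu>"
proof -
  obtain \<rho> \<alpha> where \<rho>: "\<rho> > 0" and \<alpha>: "\<alpha> > 0" and
    J: "\<And>w. w \<in> Lq_pair q \<Longrightarrow> pair_norm q w \<le> \<rho> \<Longrightarrow> dual_J a b p \<mu> \<nu> w \<ge> 0"
       "\<And>w. w \<in> Lq_pair q \<Longrightarrow> pair_norm q w = \<rho> \<Longrightarrow> dual_J a b p \<mu> \<nu> w \<ge> \<alpha>"
    using dual_J_small[of \<mu> \<nu>] by blast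
  have "ereal \<alpha> \<le> (SUP t\<in>{0..1}. ereal (dual_J a b p \<mu> \<nu> (\<gamma> t)))" if \<gamma>: "\<gamma> \<in> mp_paths a b p \<mu> \<nu>" for \<gamma>
  proof -
    have cp: "continuous_path q \<gamma>" and J1: "dual_J a b p \<mu> \<nu> (\<gamma> 1) < 0" and
      z: "AE x in lborel. fst (\<gamma> 0) x = 0" "AE x in lborel. snd (\<gamma> 0) x = 0"
      using \<gamma> by (auto simp: mp_paths_def)
    have L: "\<gamma> s \<in> Lq_pair q" if "s \<in> {0..1}" for s using cp that by (auto simp: continuous_path_def)
    have "Lq_norm q (fst (\<gamma> 0)) = 0" "Lq_norm q (snd (\<gamma> 0)) = 0"
      using L[of 0] z q by (auto simp: Lq_pair_def Lq_norm_eq_0_iff)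
    then have n0: "pair_norm q (\<gamma> 0) = 0" by (simp add: pair_norm_def)
    have n1: "\<rho> < pair_norm q (\<gamma> 1)" using J(1)[OF L[of 1]] J1 by force
    obtain t where t: "0 \<le> t" "t \<le> 1" "pair_norm q (\<gamma> t) = \<rho>"
      using IVT'[of "\<lambda>t. pair_norm q (\<gamma> t)" 0 \<rho> 1] continuous_path_norm[OF cp] n0 n1 \<rho> by auto
    then have "ereal \<alpha> \<le> ereal (dual_J a b p \<mu> \<nu> (\<gamma> t))" using J(2)[OF L[of t]] by simp
    also have "\<dots> \<le> (SUP t\<in>{0..1}. ereal (dual_J a b p \<mu> \<nu> (\<gamma> t)))"
      using t by (intro SUP_upper) auto
    finally show ?thesis .
  qed
  then have "ereal \<alpha> \<le> mp_level a b p \<mu> \<nu>"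
    unfolding mp_level_def by (intro INF_greatest) auto
  with \<alpha> show ?thesis by blast
qed

lemma mp_level_le_ray:
  assumes w: "w \<in> Lq_pair q" and B: "B = form \<mu> (fst w) + form \<nu> (snd w)" "B > 0"
  shows "mp_level a b p \<mu> \<nu> \<le> ereal ((1 - q / 2) * potential w * (q * potential w / B) powr (q / (2 - q)))"
proof -
  let ?A = "potential w"
  have A: "?A \<ge> 0" by (rule potential_nonneg[OF w])
  \<comment> \<open>Chosen with R^(2-q) B = 2 A + B, so that J(R w) = -R^q B / 2 < 0 and the segment
    to R w is an admissible path.\<close>
  define R where "R = (2 * ?A / B + 1) powr (1 / (2 - q))"
  have R0: "2 * ?A / B + 1 > 0" using A B by (intro add_nonneg_pos) auto
  have R: "R > 0" using R0 by (simp add: R_def)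
  have RR: "R powr (2 - q) = 2 * ?A / B + 1" using R0 q by (simp add: R_def powr_powr)
  define \<gamma> where "\<gamma> t = pair_scale (t * R) w" for t :: real
  have J: "dual_J a b p \<mu> \<nu> (\<gamma> t) = \<bar>t * R\<bar> powr q * ?A - (t * R)\<^sup>2 * B / 2" for t
    by (simp add: \<gamma>_def dual_J_scale[OF w] B)
  have "\<gamma> \<in> mp_paths a b p \<mu> \<nu>"
    unfolding mp_paths_def mem_Collect_eq
  proof (intro conjI)
    show "AE x in lborel. fst (\<gamma> 0) x = 0" "AE x in lborel. snd (\<gamma> 0) x = 0"
      by (auto simp: \<gamma>_def pair_scale_def)
    have "R\<^sup>2 = R powr q * R powr (2 - q)"
      using R by (simp add: powr_numeral flip: powr_add)
    then have "R\<^sup>2 * B / 2 = R powr q * (2 * ?A / B + 1) * B / 2" by (simp only: RR)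
    also have "\<dots> = R powr q * ?A + R powr q * B / 2" using B by (simp add: field_simps)
    finally show "dual_J a b p \<mu> \<nu> (\<gamma> 1) < 0" unfolding J using R B by simp
    show "continuous_path q \<gamma>"
      unfolding continuous_path_def
    proof (intro conjI ballI)
      fix t :: real
      show "\<gamma> t \<in> Lq_pair q" unfolding \<gamma>_def by (rule pair_scale_Lq[OF w])
      have "pair_add (\<gamma> s) (pair_scale (-1) (\<gamma> t)) = pair_scale ((s - t) * R) w" for s
        by (simp add: \<gamma>_def pair_add_def pair_scale_def algebra_simps)
      then have eq: "pair_norm q (pair_add (\<gamma> s) (pair_scale (-1) (\<gamma> t))) = \<bar>(s - t) * R\<bar> * pair_norm q w" for s
        by (simp add: pair_norm_scale)
      have "((\<lambda>s. \<bar>(s - t) * R\<bar> * pair_norm q w) \<longlongrightarrow> \<bar>(t - t) * R\<bar> * pair_norm q w) (at t within {0..1})"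
        by (intro tendsto_intros)
      then show "((\<lambda>s. pair_norm q (pair_add (\<gamma> s) (pair_scale (-1) (\<gamma> t)))) \<longlongrightarrow> 0) (at t within {0..1})"
        unfolding eq by simp
    qed
  qed
  then have "mp_level a b p \<mu> \<nu> \<le> (SUP t\<in>{0..1}. ereal (dual_J a b p \<mu> \<nu> (\<gamma> t)))"
    unfolding mp_level_def by (rule INF_lower)
  also have "\<dots> \<le> ereal ((1 - q / 2) * ?A * (q * ?A / B) powr (q / (2 - q)))"
  proof (rule SUP_least)
    fix t :: real assume "t \<in> {0..1}"
    then have "0 \<le> t * R" using R by simp
    then show "ereal (dual_J a b p \<mu> \<nu> (\<gamma> t)) \<le> ereal ((1 - q / 2) * ?A * (q * ?A / B) powr (q / (2 - q)))"
      unfolding J using ray_maximum[OF q(1,2) A B(2), of "t * R"] by simp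
  qed
  finally show ?thesis .
qed

text \<open>The derivative is tested in the radial direction: by homogeneity J((1 + s) w) is
  explicit in s, and its derivative at s = 0 is q A - B.\<close>

lemma critical_point_identity:
  assumes cp: "critical_point q (dual_J a b p \<mu> \<nu>) w"
  shows "form \<mu> (fst w) + form \<nu> (snd w) = q * potential w"
proof -
  let ?A = "potential w" and ?B = "form \<mu> (fst w) + form \<nu> (snd w)"
  define n where "n = pair_norm q w"
  have n: "n \<ge> 0" by (simp add: n_def pair_norm_nonneg)
  have w: "w \<in> Lq_pair q" and fd: "\<And>e. e > 0 \<Longrightarrow> \<exists>\<delta>>0. \<forall>d\<in>Lq_pair q. pair_norm q d < \<delta> \<longrightarrow>
        \<bar>dual_J a b p \<mu> \<nu> (pair_add w d) - dual_J a b p \<mu> \<nu> w - 0\<bar> \<le> e * pair_norm q d"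
    using cp by (auto simp: critical_point_def has_frechet_deriv_def)
  define \<phi> where "\<phi> s = (1 + s) powr q * ?A - (1 + s)\<^sup>2 * ?B / 2" for s :: real
  have J: "dual_J a b p \<mu> \<nu> (pair_add w (pair_scale s w)) = \<bar>1 + s\<bar> powr q * ?A - (1 + s)\<^sup>2 * ?B / 2" for s
  proof -
    have "pair_add w (pair_scale s w) = pair_scale (1 + s) w"
      by (simp add: pair_add_def pair_scale_def algebra_simps)
    then show ?thesis using dual_J_scale[OF w] by simp
  qed
  have "(\<phi> has_real_derivative 0) (at 0)"
    unfolding has_field_derivative_iff LIM_eq
  proof (intro allI impI)
    fix e :: real assume e: "e > 0"
    obtain \<delta> where \<delta>: "\<delta> > 0" "\<And>d. d \<in> Lq_pair q \<Longrightarrow> pair_norm q d < \<delta> \<Longrightarrow>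
        \<bar>dual_J a b p \<mu> \<nu> (pair_add w d) - dual_J a b p \<mu> \<nu> w\<bar> \<le> e / (n + 1) * pair_norm q d"
      using fd[of "e / (n + 1)"] e n by auto
    \<comment> \<open>The bound 1 keeps 1 + s positive, where J((1 + s) w) equals \<phi>(s); the
      denominator n + 1 also covers a pair of norm 0.\<close>
    define r where "r = min 1 (\<delta> / (n + 1))"
    have r: "r > 0" using \<delta> n by (auto simp: r_def)
    have "norm ((\<phi> s - \<phi> 0) / (s - 0) - 0) < e" if s: "s \<noteq> 0 \<and> norm (s - 0) < r" for s
    proof -
      have s1: "\<bar>s\<bar> < 1" "\<bar>s\<bar> < \<delta> / (n + 1)" "\<bar>s\<bar> > 0" using s by (auto simp: r_def)
      have "pair_norm q (pair_scale s w) = \<bar>s\<bar> * n" by (simp add: pair_norm_scale n_def)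
      moreover have "\<bar>s\<bar> * n < \<delta>"
      proof -
        have "\<bar>s\<bar> * n \<le> \<bar>s\<bar> * (n + 1)" by (intro mult_left_mono) auto
        also have "\<dots> < \<delta>" using s1(2) n by (simp add: field_simps)
        finally show ?thesis .
      qed
      ultimately have "\<bar>dual_J a b p \<mu> \<nu> (pair_add w (pair_scale s w)) - dual_J a b p \<mu> \<nu> w\<bar> \<le> e / (n + 1) * (\<bar>s\<bar> * n)"
        using \<delta>(2)[OF pair_scale_Lq[OF w], of s] by simp
      moreover have "dual_J a b p \<mu> \<nu> (pair_add w (pair_scale s w)) = \<phi> s" using s1 by (simp add: J \<phi>_def)
      moreover have "dual_J a b p \<mu> \<nu> w = \<phi> 0" using dual_J_eq[OF w] by (simp add: \<phi>_def)
      ultimately have "\<bar>\<phi> s - \<phi> 0\<bar> \<le> e / (n + 1) * (\<bar>s\<bar> * n)" by simp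
      also have "\<dots> = e * \<bar>s\<bar> * (n / (n + 1))" by simp
      also have "\<dots> < e * \<bar>s\<bar> * 1" using e s1 n by (intro mult_strict_left_mono) (auto simp: field_simps)
      finally show ?thesis using s1 by (simp add: field_simps)
    qed
    then show "\<exists>r>0. \<forall>x. x \<noteq> 0 \<and> norm (x - 0) < r \<longrightarrow> norm ((\<phi> x - \<phi> 0) / (x - 0) - 0) < e"
      using r by blast
  qed
  moreover have "(\<phi> has_real_derivative (q * ?A - ?B)) (at 0)"
    unfolding \<phi>_def[abs_def] by (auto intro!: derivative_eq_intros simp: field_simps)
  ultimately show ?thesis using DERIV_unique by fastforce
qed

text \<open>A critical point has B = q A and hence J = (1 - q/2) A. Equating this with the level and
  bounding the level along the ray of w' gives the quotient inequality, which both parts of the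
  theorem contradict at a semitrivial pair.\<close>

lemma ground_state_comparison:
  assumes gs: "dual_ground_state a b p \<mu> \<nu> w"
  shows "w \<in> Lq_pair q" "potential w > 0" "form \<mu> (fst w) + form \<nu> (snd w) = q * potential w"
    and "\<And>w'. w' \<in> Lq_pair q \<Longrightarrow> form \<mu> (fst w') + form \<nu> (snd w') > 0 \<Longrightarrow>
       (potential w)\<^sup>2 * (form \<mu> (fst w') + form \<nu> (snd w')) powr q \<le> (potential w')\<^sup>2 * (q * potential w) powr q"
proof -
  have cp: "critical_point q (dual_J a b p \<mu> \<nu>) w" and lev: "ereal (dual_J a b p \<mu> \<nu> w) = mp_level a b p \<mu> \<nu>"
    using gs by (auto simp: dual_ground_state_def)
  show w: "w \<in> Lq_pair q" using cp by (simp add: critical_point_def)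
  show B: "form \<mu> (fst w) + form \<nu> (snd w) = q * potential w" by (rule critical_point_identity[OF cp])
  have Jw: "dual_J a b p \<mu> \<nu> w = (1 - q / 2) * potential w"
    unfolding dual_J_eq[OF w] B by (simp add: algebra_simps)
  obtain \<alpha> where "\<alpha> > 0" "ereal \<alpha> \<le> mp_level a b p \<mu> \<nu>" using mp_level_pos by blast
  then have "(1 - q / 2) * potential w > 0" using lev Jw by (metis ereal_less_eq(3) less_le_trans)
  then show A: "potential w > 0" using q by (simp add: zero_less_mult_iff)
  fix w' assume w': "w' \<in> Lq_pair q" and B': "form \<mu> (fst w') + form \<nu> (snd w') > 0"
  have "ereal ((1 - q / 2) * potential w) \<le> ereal ((1 - q / 2) * potential w' * (q * potential w' / (form \<mu> (fst w') + form \<nu> (snd w'))) powr (q / (2 - q)))"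
    using mp_level_le_ray[OF w' refl B'] lev Jw by simp
  then show "(potential w)\<^sup>2 * (form \<mu> (fst w') + form \<nu> (snd w')) powr q \<le> (potential w')\<^sup>2 * (q * potential w) powr q"
    using q A B' potential_nonneg[OF w'] by (intro quotient_comparison) auto
qed

end

section \<open>Dilations of the Helmholtz operators\<close>

lemma lborel_dilation:
  assumes "s > 0"
  shows "lborel = density (distr lborel borel (\<lambda>x :: 'a::euclidean_space. s *\<^sub>R x)) (\<lambda>_. ennreal (s ^ DIM('a)))"
  using lborel_affine[of s "0 :: 'a"] assms by simp

lemma AE_dilation:
  fixes P :: "'a::euclidean_space \<Rightarrow> bool"
  assumes "s > 0" "AE x in lborel. P x"
  shows "AE x in lborel. P (s *\<^sub>R x)"
proof -
  obtain N where N: "N \<in> null_sets lborel" "{x. \<not> P x} \<subseteq> N"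
    using assms(2) by (auto simp: eventually_ae_filter)
  then have [measurable]: "N \<in> sets borel" by auto
  have "AE x in lborel. x \<notin> N" using N(1) by (rule AE_not_in)
  then have "AE x in density (distr lborel borel (\<lambda>x. s *\<^sub>R x)) (\<lambda>_. ennreal (s ^ DIM('a))). x \<notin> N"
    unfolding lborel_dilation[OF assms(1), symmetric] .
  then have "AE x in lborel. s *\<^sub>R x \<notin> N"
    using assms(1) by (simp add: AE_density AE_distr_iff)
  then show ?thesis by (rule AE_mp) (use N(2) in auto)
qed

lemma integral_dilation:
  fixes f :: "'a::euclidean_space \<Rightarrow> real"
  assumes "s > 0" and [measurable]: "f \<in> borel_measurable borel"
  shows "(LINT x|lborel. f (s *\<^sub>R x)) = (LINT x|lborel. f x) / s ^ DIM('a)"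
    and "integrable lborel (\<lambda>x. f (s *\<^sub>R x)) \<longleftrightarrow> integrable lborel f"
proof -
  have "(LINT x|lborel. f x) = (LINT x|density (distr lborel borel (\<lambda>x. s *\<^sub>R x)) (\<lambda>_. ennreal (s ^ DIM('a))). f x)"
    using lborel_dilation[OF assms(1)] by metis
  also have "\<dots> = s ^ DIM('a) * (LINT x|lborel. f (s *\<^sub>R x))"
    using assms(1) by (simp add: integral_density integral_distr)
  finally show "(LINT x|lborel. f (s *\<^sub>R x)) = (LINT x|lborel. f x) / s ^ DIM('a)"
    using assms(1) by simp
  have "integrable lborel f \<longleftrightarrow> integrable (density (distr lborel borel (\<lambda>x. s *\<^sub>R x)) (\<lambda>_. ennreal (s ^ DIM('a)))) f"
    using lborel_dilation[OF assms(1)] by metis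
  also have "\<dots> \<longleftrightarrow> integrable lborel (\<lambda>x. f (s *\<^sub>R x))"
    using assms(1) by (simp add: integrable_density integrable_distr_eq)
  finally show "integrable lborel (\<lambda>x. f (s *\<^sub>R x)) \<longleftrightarrow> integrable lborel f" by simp
qed

lemma Lq_dilation:
  fixes f :: "'a::euclidean_space \<Rightarrow> real"
  assumes "s > 0" "f \<in> Lq q"
  shows "(\<lambda>x. f (s *\<^sub>R x)) \<in> Lq q"
proof -
  have [measurable]: "f \<in> borel_measurable borel" using LqD assms by auto
  show ?thesis
    using LqD(2)[OF assms(2)] integral_dilation(2)[OF assms(1), of "\<lambda>x. \<bar>f x\<bar> powr q"] by (simp add: Lq_def)
qed

lemma Lq_norm_dilation:
  fixes f :: "'a::euclidean_space \<Rightarrow> real"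
  assumes "s > 0" "q > 0" "f \<in> Lq q"
  shows "Lq_norm q (\<lambda>x. f (s *\<^sub>R x)) powr q = Lq_norm q f powr q / s ^ DIM('a)"
proof -
  have [measurable]: "f \<in> borel_measurable borel" using LqD assms by auto
  show ?thesis
    using integral_dilation(1)[OF assms(1), of "\<lambda>x. \<bar>f x\<bar> powr q"] by (simp add: Lq_norm_powr assms(2))
qed

lemma Lq_norm_dilation':
  fixes f :: "'a::euclidean_space \<Rightarrow> real"
  assumes "s > 0" "q > 0" "f \<in> Lq q"
  shows "Lq_norm q (\<lambda>x. f (s *\<^sub>R x)) = Lq_norm q f / (s ^ DIM('a)) powr (1 / q)"
proof -
  have "(Lq_norm q (\<lambda>x. f (s *\<^sub>R x)) powr q) powr (1 / q) = (Lq_norm q f powr q / s ^ DIM('a)) powr (1 / q)"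
    by (simp only: Lq_norm_dilation[OF assms])
  then show ?thesis using assms by (simp add: powr_powr powr_divide)
qed

lemma partials_dilation:
  fixes g :: "real ^ 'n \<Rightarrow> real"
  assumes "\<And>is x. partials is g differentiable at x"
  shows "partials is (\<lambda>x. g (c *\<^sub>R x)) = (\<lambda>x. c ^ length is * partials is g (c *\<^sub>R x))"
    and "(\<lambda>x. c ^ length is * partials is g (c *\<^sub>R x)) differentiable at x"
proof -
  have D: "((\<lambda>x. c ^ length is * partials is g (c *\<^sub>R x)) has_derivative
    (\<lambda>v. c ^ length is * frechet_derivative (partials is g) (at (c *\<^sub>R x)) (c *\<^sub>R v))) (at x)" for "is" x
  proof -
    have 1: "(partials is g has_derivative frechet_derivative (partials is g) (at (c *\<^sub>R x))) (at (c *\<^sub>R x))"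
      using assms frechet_derivative_works by blast
    have 2: "((\<lambda>x. c *\<^sub>R x) has_derivative (\<lambda>v. c *\<^sub>R v)) (at x)"
      by (auto intro!: derivative_eq_intros)
    have "((\<lambda>x. partials is g (c *\<^sub>R x)) has_derivative (\<lambda>v. frechet_derivative (partials is g) (at (c *\<^sub>R x)) (c *\<^sub>R v))) (at x)"
      using has_derivative_compose[OF 2 1] .
    then show ?thesis by (rule has_derivative_mult_right)
  qed
  show "(\<lambda>x. c ^ length is * partials is g (c *\<^sub>R x)) differentiable at x"
    using D unfolding differentiable_def by blast
  show "partials is (\<lambda>x. g (c *\<^sub>R x)) = (\<lambda>x. c ^ length is * partials is g (c *\<^sub>R x))"
  proof (induction "is")
    case (Cons i "is")
    show ?case
    proof
      fix x
      have lin: "linear (frechet_derivative (partials is g) (at (c *\<^sub>R x)))"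
        using assms linear_frechet_derivative by blast
      have "partials (i # is) (\<lambda>x. g (c *\<^sub>R x)) x = frechet_derivative (\<lambda>x. c ^ length is * partials is g (c *\<^sub>R x)) (at x) (axis i 1)"
        by (simp only: partials.simps Cons.IH)
      also have "\<dots> = c ^ length is * frechet_derivative (partials is g) (at (c *\<^sub>R x)) (c *\<^sub>R axis i 1)"
        by (subst frechet_derivative_at[OF D, symmetric]) simp
      also have "\<dots> = c ^ length (i # is) * partials (i # is) g (c *\<^sub>R x)"
        by (simp add: linear_cmul[OF lin])
      finally show "partials (i # is) (\<lambda>x. g (c *\<^sub>R x)) x = c ^ length (i # is) * partials (i # is) g (c *\<^sub>R x)" .
    qed
  qed simp
qed

lemma schwartz_dilation:
  fixes g :: "real ^ 'n \<Rightarrow> real"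
  assumes "schwartz g" "c > 0"
  shows "schwartz (\<lambda>x. g (c *\<^sub>R x))"
  unfolding schwartz_def
proof (intro allI conjI)
  fix "is" :: "'n list"
  have d: "partials is g differentiable at x" for "is" x using assms(1) by (auto simp: schwartz_def)
  show "partials is (\<lambda>x. g (c *\<^sub>R x)) differentiable at x" for x
    unfolding partials_dilation(1)[OF d] by (rule partials_dilation(2)[OF d])
  fix k :: nat
  obtain C where C: "\<And>x. norm x ^ k * \<bar>partials is g x\<bar> \<le> C" using assms(1) unfolding schwartz_def by blast
  have "norm x ^ k * \<bar>partials is (\<lambda>x. g (c *\<^sub>R x)) x\<bar> \<le> c ^ length is / c ^ k * C" for x
  proof -
    have "norm x ^ k * \<bar>partials is (\<lambda>x. g (c *\<^sub>R x)) x\<bar> =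
      c ^ length is / c ^ k * (norm (c *\<^sub>R x) ^ k * \<bar>partials is g (c *\<^sub>R x)\<bar>)"
      unfolding partials_dilation(1)[OF d] using assms(2) by (simp add: abs_mult power_mult_distrib)
    also have "\<dots> \<le> c ^ length is / c ^ k * C"
      using assms(2) by (intro mult_left_mono C) auto
    finally show ?thesis .
  qed
  then show "\<exists>C. \<forall>x. norm x ^ k * \<bar>partials is (\<lambda>x. g (c *\<^sub>R x)) x\<bar> \<le> C" by blast
qed

lemma schwartz_measurable:
  assumes "schwartz g"
  shows "g \<in> borel_measurable borel"
proof -
  have "g differentiable at x" for x
    using assms unfolding schwartz_def by (metis partials.simps(1))
  then have "continuous_on UNIV g"
    by (auto intro!: continuous_at_imp_continuous_on differentiable_imp_continuous_within)
  then show ?thesis by (rule borel_measurable_continuous_onI)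
qed

text \<open>The Bessel argument sqrt l |x| is unchanged by the scaling, so the power of s comes from
  the prefactor alone. At x = 0 the division by 0 gives base 0, whose powers are all 0, and both
  sides vanish.\<close>

lemma Psi_scale:
  fixes x :: "real ^ 'n"
  assumes "CARD('n) \<ge> 2" "s > 0" "l > 0"
  shows "Psi (s\<^sup>2 * l) x = s ^ (CARD('n) - 2) * Psi l (s *\<^sub>R x)"
proof (cases "x = 0")
  case True
  then show ?thesis by (simp add: Psi_eq_bessel_Y)
next
  case False
  define N where "N = CARD('n)"
  have N: "real N - 2 = real (N - 2)" using assms(1) by (simp add: N_def)
  have "s\<^sup>2 * l / (4 * pi\<^sup>2 * (norm x)\<^sup>2) = s powr 4 * (l / (4 * pi\<^sup>2 * (norm (s *\<^sub>R x))\<^sup>2))"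
    using assms(2) False by (simp add: powr_numeral power_mult_distrib field_simps eval_nat_numeral)
  then have "(s\<^sup>2 * l / (4 * pi\<^sup>2 * (norm x)\<^sup>2)) powr ((real N - 2) / 4) =
     s powr (4 * ((real N - 2) / 4)) * (l / (4 * pi\<^sup>2 * (norm (s *\<^sub>R x))\<^sup>2)) powr ((real N - 2) / 4)"
    by (simp only: powr_mult powr_powr)
  also have "s powr (4 * ((real N - 2) / 4)) = s ^ (N - 2)"
    using assms(2) by (simp add: N powr_realpow)
  finally have 1: "(s\<^sup>2 * l / (4 * pi\<^sup>2 * (norm x)\<^sup>2)) powr ((real N - 2) / 4) =
     s ^ (N - 2) * (l / (4 * pi\<^sup>2 * (norm (s *\<^sub>R x))\<^sup>2)) powr ((real N - 2) / 4)" .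
  have 2: "sqrt (s\<^sup>2 * l) * norm x = sqrt l * norm (s *\<^sub>R x)"
    using assms by (simp add: real_sqrt_mult)
  show ?thesis
    unfolding Psi_eq_bessel_Y N_def[symmetric] 1 2 by simp
qed

text \<open>Conjugation with a dilation. The divisor s^2 is what is left of s^(N-2) from
  \<open>Psi_scale\<close> and s^(-N) from the change of variables in the convolution.\<close>

definition dilate_op :: "real \<Rightarrow> ((real ^ 'n \<Rightarrow> real) \<Rightarrow> (real ^ 'n \<Rightarrow> real)) \<Rightarrow> (real ^ 'n \<Rightarrow> real) \<Rightarrow> real ^ 'n \<Rightarrow> real" where
  "dilate_op s T g x = T (\<lambda>y. g ((1 / s) *\<^sub>R y)) (s *\<^sub>R x) / s\<^sup>2"

lemma conv_extension_scale:
  fixes T :: "(real ^ 'n \<Rightarrow> real) \<Rightarrow> (real ^ 'n \<Rightarrow> real)"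
  assumes N: "CARD('n) \<ge> 2" and s: "s > 0" and l: "l > 0" and p: "p > 1"
    and T: "conv_extension p (Psi l) T"
  shows "conv_extension p (Psi (s\<^sup>2 * l)) (dilate_op s T)"
proof -
  let ?q = "conj_exp p"
  have q: "?q > 0" using conj_exp_bounds[OF p] by simp
  have bT: "bounded_op ?q p T" using T unfolding conv_extension_def bounded_op_def by blast
  have conv: "\<And>g. schwartz g \<Longrightarrow> AE x in lborel. T g x = (LINT y|lborel. Psi l (x - y) * g y)"
    using T unfolding conv_extension_def by blast
  note T' = bounded_opD[OF bT]
  have s': "1 / s > 0" using s by simp
  have dl: "(\<lambda>y. g ((1 / s) *\<^sub>R y)) \<in> Lq ?q" if "g \<in> Lq ?q" for g :: "real ^ 'n \<Rightarrow> real"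
    by (rule Lq_dilation[OF s' that])
  have mem: "dilate_op s T g \<in> Lq p" if g: "g \<in> Lq ?q" for g
    unfolding dilate_op_def[abs_def] using Lq_scale[OF Lq_dilation[OF s T'(1)[OF dl[OF g]]], of "1 / s\<^sup>2"] by simp
  show ?thesis
    unfolding conv_extension_def
  proof (intro conjI ballI allI impI)
    show "dilate_op s T g \<in> Lq p" if "g \<in> Lq ?q" for g by (rule mem[OF that])
  next
    fix f g :: "real ^ 'n \<Rightarrow> real" assume fg: "f \<in> Lq ?q" "g \<in> Lq ?q"
    show "AE x in lborel. dilate_op s T (\<lambda>y. f y + g y) x = dilate_op s T f x + dilate_op s T g x"
      using AE_dilation[OF s T'(2)[OF dl[OF fg(1)] dl[OF fg(2)]]]
      by eventually_elim (simp add: dilate_op_def add_divide_distrib)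
  next
    fix c and g :: "real ^ 'n \<Rightarrow> real" assume g: "g \<in> Lq ?q"
    show "AE x in lborel. dilate_op s T (\<lambda>y. c * g y) x = c * dilate_op s T g x"
      using AE_dilation[OF s T'(3)[OF dl[OF g], of c]]
      by eventually_elim (simp add: dilate_op_def)
  next
    obtain C where C: "C > 0" "\<And>g. g \<in> Lq ?q \<Longrightarrow> Lq_norm p (T g) \<le> C * Lq_norm ?q g"
      using bounded_op_bound[OF bT] by blast
    define M where "M = 1 / s\<^sup>2 / (s ^ DIM(real ^ 'n)) powr (1 / p)"
    have M: "M \<ge> 0" using s by (simp add: M_def)
    have "Lq_norm p (dilate_op s T g) \<le> M * (C / ((1 / s) ^ DIM(real ^ 'n)) powr (1 / ?q)) * Lq_norm ?q g" if g: "g \<in> Lq ?q" for g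
    proof -
      have "Lq_norm p (dilate_op s T g) = 1 / s\<^sup>2 * Lq_norm p (\<lambda>x. T (\<lambda>y. g ((1 / s) *\<^sub>R y)) (s *\<^sub>R x))"
        using Lq_norm_scale[of p "1 / s\<^sup>2" "\<lambda>x. T (\<lambda>y. g ((1 / s) *\<^sub>R y)) (s *\<^sub>R x)"] p s
        by (simp add: dilate_op_def[abs_def])
      also have "\<dots> = M * Lq_norm p (T (\<lambda>y. g ((1 / s) *\<^sub>R y)))"
        using Lq_norm_dilation'[OF s _ T'(1)[OF dl[OF g]]] p by (simp add: M_def)
      also have "\<dots> \<le> M * (C * Lq_norm ?q (\<lambda>y. g ((1 / s) *\<^sub>R y)))"
        using M by (intro mult_left_mono C dl g) auto
      finally show ?thesis using Lq_norm_dilation'[OF s' q g] by (simp add: mult_ac)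
    qed
    then show "\<exists>C. \<forall>g\<in>Lq ?q. Lq_norm p (dilate_op s T g) \<le> C * Lq_norm ?q g" by blast
  next
    fix g :: "real ^ 'n \<Rightarrow> real" assume g: "schwartz g"
    have [measurable]: "g \<in> borel_measurable borel" "Psi l \<in> borel_measurable (borel :: (real ^ 'n) measure)"
      by (rule schwartz_measurable[OF g], rule Psi_measurable[OF N l])
    show "AE x in lborel. dilate_op s T g x = (LINT y|lborel. Psi (s\<^sup>2 * l) (x - y) * g y)"
      using AE_dilation[OF s conv[OF schwartz_dilation[OF g s']]]
    proof eventually_elim
      case (elim x)
      have "(LINT y|lborel. Psi (s\<^sup>2 * l) (x - y) * g y) =
         (LINT y|lborel. s ^ (CARD('n) - 2) * (Psi l (s *\<^sub>R x - s *\<^sub>R y) * g ((1 / s) *\<^sub>R (s *\<^sub>R y))))"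
        using s by (simp add: Psi_scale[OF N s l] scaleR_diff_right mult.assoc)
      also have "\<dots> = s ^ (CARD('n) - 2) * ((LINT y|lborel. Psi l (s *\<^sub>R x - y) * g ((1 / s) *\<^sub>R y)) / s ^ CARD('n))"
        using integral_dilation(1)[OF s, of "\<lambda>y. Psi l (s *\<^sub>R x - y) * g ((1 / s) *\<^sub>R y)"] by simp
      also have "\<dots> = (LINT y|lborel. Psi l (s *\<^sub>R x - y) * g ((1 / s) *\<^sub>R y)) / s\<^sup>2"
      proof -
        have "s ^ CARD('n) = s ^ (CARD('n) - 2) * s\<^sup>2" using N by (metis le_add_diff_inverse2 power_add)
        then show ?thesis using s by simp
      qed
      finally show ?case using elim by (simp add: dilate_op_def)
    qed
  qed
qed

text \<open>By density, the arbitrary choice in \<open>Psi_op\<close> can be replaced by any known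
  extension; later this identifies the operator of frequency s^2 l with the dilated operator of
  frequency l.\<close>

lemma conv_extension_unique:
  fixes T T' :: "(real ^ 'n \<Rightarrow> real) \<Rightarrow> (real ^ 'n \<Rightarrow> real)"
  assumes p: "p > 1" and T: "conv_extension p K T" and T': "conv_extension p K T'" and g: "g \<in> Lq (conj_exp p)"
  shows "AE x in lborel. T g x = T' g x"
proof -
  let ?q = "conj_exp p"
  have q: "?q > 0" using conj_exp_bounds[OF p] by simp
  have b: "bounded_op ?q p T" "bounded_op ?q p T'" using T T' unfolding conv_extension_def bounded_op_def by blast+
  note B = bounded_opD[OF b(1)] note B' = bounded_opD[OF b(2)]
  show ?thesis
  proof (rule Lq_induct[OF q _ _ _ _ g])
    fix g :: "real ^ 'n \<Rightarrow> real" assume "schwartz g"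
    then have "AE x in lborel. T g x = (LINT y|lborel. K (x - y) * g y)" "AE x in lborel. T' g x = (LINT y|lborel. K (x - y) * g y)"
      using T T' unfolding conv_extension_def by blast+
    then show "AE x in lborel. T g x = T' g x" by eventually_elim simp
  next
    fix f g :: "real ^ 'n \<Rightarrow> real"
    assume fg: "f \<in> Lq ?q" "g \<in> Lq ?q" "AE x in lborel. T f x = T' f x" "AE x in lborel. T g x = T' g x"
    show "AE x in lborel. T (\<lambda>x. f x + g x) x = T' (\<lambda>x. f x + g x) x"
      using fg(3,4) B(2)[OF fg(1,2)] B'(2)[OF fg(1,2)] by eventually_elim simp
  next
    fix f :: "real ^ 'n \<Rightarrow> real" and c
    assume f: "f \<in> Lq ?q" "AE x in lborel. T f x = T' f x"
    show "AE x in lborel. T (\<lambda>x. c * f x) x = T' (\<lambda>x. c * f x) x"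
      using f(2) B(3)[OF f(1), of c] B'(3)[OF f(1), of c] by eventually_elim simp
  next
    fix g and G :: "nat \<Rightarrow> real ^ 'n \<Rightarrow> real"
    assume G: "\<And>k. G k \<in> Lq ?q" and g: "g \<in> Lq ?q" and lim: "(\<lambda>k. Lq_norm ?q (\<lambda>x. G k x - g x)) \<longlonglongrightarrow> 0"
      and eq: "\<And>k. AE x in lborel. T (G k) x = T' (G k) x"
    have p0: "p > 0" using p by simp
    have Td: "(\<lambda>x. T g x - T' g x) \<in> Lq p" by (rule Lq_diff[OF B(1)[OF g] B'(1)[OF g] p0])
    have d: "(\<lambda>x. T (G k) x - T g x) \<in> Lq p" "(\<lambda>x. T' (G k) x - T' g x) \<in> Lq p" for k
      using Lq_diff[OF B(1)[OF G] B(1)[OF g] p0] Lq_diff[OF B'(1)[OF G] B'(1)[OF g] p0] by blast+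
    have le: "Lq_norm p (\<lambda>x. T g x - T' g x) \<le> Lq_norm p (\<lambda>x. T' (G k) x - T' g x) + Lq_norm p (\<lambda>x. T (G k) x - T g x)" for k
    proof -
      have "Lq_norm p (\<lambda>x. T g x - T' g x) = Lq_norm p (\<lambda>x. (T' (G k) x - T' g x) - (T (G k) x - T g x))"
        by (rule Lq_norm_cong_AE[OF LqD(1)[OF Td] LqD(1)[OF Lq_diff[OF d(2) d(1) p0]]])
           (use eq[of k] in eventually_elim, simp)
      also have "\<dots> \<le> Lq_norm p (\<lambda>x. T' (G k) x - T' g x) + Lq_norm p (\<lambda>x. T (G k) x - T g x)"
        using p by (intro Lq_norm_triangle_diff d) auto
      finally show ?thesis .
    qed
    have "(\<lambda>k. Lq_norm p (\<lambda>x. T' (G k) x - T' g x) + Lq_norm p (\<lambda>x. T (G k) x - T g x)) \<longlonglongrightarrow> 0 + 0"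
      by (intro tendsto_add bounded_op_tendsto(1)[OF b(1) G g q p0 lim] bounded_op_tendsto(1)[OF b(2) G g q p0 lim])
    then have "Lq_norm p (\<lambda>x. T g x - T' g x) \<le> 0"
      using LIMSEQ_le_const[of _ "0 + 0" "Lq_norm p (\<lambda>x. T g x - T' g x)"] le by auto
    then have "Lq_norm p (\<lambda>x. T g x - T' g x) = 0" using Lq_norm_nonneg[of p "\<lambda>x. T g x - T' g x"] by linarith
    then show "AE x in lborel. T g x = T' g x"
      using Lq_norm_eq_0_iff[OF Td p0] by simp
  qed
qed

lemma Psi_op_extension:
  assumes "conv_extension p (Psi l :: real ^ 'n \<Rightarrow> real) T"
  shows "conv_extension p (Psi l :: real ^ 'n \<Rightarrow> real) (Psi_op p l)"
  unfolding Psi_op_def using someI[of "conv_extension p (Psi l)", OF assms] assms by auto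

text \<open>Dominated convergence for continuous functions supported in a box, then density together
  with the uniform operator bound c. The condition X k >= 1/2 provides both c and a common ball, of
  twice the radius, outside which all dilates vanish.\<close>

lemma dilation_tendsto:
  fixes g :: "real ^ 'n \<Rightarrow> real" and X :: "nat \<Rightarrow> real"
  assumes q: "q \<ge> 1" and g: "g \<in> Lq q" and X: "X \<longlonglongrightarrow> 1" "\<And>k. X k \<ge> 1 / 2"
  shows "(\<lambda>k. Lq_norm q (\<lambda>x. g (X k *\<^sub>R x) - g x)) \<longlonglongrightarrow> 0"
proof -
  have q0: "q > 0" using q by simp
  have X0: "X k > 0" for k using X(2)[of k] by linarith
  define c where "c = 1 / ((1 / 2) ^ DIM(real ^ 'n)) powr (1 / q)"
  have c: "c > 0" by (simp add: c_def)
  have dil: "Lq_norm q (\<lambda>x. f (X k *\<^sub>R x)) \<le> c * Lq_norm q f" if "f \<in> Lq q" for f :: "real ^ 'n \<Rightarrow> real" and k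
  proof -
    have "((1 / 2) ^ DIM(real ^ 'n)) powr (1 / q) \<le> (X k ^ DIM(real ^ 'n)) powr (1 / q)"
      using X(2)[of k] q by (intro powr_mono2 power_mono) auto
    then have "Lq_norm q f / (X k ^ DIM(real ^ 'n)) powr (1 / q) \<le> Lq_norm q f / ((1 / 2) ^ DIM(real ^ 'n)) powr (1 / q)"
      using X0[of k] by (intro divide_left_mono mult_pos_pos) auto
    then show ?thesis using Lq_norm_dilation'[OF X0 q0 that] by (simp add: c_def)
  qed
  have dL: "(\<lambda>x. f (X k *\<^sub>R x)) \<in> Lq q" "(\<lambda>x. f (X k *\<^sub>R x) - f x) \<in> Lq q" if "f \<in> Lq q" for f :: "real ^ 'n \<Rightarrow> real" and k
    using Lq_dilation[OF X0 that] Lq_diff[OF Lq_dilation[OF X0 that] that q0] by auto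
  show ?thesis
  proof (rule Lq_induct[OF q0 _ _ _ _ g])
    fix g :: "real ^ 'n \<Rightarrow> real" and e d M
    assume sg: "schwartz g" and gL: "g \<in> Lq q" and bd: "\<And>x. \<bar>g x\<bar> \<le> M * indicator (box e d) x"
    obtain R where R: "R > 0" "box e d \<subseteq> ball 0 R"
      using bounded_subset_ballD[OF bounded_box] by blast
    define D where "D x = \<bar>M\<bar> * indicator (ball 0 (2 * R)) x" for x :: "real ^ 'n"
    have DL: "D \<in> Lq q"
      unfolding D_def[abs_def] using R by (intro Lq_scale Lq_indicator) (auto simp: emeasure_ball)
    show "(\<lambda>k. Lq_norm q (\<lambda>x. g (X k *\<^sub>R x) - g x)) \<longlonglongrightarrow> 0"
    proof (rule Lq_dominated_convergence[OF q0 _ _ DL])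
      show "(\<lambda>x. g (X k *\<^sub>R x)) \<in> borel_measurable borel" for k using LqD(1)[OF dL(1)[OF gL]] .
      show "g \<in> borel_measurable borel" using LqD(1)[OF gL] .
      show "\<bar>g (X k *\<^sub>R x)\<bar> \<le> \<bar>D x\<bar>" for k x
      proof (cases "X k *\<^sub>R x \<in> box e d")
        case True
        then have "X k * norm x < R" using R X0[of k] by (auto simp: subset_iff)
        moreover have "1 / 2 * norm x \<le> X k * norm x" using X(2) by (intro mult_right_mono) auto
        ultimately have "norm x < 2 * R" by linarith
        then have "\<bar>D x\<bar> = \<bar>M\<bar>" by (simp add: D_def)
        then show ?thesis using bd[of "X k *\<^sub>R x"] True by simp
      next
        case False
        then show ?thesis using bd[of "X k *\<^sub>R x"] by simp
      qed
      show "AE x in lborel. (\<lambda>k. g (X k *\<^sub>R x)) \<longlonglongrightarrow> g x"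
      proof (intro AE_I2)
        fix x
        have "g differentiable at x" for x
          using sg unfolding schwartz_def by (metis partials.simps(1))
        then have "isCont g (1 *\<^sub>R x)" using differentiable_imp_continuous_within by blast
        moreover have "(\<lambda>k. X k *\<^sub>R x) \<longlonglongrightarrow> 1 *\<^sub>R x" by (intro tendsto_intros X)
        ultimately show "(\<lambda>k. g (X k *\<^sub>R x)) \<longlonglongrightarrow> g x"
          using isCont_tendsto_compose[of "1 *\<^sub>R x" g] by auto
      qed
    qed
  next
    fix f g :: "real ^ 'n \<Rightarrow> real"
    assume fg: "f \<in> Lq q" "g \<in> Lq q" and l: "(\<lambda>k. Lq_norm q (\<lambda>x. f (X k *\<^sub>R x) - f x)) \<longlonglongrightarrow> 0"
      "(\<lambda>k. Lq_norm q (\<lambda>x. g (X k *\<^sub>R x) - g x)) \<longlonglongrightarrow> 0"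
    have le: "Lq_norm q (\<lambda>x. f (X k *\<^sub>R x) + g (X k *\<^sub>R x) - (f x + g x)) \<le>
       Lq_norm q (\<lambda>x. f (X k *\<^sub>R x) - f x) + Lq_norm q (\<lambda>x. g (X k *\<^sub>R x) - g x)" for k
      using Lq_norm_triangle[OF q dL(2)[OF fg(1)] dL(2)[OF fg(2)], of k k] by (simp add: algebra_simps)
    show "(\<lambda>k. Lq_norm q (\<lambda>x. f (X k *\<^sub>R x) + g (X k *\<^sub>R x) - (f x + g x))) \<longlonglongrightarrow> 0"
      by (rule tendsto_sandwich[OF _ _ tendsto_const tendsto_add_zero[OF l]]) (use le in auto)
  next
    fix f :: "real ^ 'n \<Rightarrow> real" and c
    assume f: "f \<in> Lq q" "(\<lambda>k. Lq_norm q (\<lambda>x. f (X k *\<^sub>R x) - f x)) \<longlonglongrightarrow> 0"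
    have "Lq_norm q (\<lambda>x. c * f (X k *\<^sub>R x) - c * f x) = \<bar>c\<bar> * Lq_norm q (\<lambda>x. f (X k *\<^sub>R x) - f x)" for k
      using Lq_norm_scale[OF q0, of c "\<lambda>x. f (X k *\<^sub>R x) - f x"] by (simp add: right_diff_distrib)
    then show "(\<lambda>k. Lq_norm q (\<lambda>x. c * f (X k *\<^sub>R x) - c * f x)) \<longlonglongrightarrow> 0"
      using tendsto_mult_right_zero[OF f(2)] by simp
  next
    fix g and G :: "nat \<Rightarrow> real ^ 'n \<Rightarrow> real"
    assume G: "\<And>k. G k \<in> Lq q" and g: "g \<in> Lq q" and lim: "(\<lambda>k. Lq_norm q (\<lambda>x. G k x - g x)) \<longlonglongrightarrow> 0"
      and eq: "\<And>j. (\<lambda>k. Lq_norm q (\<lambda>x. G j (X k *\<^sub>R x) - G j x)) \<longlonglongrightarrow> 0"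
    have d: "(\<lambda>x. G j x - g x) \<in> Lq q" for j by (rule Lq_diff[OF G g q0])
    have le: "Lq_norm q (\<lambda>x. g (X k *\<^sub>R x) - g x) \<le>
       Lq_norm q (\<lambda>x. G j (X k *\<^sub>R x) - G j x) + (c + 1) * Lq_norm q (\<lambda>x. G j x - g x)" for j k
    proof -
      have "Lq_norm q (\<lambda>x. g (X k *\<^sub>R x) - g x) =
         Lq_norm q (\<lambda>x. ((G j (X k *\<^sub>R x) - G j x) + (G j x - g x)) - (G j (X k *\<^sub>R x) - g (X k *\<^sub>R x)))"
        by simp
      also have "\<dots> \<le> Lq_norm q (\<lambda>x. (G j (X k *\<^sub>R x) - G j x) + (G j x - g x)) + Lq_norm q (\<lambda>x. G j (X k *\<^sub>R x) - g (X k *\<^sub>R x))"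
        by (intro Lq_norm_triangle_diff q Lq_add dL(2) G d q0 dL(1)[OF d])
      also have "Lq_norm q (\<lambda>x. (G j (X k *\<^sub>R x) - G j x) + (G j x - g x)) \<le> Lq_norm q (\<lambda>x. G j (X k *\<^sub>R x) - G j x) + Lq_norm q (\<lambda>x. G j x - g x)"
        by (intro Lq_norm_triangle q dL(2) G d)
      also have "Lq_norm q (\<lambda>x. G j (X k *\<^sub>R x) - g (X k *\<^sub>R x)) \<le> c * Lq_norm q (\<lambda>x. G j x - g x)"
        using dil[OF d] .
      finally show ?thesis by (simp add: algebra_simps)
    qed
    show "(\<lambda>k. Lq_norm q (\<lambda>x. g (X k *\<^sub>R x) - g x)) \<longlonglongrightarrow> 0"
    proof (rule LIMSEQ_I)
      fix e :: real assume e: "e > 0"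
      have "\<forall>\<^sub>F j in sequentially. Lq_norm q (\<lambda>x. G j x - g x) < e / (2 * (c + 1))"
        using order_tendstoD(2)[OF lim, of "e / (2 * (c + 1))"] e c by simp
      then obtain j where j: "Lq_norm q (\<lambda>x. G j x - g x) < e / (2 * (c + 1))"
        by (auto simp: eventually_sequentially)
      then have j': "(c + 1) * Lq_norm q (\<lambda>x. G j x - g x) < e / 2" using c by (simp add: field_simps)
      have "\<forall>\<^sub>F k in sequentially. Lq_norm q (\<lambda>x. G j (X k *\<^sub>R x) - G j x) < e / 2"
        using order_tendstoD(2)[OF eq[of j], of "e / 2"] e by simp
      then obtain k0 where k0: "\<And>k. k \<ge> k0 \<Longrightarrow> Lq_norm q (\<lambda>x. G j (X k *\<^sub>R x) - G j x) < e / 2"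
        by (auto simp: eventually_sequentially)
      have "norm (Lq_norm q (\<lambda>x. g (X k *\<^sub>R x) - g x) - 0) < e" if "k \<ge> k0" for k
        using le[of k j] k0[OF that] j' Lq_norm_nonneg[of q "\<lambda>x. g (X k *\<^sub>R x) - g x"] by simp
      then show "\<exists>k0. \<forall>k\<ge>k0. norm (Lq_norm q (\<lambda>x. g (X k *\<^sub>R x) - g x) - 0) < e" by blast
    qed
  qed
qed

section \<open>Ground states for exponents below four\<close>

lemma integrable_norm_powr_ball:
  fixes s r :: real
  assumes "0 \<le> s" "s < real DIM('a)" "r > 0"
  shows "integrable lborel (\<lambda>x::'a::euclidean_space. indicator (ball 0 r) x * norm x powr (- s))"
proof (rule integrableI_bounded)
  let ?N = "DIM('a)" and ?V = "unit_ball_vol (real DIM('a))"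
  have [measurable]: "ball (0::'a) r \<in> sets borel" by simp
  have "(\<lambda>x::'a. indicator (ball 0 r) x * norm x powr (- s)) \<in> borel_measurable borel" by measurable
  then show "(\<lambda>x::'a. indicator (ball 0 r) x * norm x powr (- s)) \<in> borel_measurable lborel" by simp
  \<comment> \<open>c k bounds |x|^(-s) on the dyadic shell r/2^(k+1) <= |x| < r/2^k. Enlarging
    shells to balls still leaves a geometric series, of ratio 2^(s-N) < 1.\<close>
  define c where "c k = (r / 2 ^ Suc k) powr (- s)" for k
  define \<theta> where "\<theta> = 2 powr (s - real ?N)"
  have \<theta>: "0 \<le> \<theta>" "\<theta> < 1" using assms powr_less_mono[of "s - real ?N" 0 2] by (auto simp: \<theta>_def)
  have ptw: "ennreal (norm (indicator (ball 0 r) x * norm x powr (- s))) \<le> (\<Sum>k. ennreal (c k) * indicator (ball 0 (r / 2 ^ k)) x)" for x :: 'a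
  proof (cases "x \<in> ball 0 r \<and> x \<noteq> 0")
    case False
    then show ?thesis by auto
  next
    case True
    obtain n where "(1 / 2 :: real) ^ n < norm x / r"
      using real_arch_pow_inv[of "norm x / r" "1 / 2"] True assms by auto
    then have "r * (1 / 2) ^ n < norm x"
      using assms by (simp add: pos_less_divide_eq mult.commute)
    then have "r / 2 ^ n \<le> norm x" by (simp add: power_divide)
    then have ex: "\<exists>n. r / 2 ^ n \<le> norm x" by blast
    define n where "n = (LEAST n. r / 2 ^ n \<le> norm x)"
    have n: "r / 2 ^ n \<le> norm x" unfolding n_def by (rule LeastI_ex[OF ex])
    have "n \<noteq> 0" using n True by (intro notI) auto
    then obtain k where k: "n = Suc k" by (cases n) auto
    have "\<not> r / 2 ^ k \<le> norm x" using not_less_Least[of k "\<lambda>n. r / 2 ^ n \<le> norm x"] k n_def by auto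
    then have mem: "x \<in> ball 0 (r / 2 ^ k)" by simp
    have "norm x powr (- s) \<le> c k"
      unfolding c_def using n k assms by (intro powr_mono2') auto
    then have "ennreal (norm (indicator (ball 0 r) x * norm x powr (- s))) \<le> ennreal (c k) * indicator (ball 0 (r / 2 ^ k)) x"
      using mem True by (auto intro!: ennreal_leI)
    also have "\<dots> \<le> (\<Sum>k. ennreal (c k) * indicator (ball 0 (r / 2 ^ k)) x)"
    proof -
      have "F k \<le> suminf F" for F :: "nat \<Rightarrow> ennreal"
        using sum_le_suminf[of F "{k}"] by simp
      then show ?thesis .
    qed
    finally show ?thesis .
  qed
  have summand: "ennreal (c k) * emeasure lborel (ball (0::'a) (r / 2 ^ k)) = ennreal (((r / 2) powr (- s) * ?V * r ^ ?N) * \<theta> ^ k)" for k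
  proof -
    have "emeasure lborel (ball (0::'a) (r / 2 ^ k)) = ennreal (?V * (r / 2 ^ k) ^ ?N)"
      using assms by (intro emeasure_ball) auto
    moreover have "c k * (?V * (r / 2 ^ k) ^ ?N) = ((r / 2) powr (- s) * ?V * r ^ ?N) * \<theta> ^ k"
    proof -
      have e1: "c k = (r / 2) powr (- s) * (2 powr real k) powr s"
        using assms by (simp add: c_def powr_realpow powr_divide powr_mult powr_minus_divide)
      have e2: "(r / 2 ^ k) ^ ?N = r ^ ?N * (2 powr real k) powr (- real ?N)"
        by (simp add: power_divide powr_realpow powr_minus_divide powr_powr flip: power_mult)
      have "(2 powr real k) powr s * (2 powr real k) powr (- real ?N) = 2 powr ((s - real ?N) * real k)"
        unfolding powr_add[symmetric] powr_powr by (simp add: algebra_simps)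
      also have "\<dots> = \<theta> ^ k"
        unfolding powr_powr[symmetric] \<theta>_def by (rule powr_realpow) simp
      finally have e3: "(2 powr real k) powr s * (2 powr real k) powr (- real ?N) = \<theta> ^ k" .
      have "c k * (?V * (r / 2 ^ k) ^ ?N) = (r / 2) powr (- s) * ?V * r ^ ?N * ((2 powr real k) powr s * (2 powr real k) powr (- real ?N))"
        unfolding e1 e2 by (simp only: mult_ac)
      then show ?thesis unfolding e3 .
    qed
    moreover have "c k \<ge> 0" by (simp add: c_def)
    ultimately show ?thesis by (metis ennreal_mult')
  qed
  have "(\<integral>\<^sup>+ (x::'a). ennreal (norm (indicator (ball 0 r) x * norm x powr (- s))) \<partial>lborel) \<le>
     (\<integral>\<^sup>+ (x::'a). (\<Sum>k. ennreal (c k) * indicator (ball 0 (r / 2 ^ k)) x) \<partial>lborel)"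
    by (intro nn_integral_mono ptw)
  also have "\<dots> = (\<Sum>k. ennreal (c k) * emeasure lborel (ball (0::'a) (r / 2 ^ k)))"
  proof -
    have "(\<integral>\<^sup>+ (x::'a). (\<Sum>k. ennreal (c k) * indicator (ball 0 (r / 2 ^ k)) x) \<partial>lborel) =
      (\<Sum>k. (\<integral>\<^sup>+ (x::'a). ennreal (c k) * indicator (ball 0 (r / 2 ^ k)) x \<partial>lborel))"
      by (rule nn_integral_suminf)
         (intro borel_measurable_times_ennreal borel_measurable_const borel_measurable_indicator, simp)
    then show ?thesis by (simp only: nn_integral_cmult_indicator sets_lborel borel_open open_ball)
  qed
  also have "\<dots> = (\<Sum>k. ennreal (((r / 2) powr (- s) * ?V * r ^ ?N) * \<theta> ^ k))"
    by (simp only: summand)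
  also have "\<dots> < \<infinity>"
  proof -
    have "summable (\<lambda>k. ((r / 2) powr (- s) * ?V * r ^ ?N) * \<theta> ^ k)"
      using \<theta> by (intro summable_mult summable_geometric) auto
    then show ?thesis
      using assms \<theta> by (subst suminf_ennreal2) (auto intro!: mult_nonneg_nonneg)
  qed
  finally show "(\<integral>\<^sup>+ (x::'a). ennreal (norm (indicator (ball 0 r) x * norm x powr (- s))) \<partial>lborel) < \<infinity>" .
qed

lemma integrable_reflect:
  fixes k :: "'a::euclidean_space \<Rightarrow> real"
  assumes "integrable lborel k"
  shows "integrable lborel (\<lambda>y. k (x - y))"
proof -
  have [measurable]: "k \<in> borel_measurable borel" using assms by auto
  have "lborel = density (distr lborel borel (\<lambda>y. x + (-1) *\<^sub>R y)) (\<lambda>_. ennreal (\<bar>-1\<bar> ^ DIM('a)))"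
    by (rule lborel_affine) simp
  then have "lborel = distr lborel borel (\<lambda>y. x - y)"
    by (simp add: density_1)
  then have "integrable (distr lborel borel (\<lambda>y. x - y)) k" using assms by metis
  then show ?thesis by (subst (asm) integrable_distr_eq) auto
qed

lemma small_box_norm:
  fixes x y c :: "real ^ 'n"
  assumes "x \<in> box (c - \<rho> *\<^sub>R 1) (c + \<rho> *\<^sub>R 1)" "y \<in> box (c - \<rho> *\<^sub>R 1) (c + \<rho> *\<^sub>R 1)"
  shows "norm (x - y) < real CARD('n) * (2 * \<rho>)"
proof -
  have "norm (x - y) \<le> (\<Sum>i\<in>UNIV. \<bar>(x - y) $ i\<bar>)" by (rule norm_le_l1_cart)
  also have "\<dots> < (\<Sum>i\<in>(UNIV :: 'n set). 2 * \<rho>)"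
  proof (rule sum_strict_mono)
    fix i :: 'n
    have "c $ i - \<rho> < x $ i" "x $ i < c $ i + \<rho>" "c $ i - \<rho> < y $ i" "y $ i < c $ i + \<rho>"
      using assms by (auto simp: mem_box_cart)
    then show "\<bar>(x - y) $ i\<bar> < 2 * \<rho>" by (simp add: abs_less_iff)
  qed auto
  finally show ?thesis by simp
qed

text \<open>The convolution formula is given for Schwartz functions only. Inside a box whose
  differences have norm below r, K may be replaced by an integrable k that agrees with it there; the
  formula then survives dominated limits and reaches indicators.\<close>

lemma conv_extension_local:
  fixes k :: "real ^ 'n \<Rightarrow> real"
  assumes p: "p > 1" and T: "conv_extension p K T" and k: "integrable lborel k" "\<And>x. norm x < r \<Longrightarrow> k x = K x"
    and C: "\<And>x y. x \<in> box c d \<Longrightarrow> y \<in> box c d \<Longrightarrow> norm (x - y) < r"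
    and A: "A \<in> sets borel"
  shows "AE x in lborel. x \<in> box c d \<longrightarrow> T (indicator (A \<inter> box c d)) x = (LINT y|lborel. k (x - y) * indicator (A \<inter> box c d) y)"
proof -
  let ?q = "conj_exp p"
  have q: "?q > 0" and p0: "p > 0" using conj_exp_bounds[OF p] p by simp_all
  have bT: "bounded_op ?q p T" using T unfolding conv_extension_def bounded_op_def by blast
  note B = bounded_opD[OF bT]
  have CL: "indicator (box c d) \<in> Lq ?q"
    by (rule Lq_indicator) (use emeasure_lborel_box_finite[of c d] in auto)
  have KL: "g \<in> Lq ?q" if "g \<in> borel_measurable borel" "\<And>x. \<bar>g x\<bar> \<le> M * indicator (box c d) x" for g M
  proof (rule Lq_dominated[OF Lq_scale[OF CL, of M] that(1) _ q])
    show "\<bar>g x\<bar> \<le> \<bar>M * indicator (box c d) x\<bar>" for x using that(2)[of x] by linarith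
  qed
  have [measurable]: "k \<in> borel_measurable borel" using k(1) by auto
  have kx: "integrable lborel (\<lambda>y. k (x - y) * g y)" if g [measurable]: "g \<in> borel_measurable borel" and M: "\<And>x. \<bar>g x\<bar> \<le> M * indicator (box c d) x" for g M x
  proof (rule Bochner_Integration.integrable_bound)
    show "integrable lborel (\<lambda>y. \<bar>M\<bar> * k (x - y))" using integrable_reflect[OF k(1)] by simp
    have "\<bar>g y\<bar> \<le> \<bar>M\<bar>" for y using M[of y] abs_ge_self[of M] by (cases "y \<in> box c d") auto
    then show "AE y in lborel. norm (k (x - y) * g y) \<le> norm (\<bar>M\<bar> * k (x - y))"
      by (auto simp: abs_mult mult.commute intro!: mult_right_mono)
  qed simp
  let ?P = "\<lambda>g. AE x in lborel. x \<in> box c d \<longrightarrow> T g x = (LINT y|lborel. k (x - y) * g y)"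
  show ?thesis
  proof (rule box_indicator_induct[where P="?P", OF _ _ _ _ A])
    fix g :: "real ^ 'n \<Rightarrow> real" assume sg: "schwartz g" and "g \<in> box_bounded c d"
    then obtain M where M: "\<And>x. \<bar>g x\<bar> \<le> M * indicator (box c d) x" by (auto simp: box_bounded_def)
    have "AE x in lborel. T g x = (LINT y|lborel. K (x - y) * g y)"
      using T sg unfolding conv_extension_def by blast
    then show "?P g"
    proof eventually_elim
      case (elim x)
      have "K (x - y) * g y = k (x - y) * g y" if "x \<in> box c d" for y
      proof (cases "y \<in> box c d")
        case True
        then show ?thesis using k(2)[OF C[OF that True]] by simp
      next
        case False
        then show ?thesis using M[of y] by simp
      qed
      then have "(\<lambda>y. K (x - y) * g y) = (\<lambda>y. k (x - y) * g y)" if "x \<in> box c d" using that by blast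
      then show ?case using elim by metis
    qed
  next
    fix f g :: "real ^ 'n \<Rightarrow> real"
    assume f: "f \<in> box_bounded c d"
      and g: "g \<in> box_bounded c d" and P: "?P f" "?P g"
    obtain M M' where M: "f \<in> borel_measurable borel" "\<And>x. \<bar>f x\<bar> \<le> M * indicator (box c d) x" "g \<in> borel_measurable borel" "\<And>x. \<bar>g x\<bar> \<le> M' * indicator (box c d) x"
      using f g by (auto simp: box_bounded_def)
    show "?P (\<lambda>x. f x + g x)"
      using B(2)[OF KL[OF M(1,2)] KL[OF M(3,4)]] P
      by eventually_elim (simp add: distrib_left Bochner_Integration.integral_add[OF kx[OF M(1,2)] kx[OF M(3,4)]])
  next
    fix f :: "real ^ 'n \<Rightarrow> real" and e
    assume f: "f \<in> box_bounded c d" and P: "?P f"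
    obtain M where M: "f \<in> borel_measurable borel" "\<And>x. \<bar>f x\<bar> \<le> M * indicator (box c d) x"
      using f by (auto simp: box_bounded_def)
    show "?P (\<lambda>x. e * f x)"
      using B(3)[OF KL[OF M], of e] P
      by eventually_elim (simp add: mult.left_commute[of _ e])
  next
    fix g and G :: "nat \<Rightarrow> real ^ 'n \<Rightarrow> real"
    assume Gm: "\<And>k. G k \<in> borel_measurable borel" and Gb: "\<And>k x. \<bar>G k x\<bar> \<le> indicator (box c d) x"
      and lim: "\<And>x. (\<lambda>k. G k x) \<longlonglongrightarrow> g x" and P: "\<And>k. ?P (G k)"
    have gm: "g \<in> borel_measurable borel" by (rule borel_measurable_LIMSEQ_real[OF lim Gm])
    have gb: "\<bar>g x\<bar> \<le> 1 * indicator (box c d) x" for x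
      using LIMSEQ_le_const2[OF tendsto_rabs[OF lim[of x]]] Gb by auto
    have GL: "G j \<in> Lq ?q" for j using KL[OF Gm, of j 1] Gb by simp
    have gL: "g \<in> Lq ?q" by (rule KL[OF gm gb])
    have "(\<lambda>k. Lq_norm ?q (\<lambda>x. G k x - g x)) \<longlonglongrightarrow> 0"
      by (rule Lq_dominated_convergence[OF q Gm gm CL]) (use Gb lim in auto)
    from bounded_op_tendsto(2)[OF bT GL gL q p0 this]
    obtain \<sigma> where \<sigma>: "strict_mono \<sigma>" "AE x in lborel. (\<lambda>j. T (G (\<sigma> j)) x) \<longlonglongrightarrow> T g x" by blast
    have "AE x in lborel. \<forall>j. x \<in> box c d \<longrightarrow> T (G j) x = (LINT y|lborel. k (x - y) * G j y)"
      unfolding AE_all_countable using P by blast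
    with \<sigma>(2) show "?P g"
    proof eventually_elim
      case (elim x)
      show ?case
      proof
        assume x: "x \<in> box c d"
        have [measurable]: "G j \<in> borel_measurable borel" "g \<in> borel_measurable borel" for j using Gm gm by auto
        have "(\<lambda>j. LINT y|lborel. k (x - y) * G (\<sigma> j) y) \<longlonglongrightarrow> (LINT y|lborel. k (x - y) * g y)"
        proof (rule integral_dominated_convergence)
          show "integrable lborel (\<lambda>y. \<bar>k (x - y)\<bar>)" using integrable_reflect[OF k(1)] by simp
          show "AE y in lborel. (\<lambda>j. k (x - y) * G (\<sigma> j) y) \<longlonglongrightarrow> k (x - y) * g y"
            using LIMSEQ_subseq_LIMSEQ[OF lim \<sigma>(1)] by (auto intro!: tendsto_intros simp: o_def)
          show "AE y in lborel. norm (k (x - y) * G (\<sigma> j) y) \<le> \<bar>k (x - y)\<bar>" for j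
          proof (intro AE_I2)
            fix y
            have "\<bar>G (\<sigma> j) y\<bar> \<le> 1" using Gb[of "\<sigma> j" y] by (cases "y \<in> box c d") auto
            then show "norm (k (x - y) * G (\<sigma> j) y) \<le> \<bar>k (x - y)\<bar>"
              by (simp add: abs_mult mult_left_le)
          qed
        qed simp_all
        moreover have "(\<lambda>j. LINT y|lborel. k (x - y) * G (\<sigma> j) y) \<longlonglongrightarrow> T g x"
          using elim x by simp
        ultimately show "T g x = (LINT y|lborel. k (x - y) * g y)" by (rule LIMSEQ_unique[symmetric])
      qed
    qed
  qed
qed

text \<open>If all differences of points of E lie where \<Psi> >= m, the form of its indicator is at
  least m |E|^2. Countably many small boxes cover the space, so one of them meets S in positive
  measure.\<close>

lemma local_positivity:
  fixes S :: "(real ^ 'n) set"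
  assumes N: "CARD('n) \<ge> 2" and l: "l > 0" and p: "p > 1"
    and T: "conv_extension p (Psi l :: real ^ 'n \<Rightarrow> real) T"
    and S: "S \<in> sets borel" "emeasure lborel S > 0"
  shows "\<exists>E. E \<subseteq> S \<and> E \<in> sets borel \<and> emeasure lborel E < \<infinity> \<and> (LINT x|lborel. indicator E x * T (indicator E) x) > 0"
proof -
  let ?N = "CARD('n)" and ?q = "conj_exp p"
  have q: "?q > 1" "1 / p + 1 / ?q = 1" using conj_exp_bounds[OF p] by auto
  obtain r m C where r: "r > 0" and m: "m > 0" and
    \<Psi>: "\<And>x::real ^ 'n. 0 < norm x \<Longrightarrow> norm x < r \<Longrightarrow> m \<le> Psi l x"
       "\<And>x::real ^ 'n. 0 < norm x \<Longrightarrow> norm x < r \<Longrightarrow> Psi l x \<le> C * norm x powr (3 / 2 - real ?N)"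
    using Psi_small[OF N l] by blast
  define k where "k x = indicator (ball 0 r) x * Psi l x" for x :: "real ^ 'n"
  have [measurable]: "Psi l \<in> borel_measurable (borel :: (real ^ 'n) measure)" by (rule Psi_measurable[OF N l])
  have kint: "integrable lborel k"
  proof (rule Bochner_Integration.integrable_bound)
    show "integrable lborel (\<lambda>x::real ^ 'n. \<bar>C\<bar> * (indicator (ball 0 r) x * norm x powr (- (real ?N - 3 / 2))))"
      using N r by (intro integrable_mult_right integrable_norm_powr_ball) auto
    have [measurable]: "ball (0 :: real ^ 'n) r \<in> sets borel" by simp
    have "k \<in> borel_measurable borel" unfolding k_def[abs_def] by measurable
    then show "k \<in> borel_measurable lborel" by simp
    have "AE x in lborel. x \<noteq> (0 :: real ^ 'n)" by (rule AE_lborel_singleton)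
    then show "AE x in lborel. norm (k x) \<le> norm (\<bar>C\<bar> * (indicator (ball 0 r) x * norm x powr (- (real ?N - 3 / 2))))"
    proof eventually_elim
      case (elim x)
      show ?case
      proof (cases "x \<in> ball 0 r")
        case True
        then have x: "0 < norm x" "norm x < r" using elim by auto
        have "norm (k x) = Psi l x" using True \<Psi>(1)[OF x] m by (simp add: k_def)
        also have "\<dots> \<le> C * norm x powr (3 / 2 - real ?N)" by (rule \<Psi>(2)[OF x])
        also have "\<dots> \<le> \<bar>C\<bar> * norm x powr (3 / 2 - real ?N)" by (intro mult_right_mono) auto
        finally show ?thesis using True by simp
      qed (simp add: k_def)
    qed
  qed
  \<comment> \<open>The Euclidean norm is at most the l1 norm, so differences within a box of
    half-width \<rho> have norm below N * 2 \<rho> = r.\<close>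
  define \<rho> where "\<rho> = r / (2 * real ?N)"
  have \<rho>: "\<rho> > 0" "real ?N * (2 * \<rho>) = r" using r N by (auto simp: \<rho>_def)
  define Q where "Q z = box (z - \<rho> *\<^sub>R 1) (z + \<rho> *\<^sub>R 1)" for z :: "real ^ 'n"
  obtain D :: "(real ^ 'n) set" where D: "countable D" "\<And>X. open X \<Longrightarrow> X \<noteq> {} \<Longrightarrow> \<exists>d\<in>D. d \<in> X"
    using countable_dense_setE by blast
  \<comment> \<open>x lies in Q z exactly if z lies in Q x, so a dense set of centres suffices for a
    cover.\<close>
  have cover: "\<exists>z\<in>D. x \<in> Q z" for x
  proof -
    have "x \<in> Q x" using \<rho> by (simp add: Q_def mem_box_cart)
    then have "open (Q x)" "Q x \<noteq> {}" by (auto simp: Q_def)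
    then obtain z where "z \<in> D" "z \<in> Q x" using D(2) by blast
    then have "x \<in> Q z" by (auto simp: Q_def mem_box_cart algebra_simps)
    then show ?thesis using \<open>z \<in> D\<close> by blast
  qed
  have "\<exists>z\<in>D. emeasure lborel (S \<inter> Q z) > 0"
  proof (rule ccontr)
    assume "\<not> ?thesis"
    then have "S \<inter> Q z \<in> null_sets lborel" if "z \<in> D" for z
      using that S(1) by (auto simp: null_sets_def Q_def)
    then have "(\<Union>z\<in>D. S \<inter> Q z) \<in> null_sets lborel" using D(1) by (intro null_sets_UN') auto
    moreover have "(\<Union>z\<in>D. S \<inter> Q z) = S" using cover by auto
    ultimately show False using S(2) by auto
  qed
  then obtain z where z: "emeasure lborel (S \<inter> Q z) > 0" by blast
  define E where "E = S \<inter> Q z"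
  have E [measurable]: "E \<in> sets borel" using S(1) by (auto simp: E_def Q_def)
  have fin: "emeasure lborel E < \<infinity>"
  proof -
    have "emeasure lborel E \<le> emeasure lborel (Q z)" unfolding E_def Q_def by (rule emeasure_mono) auto
    also have "\<dots> < \<infinity>" unfolding Q_def by (rule emeasure_lborel_box_finite)
    finally show ?thesis .
  qed
  have EL: "indicator E \<in> Lq ?q" by (rule Lq_indicator[OF E fin])
  have bT: "bounded_op ?q p T" using T unfolding conv_extension_def bounded_op_def by blast
  have TE: "T (indicator E) \<in> Lq p" by (rule bounded_opD(1)[OF bT EL])
  have Eint: "integrable lborel (indicator E :: _ \<Rightarrow> real)" using fin by (intro integrable_real_indicator) auto
  have M: "measure lborel E > 0" using z fin by (simp add: E_def measure_def enn2real_positive_iff)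
  have diam: "norm (x - y) < r" if "x \<in> Q z" "y \<in> Q z" for x y
    using small_box_norm[of x z \<rho> y] that \<rho> by (simp add: Q_def)
  have local: "AE x in lborel. x \<in> Q z \<longrightarrow> T (indicator E) x = (LINT y|lborel. k (x - y) * indicator E y)"
    unfolding E_def Q_def
    by (rule conv_extension_local[OF p T kint _ diam[unfolded Q_def] S(1)]) (auto simp: k_def)
  have lower: "m * measure lborel E \<le> (LINT y|lborel. k (x - y) * indicator E y)" if x: "x \<in> Q z" for x
  proof -
    have "m * measure lborel E = (LINT y|lborel. m * indicator E y)" using Eint by simp
    also have "\<dots> \<le> (LINT y|lborel. k (x - y) * indicator E y)"
    proof (rule integral_mono_AE)
      show "integrable lborel (\<lambda>y. m * indicator E y)" using Eint by simp
      have [measurable]: "k \<in> borel_measurable borel" using kint by auto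
      show "integrable lborel (\<lambda>y. k (x - y) * indicator E y)"
        by (rule Bochner_Integration.integrable_bound[OF integrable_reflect[OF kint, of x]]) (auto simp: indicator_def)
      have "AE y in lborel. y \<noteq> x" by (rule AE_lborel_singleton)
      then show "AE y in lborel. m * indicator E y \<le> k (x - y) * indicator E y"
      proof eventually_elim
        case (elim y)
        show ?case
        proof (cases "y \<in> E")
          case True
          then have d: "0 < norm (x - y)" "norm (x - y) < r" using elim diam[OF x] by (auto simp: E_def)
          then show ?thesis using \<Psi>(1)[OF d] True by (simp add: k_def)
        qed simp
      qed
    qed
    finally show ?thesis .
  qed
  have "0 < m * measure lborel E * measure lborel E" using m M by simp
  also have "\<dots> = (LINT x|lborel. m * measure lborel E * indicator E x)" using Eint by simp
  also have "\<dots> \<le> (LINT x|lborel. indicator E x * T (indicator E) x)"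
  proof (rule integral_mono_AE)
    show "integrable lborel (\<lambda>x. m * measure lborel E * indicator E x)" using Eint by simp
    show "integrable lborel (\<lambda>x. indicator E x * T (indicator E) x)"
      by (rule Hoelder(1)[OF p q EL TE])
    show "AE x in lborel. m * measure lborel E * indicator E x \<le> indicator E x * T (indicator E) x"
      using local
    proof eventually_elim
      case (elim x)
      then show ?case using lower[of x] by (auto simp: indicator_def E_def)
    qed
  qed
  finally show ?thesis using E fin by (intro exI[of _ E]) (auto simp: E_def)
qed

section \<open>Lowering the quotient at semitrivial pairs for p < 4\<close>

context dual_problem
begin

text \<open>Of the factor s^(N+2), two powers come from \<open>dilate_op\<close> and N from the
  change of variables in the integral.\<close>

lemma form_scaling:
  fixes g :: "real ^ 'n \<Rightarrow> real"
  assumes N: "CARD('n) \<ge> 2" and s: "s > 0" and l: "l > 0"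
    and T: "conv_extension p (Psi l :: real ^ 'n \<Rightarrow> real) T" and g: "g \<in> Lq q"
  shows "form (s\<^sup>2 * l) g = form l (\<lambda>x. g ((1 / s) *\<^sub>R x)) / s ^ (CARD('n) + 2)"
proof -
  have p1: "p > 1" using p by simp
  have s': "1 / s > 0" using s by simp
  have T1: "conv_extension p (Psi l :: real ^ 'n \<Rightarrow> real) (Psi_op p l)" by (rule Psi_op_extension[OF T])
  have D: "conv_extension p (Psi (s\<^sup>2 * l) :: real ^ 'n \<Rightarrow> real) (dilate_op s (Psi_op p l))"
    by (rule conv_extension_scale[OF N s l p1 T1])
  have D2: "conv_extension p (Psi (s\<^sup>2 * l) :: real ^ 'n \<Rightarrow> real) (Psi_op p (s\<^sup>2 * l))" by (rule Psi_op_extension[OF D])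
  have ae: "AE x in lborel. Psi_op p (s\<^sup>2 * l) g x = dilate_op s (Psi_op p l) g x"
    by (rule conv_extension_unique[OF p1 D2 D g])
  let ?g = "\<lambda>x. g ((1 / s) *\<^sub>R x)"
  have gL: "?g \<in> Lq q" by (rule Lq_dilation[OF s' g])
  have [measurable]: "g \<in> borel_measurable borel" "Psi_op p l ?g \<in> borel_measurable borel" "Psi_op p (s\<^sup>2 * l) g \<in> borel_measurable borel"
    using LqD(1)[OF g] LqD(1)[OF bounded_opD(1)[OF Psi_op_bounded gL]] LqD(1)[OF bounded_opD(1)[OF Psi_op_bounded g]] by auto
  have "form (s\<^sup>2 * l) g = (LINT x|lborel. 1 / s\<^sup>2 * (?g (s *\<^sub>R x) * Psi_op p l ?g (s *\<^sub>R x)))"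
    unfolding form_def
  proof (rule integral_cong_AE)
    show "AE x in lborel. g x * Psi_op p (s\<^sup>2 * l) g x = 1 / s\<^sup>2 * (?g (s *\<^sub>R x) * Psi_op p l ?g (s *\<^sub>R x))"
      using ae by eventually_elim (use s in \<open>simp add: dilate_op_def\<close>)
  qed measurable
  also have "\<dots> = 1 / s\<^sup>2 * (form l ?g / s ^ CARD('n))"
    using integral_dilation(1)[OF s, of "\<lambda>x. ?g x * Psi_op p l ?g x"] by (simp add: form_def)
  finally show ?thesis by (simp add: power_add mult.commute power2_eq_square)
qed

text \<open>The dummy operator has zero form everywhere. A ground state has total form q A > 0, so
  it certifies an extension for at least one of its two frequencies.\<close>

lemma form_nontrivial_extension:
  assumes "form l g \<noteq> 0"
  shows "\<exists>T. conv_extension p (Psi l :: real ^ 'n \<Rightarrow> real) T"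
proof (rule ccontr)
  assume "\<not> ?thesis"
  then have "(Psi_op p l :: (real ^ 'n \<Rightarrow> real) \<Rightarrow> _) = (\<lambda>g x. 0)" by (simp add: Psi_op_def)
  then show False using assms by (simp add: form_def)
qed

lemma extension_transfer:
  assumes N: "CARD('n) \<ge> 2" and "l > 0" "l' > 0" and T: "conv_extension p (Psi l :: real ^ 'n \<Rightarrow> real) T"
  shows "\<exists>T'. conv_extension p (Psi l' :: real ^ 'n \<Rightarrow> real) T'"
proof -
  have "l' = (sqrt (l' / l))\<^sup>2 * l" using assms by simp
  moreover have "sqrt (l' / l) > 0" using assms by simp
  ultimately show ?thesis using conv_extension_scale[OF N _ assms(2) _ T, of "sqrt (l' / l)"] p by (metis less_trans one_less_numeral_iff semiring_norm(76))
qed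

text \<open>The left factor changes by order e^r, whereas (1 + e^2 m)^q >= 1 + e^2 m because q > 1;
  for r > 2 the gain wins at small e.\<close>

lemma small_perturbation:
  fixes A B K Q \<tau> r :: real
  assumes "A > 0" "B > 0" "K \<ge> 0" "Q > 0" "\<tau> > 0" "r > 2"
  shows "\<exists>e. 0 < e \<and> e \<le> \<tau> \<and> (A + K * e powr r)\<^sup>2 * B powr q < A\<^sup>2 * (B + e\<^sup>2 * Q) powr q"
proof -
  define k where "k = K / A"
  define m where "m = Q / B"
  have km: "k \<ge> 0" "m > 0" using assms by (auto simp: k_def m_def)
  \<comment> \<open>For y = e^r <= 1 one has (1 + k y)^2 <= 1 + y (2k + k^2 + 1), which is below 1 +
    e^2 m as soon as e^(r-2) < \<theta>. Halving \<theta> in the choice of e makes this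
    strict.\<close>
  define \<theta> where "\<theta> = m / (2 * k + k\<^sup>2 + 1)"
  have \<theta>: "\<theta> > 0" using km by (auto simp: \<theta>_def intro!: divide_pos_pos add_nonneg_pos add_nonneg_nonneg)
  define e where "e = min (min 1 \<tau>) ((\<theta> / 2) powr (1 / (r - 2)))"
  have e: "0 < e" "e \<le> 1" "e \<le> \<tau>" using \<theta> assms by (auto simp: e_def)
  have "e powr (r - 2) \<le> ((\<theta> / 2) powr (1 / (r - 2))) powr (r - 2)"
    using e assms by (intro powr_mono2) (auto simp: e_def)
  then have er: "e powr (r - 2) < \<theta>" using \<theta> assms by (simp add: powr_powr)
  define y where "y = e powr r"
  have "e powr r = e\<^sup>2 * e powr (r - 2)" using e by (simp add: powr_diff powr_numeral)
  then have y: "y < e\<^sup>2 * \<theta>" using er e by (simp add: y_def)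
  have y01: "0 < y" "y \<le> 1" using e assms by (auto simp: y_def intro!: powr_le1)
  have "(1 + k * y)\<^sup>2 = 1 + y * (2 * k + k\<^sup>2 * y)" by (simp add: power2_eq_square algebra_simps)
  also have "\<dots> \<le> 1 + y * (2 * k + k\<^sup>2 + 1)"
  proof -
    have "k\<^sup>2 * y \<le> k\<^sup>2 * 1" using y01 by (intro mult_left_mono) auto
    then show ?thesis using y01 by (intro add_left_mono mult_left_mono) auto
  qed
  also have "\<dots> < 1 + (e\<^sup>2 * \<theta>) * (2 * k + k\<^sup>2 + 1)"
    using y km by (intro add_strict_left_mono mult_strict_right_mono) (auto intro!: add_nonneg_pos add_nonneg_nonneg)
  also have "\<dots> = 1 + e\<^sup>2 * m"
  proof -
    have "2 * k + k\<^sup>2 + 1 > 0" using km by (auto intro!: add_nonneg_pos add_nonneg_nonneg)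
    then show ?thesis by (simp add: \<theta>_def)
  qed
  also have "\<dots> = (1 + e\<^sup>2 * m) powr 1" using e km by (simp add: add_nonneg_nonneg)
  also have "\<dots> \<le> (1 + e\<^sup>2 * m) powr q" using q km by (intro powr_mono) auto
  finally have "(A\<^sup>2 * B powr q) * (1 + k * y)\<^sup>2 < (A\<^sup>2 * B powr q) * (1 + e\<^sup>2 * m) powr q"
    using assms by (intro mult_strict_left_mono) auto
  moreover have "(A\<^sup>2 * B powr q) * (1 + k * y)\<^sup>2 = (A + K * y)\<^sup>2 * B powr q"
  proof -
    have "A + K * y = A * (1 + k * y)" using assms by (simp add: k_def field_simps)
    then show ?thesis by (simp add: power_mult_distrib)
  qed
  moreover have "(A\<^sup>2 * B powr q) * (1 + e\<^sup>2 * m) powr q = A\<^sup>2 * (B + e\<^sup>2 * Q) powr q"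
  proof -
    have "B + e\<^sup>2 * Q = B * (1 + e\<^sup>2 * m)" using assms by (simp add: m_def field_simps)
    then show ?thesis by (simp add: powr_mult)
  qed
  ultimately have "(A + K * y)\<^sup>2 * B powr q < A\<^sup>2 * (B + e\<^sup>2 * Q) powr q" by simp
  then show ?thesis using e unfolding y_def by blast
qed

lemma potential_swap:
  assumes "w \<in> Lq_pair q"
  shows "potential (snd w, fst w) = potential w"
  unfolding potential_def
proof (rule integral_cong_AE)
  have w': "(snd w, fst w) \<in> Lq_pair q" using assms by (auto simp: Lq_pair_def)
  show "(\<lambda>x. h_nl a b p x (fst (snd w, fst w) x) (snd (snd w, fst w) x)) \<in> borel_measurable lborel"
    using potential_bounds(1)[OF w'] by auto
  show "(\<lambda>x. h_nl a b p x (fst w x) (snd w x)) \<in> borel_measurable lborel"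
    using potential_bounds(1)[OF assms] by auto
  show "AE x in lborel. h_nl a b p x (fst (snd w, fst w) x) (snd (snd w, fst w) x) = h_nl a b p x (fst w x) (snd w x)"
    using nonlinearity_AE by eventually_elim (simp add: nonlinearity.h_sym)
qed

text \<open>Perturbing a semitrivial pair by a small multiple of the indicator of a set on which the nonzero component
  stays away from \<open>0\<close> costs \<open>e\<^bsup>p/(p-2)\<^esup> = o(e\<^sup>2)\<close> in the potential and gains \<open>e\<^sup>2\<close> in the quadratic form.\<close>

lemma perturbation_of_semitrivial:
  fixes u v :: "real ^ 'n \<Rightarrow> real"
  assumes N: "CARD('n) \<ge> 2" and l: "l > 0" and p4: "p < 4" and b0: "b0 > 0" "AE x in lborel. b0 \<le> b x"
    and T: "conv_extension p (Psi l :: real ^ 'n \<Rightarrow> real) T"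
    and u: "u \<in> Lq q" and v: "v \<in> Lq q" "AE x in lborel. v x = 0" and A: "potential (u, v) > 0" and B: "B > 0"
  shows "\<exists>g\<in>Lq q. form l g > 0 \<and> (potential (u, g))\<^sup>2 * B powr q < (potential (u, v))\<^sup>2 * (B + form l g) powr q"
proof -
  have [measurable]: "u \<in> borel_measurable borel" "v \<in> borel_measurable borel" using LqD u v by auto
  have uv: "(u, v) \<in> Lq_pair q" using u v by (simp add: Lq_pair_def)
  \<comment> \<open>If every level set were null, u would vanish almost everywhere and the potential
    would be 0; so |u| is bounded away from 0 on some set of positive measure.\<close>
  have "\<exists>n::nat. emeasure lborel {x. \<bar>u x\<bar> \<ge> 1 / real (Suc n)} > 0"
  proof (rule ccontr)
    assume "\<not> ?thesis"
    then have "AE x in lborel. \<not> \<bar>u x\<bar> \<ge> 1 / real (Suc n)" for n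
      by (subst AE_iff_measurable[OF _ refl]) auto
    then have "AE x in lborel. \<forall>n. \<not> \<bar>u x\<bar> \<ge> 1 / real (Suc n)" by (simp add: AE_all_countable)
    then have "AE x in lborel. h_nl a b p x (u x) (v x) = 0"
      using nonlinearity_AE v(2)
    proof eventually_elim
      case (elim x)
      interpret nonlinearity a b p x by fact
      have "u x = 0"
      proof (rule ccontr)
        assume "u x \<noteq> 0"
        then obtain n where "inverse (real (Suc n)) < \<bar>u x\<bar>" using reals_Archimedean[of "\<bar>u x\<bar>"] by auto
        then show False using elim(1) by (metis inverse_eq_divide less_imp_le)
      qed
      then show ?case using elim(3) h_zero_right[of 0] by simp
    qed
    then have "potential (u, v) = 0" unfolding potential_def by (intro integral_eq_zero_AE) simp
    then show False using A by simp
  qed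
  then obtain \<eta> where \<eta>: "\<eta> > 0" "emeasure lborel {x. \<bar>u x\<bar> \<ge> \<eta>} > 0"
    by (metis of_nat_0_less_iff zero_less_Suc zero_less_divide_1_iff)
  have p1: "p > 1" using p by simp
  obtain E where E: "E \<subseteq> {x. \<bar>u x\<bar> \<ge> \<eta>}" "E \<in> sets borel" "emeasure lborel E < \<infinity>"
    and pos: "(LINT x|lborel. indicator E x * Psi_op p l (indicator E) x) > 0"
    using local_positivity[OF N l p1 Psi_op_extension[OF T] _ \<eta>(2)] by auto
  have [measurable]: "E \<in> sets borel" by fact
  define Q where "Q = form l (indicator E)"
  have Q: "Q > 0" using pos by (simp add: Q_def form_def)
  have EL: "indicator E \<in> Lq q" by (rule Lq_indicator[OF E(2,3)])
  obtain \<tau> K where \<tau>: "\<tau> > 0" and K: "K \<ge> 0" and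
    h: "\<And>a b (x :: real ^ 'n) s' t'. a0 \<le> a x \<Longrightarrow> a x \<le> a1 \<Longrightarrow> b0 \<le> b x \<Longrightarrow> \<eta> \<le> \<bar>s'\<bar> \<Longrightarrow> \<bar>t'\<bar> \<le> \<tau>
    \<Longrightarrow> h_nl a b p x s' t' \<le> h_nl a b p x s' 0 + K * \<bar>t'\<bar> powr (p / (p - 2))"
    using h_perturbation[OF p p4 a0 a0_le_a1 b0(1) \<eta>(1)] by metis
  define K' where "K' = K * measure lborel E"
  have K': "K' \<ge> 0" using K by (simp add: K'_def)
  define r where "r = p / (p - 2)"
  have r: "r > 2" using p p4 by (simp add: r_def field_simps)
  obtain e where e: "0 < e" "e \<le> \<tau>" and
    lt: "(potential (u, v) + K' * e powr r)\<^sup>2 * B powr q < (potential (u, v))\<^sup>2 * (B + e\<^sup>2 * Q) powr q"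
    using small_perturbation[OF A B K' Q \<tau> r] by blast
  define g where "g x = e * indicator E x" for x
  have gL: "g \<in> Lq q" unfolding g_def[abs_def] by (rule Lq_scale[OF EL])
  have ug: "(u, g) \<in> Lq_pair q" using u gL by (simp add: Lq_pair_def)
  have fg: "form l g = e\<^sup>2 * Q" unfolding g_def[abs_def] Q_def by (rule form_scale[OF EL])
  have Eint: "integrable lborel (indicator E :: _ \<Rightarrow> real)" using E by (intro integrable_real_indicator) auto
  have "potential (u, g) \<le> (LINT x|lborel. h_nl a b p x (u x) (v x) + K * e powr r * indicator E x)"
    unfolding potential_def
  proof (rule integral_mono_AE)
    show "integrable lborel (\<lambda>x. h_nl a b p x (fst (u, g) x) (snd (u, g) x))" by (rule potential_bounds(1)[OF ug])
    show "integrable lborel (\<lambda>x. h_nl a b p x (u x) (v x) + K * e powr r * indicator E x)"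
      using potential_bounds(1)[OF uv] Eint by simp
    show "AE x in lborel. h_nl a b p x (fst (u, g) x) (snd (u, g) x) \<le> h_nl a b p x (u x) (v x) + K * e powr r * indicator E x"
      using a_bounds b0(2) v(2)
    proof eventually_elim
      case (elim x)
      show ?case
      proof (cases "x \<in> E")
        case True
        then have "\<eta> \<le> \<bar>u x\<bar>" using E(1) by auto
        then show ?thesis using h[of a x b "u x" e] elim e True by (simp add: g_def r_def)
      next
        case False
        then show ?thesis using elim by (simp add: g_def)
      qed
    qed
  qed
  also have "\<dots> = potential (u, v) + K' * e powr r"
    using potential_bounds(1)[OF uv] Eint by (simp add: potential_def K'_def)
  finally have "(potential (u, g))\<^sup>2 * B powr q \<le> (potential (u, v) + K' * e powr r)\<^sup>2 * B powr q"
    using potential_nonneg[OF ug] by (intro mult_right_mono power_mono) auto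
  then have "(potential (u, g))\<^sup>2 * B powr q < (potential (u, v))\<^sup>2 * (B + form l g) powr q"
    using lt by (simp add: fg)
  moreover have "form l g > 0" using e Q by (simp add: fg)
  ultimately show ?thesis using gL by blast
qed

text \<open>The perturbation fills the vanishing component, so its form is taken at the frequency of
  that component. If the first component vanishes, \<open>potential_swap\<close> exchanges the
  roles.\<close>

theorem ground_state_fully_nontrivial_less_4:
  assumes N: "CARD('n) \<ge> 2" and p4: "p < 4" and b0: "b0 > 0" "AE x in lborel. b0 \<le> b x"
    and \<mu>: "\<mu> > 0" and \<nu>: "\<nu> > 0" and gs: "dual_ground_state a b p \<mu> \<nu> w"
  shows "fully_nontrivial w"
proof -
  note G = ground_state_comparison[OF gs]
  obtain u v where w: "w = (u, v)" by fastforce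
  have uv: "u \<in> Lq q" "v \<in> Lq q" using G(1) by (auto simp: w Lq_pair_def)
  have B: "form \<mu> u + form \<nu> v = q * potential w" "q * potential w > 0" using G(2,3) q by (auto simp: w)
  have ext: "\<exists>T. conv_extension p (Psi l :: real ^ 'n \<Rightarrow> real) T" if "l > 0" for l
  proof -
    have "form \<mu> u \<noteq> 0 \<or> form \<nu> v \<noteq> 0" using B by auto
    then show ?thesis using form_nontrivial_extension extension_transfer[OF N] \<mu> \<nu> that by metis
  qed
  have False if v0: "AE x in lborel. v x = 0"
  proof -
    obtain T where T: "conv_extension p (Psi \<nu> :: real ^ 'n \<Rightarrow> real) T" using ext[OF \<nu>] by blast
    have f: "form \<mu> u = q * potential w" using B(1) form_zero[OF v0] by simp
    obtain g where g: "g \<in> Lq q" "form \<nu> g > 0"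
      "(potential (u, g))\<^sup>2 * form \<mu> u powr q < (potential (u, v))\<^sup>2 * (form \<mu> u + form \<nu> g) powr q"
      using perturbation_of_semitrivial[OF N \<nu> p4 b0 T uv v0, of "form \<mu> u"] G(2) B f by (auto simp: w)
    have "(u, g) \<in> Lq_pair q" using g uv by (simp add: Lq_pair_def)
    from G(4)[OF this] show False using g B f by (simp add: w)
  qed
  moreover have False if u0: "AE x in lborel. u x = 0"
  proof -
    obtain T where T: "conv_extension p (Psi \<mu> :: real ^ 'n \<Rightarrow> real) T" using ext[OF \<mu>] by blast
    have f: "form \<nu> v = q * potential w" using B(1) form_zero[OF u0] by simp
    have sw: "potential (v, u) = potential w" using potential_swap[OF G(1)] by (simp add: w)
    obtain g where g: "g \<in> Lq q" "form \<mu> g > 0"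
      "(potential (v, g))\<^sup>2 * form \<nu> v powr q < (potential (v, u))\<^sup>2 * (form \<nu> v + form \<mu> g) powr q"
      using perturbation_of_semitrivial[OF N \<mu> p4 b0 T uv(2) uv(1) u0, of "form \<nu> v"] G(2) B f sw by auto
    have vg: "(v, g) \<in> Lq_pair q" "(g, v) \<in> Lq_pair q" using g uv by (auto simp: Lq_pair_def)
    have "potential (g, v) = potential (v, g)" using potential_swap[OF vg(1)] by simp
    then show False using G(4)[OF vg(2)] g B f sw by (simp add: add.commute)
  qed
  ultimately show ?thesis by (auto simp: fully_nontrivial_def w)
qed

end

section \<open>Ground states for exponents at least four\<close>

text \<open>\<open>ess_sup\<close> converts from the extended reals and would send infinite values
  to 0, so finiteness from both sides is established before the bounds are transferred.\<close>

lemma ess_sup_bounds: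
  fixes f :: "'a::euclidean_space \<Rightarrow> real"
  assumes "f \<in> L_infty"
  shows "AE x in lborel. f x \<le> ess_sup f" "AE x in lborel. f x \<le> c \<Longrightarrow> ess_sup f \<le> c"
proof -
  have [measurable]: "f \<in> borel_measurable borel" using assms by (simp add: L_infty_def)
  obtain C where C: "AE x in lborel. \<bar>f x\<bar> \<le> C" using assms by (auto simp: L_infty_def)
  let ?M = "lborel :: 'a measure" and ?e = "esssup lborel (\<lambda>x. ereal (f x))"
  have "?e \<le> ereal C"
    by (rule esssup_I) (use C in \<open>auto elim!: eventually_mono\<close>)
  moreover have "ereal (- C) \<le> ?e"
  proof -
    have "ereal (- C) = esssup ?M (\<lambda>x. ereal (- C))" by (rule esssup_const[symmetric]) simp
    also have "\<dots> \<le> ?e" by (rule esssup_AE_mono) (use C in \<open>auto elim!: eventually_mono\<close>)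
    finally show ?thesis .
  qed
  ultimately have e: "?e = ereal (ess_sup f)" unfolding ess_sup_def by (cases ?e) auto
  have "AE x in lborel. ereal (f x) \<le> ?e" by (rule esssup_AE)
  then show "AE x in lborel. f x \<le> ess_sup f" unfolding e by simp
  assume c: "AE x in lborel. f x \<le> c"
  have "?e \<le> ereal c" by (rule esssup_I) (use c in auto)
  then show "ess_sup f \<le> c" unfolding e by simp
qed

lemma L_infty_uminus: "f \<in> L_infty \<Longrightarrow> (\<lambda>x. - f x) \<in> L_infty"
  by (auto simp: L_infty_def)

lemma ess_inf_bounds:
  fixes f :: "'a::euclidean_space \<Rightarrow> real"
  assumes "f \<in> L_infty"
  shows "AE x in lborel. ess_inf f \<le> f x" "AE x in lborel. c \<le> f x \<Longrightarrow> c \<le> ess_inf f"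
proof -
  have "AE x in lborel. - f x \<le> ess_sup (\<lambda>x. - f x)"
    by (rule ess_sup_bounds(1)[OF L_infty_uminus[OF assms]])
  then show "AE x in lborel. ess_inf f \<le> f x"
    by eventually_elim (simp add: ess_inf_def)
  assume "AE x in lborel. c \<le> f x"
  then have "ess_sup (\<lambda>x. - f x) \<le> - c"
    by (intro ess_sup_bounds(2) L_infty_uminus assms) auto
  then show "c \<le> ess_inf f" by (simp add: ess_inf_def)
qed

section \<open>Best constants and the diagonal competitor for p >= 4\<close>

context dual_problem
begin

lemma form_tendsto:
  fixes g :: "real ^ 'n \<Rightarrow> real"
  assumes G: "\<And>k::nat. G k \<in> Lq q" and g: "g \<in> Lq q" and lim: "(\<lambda>k. Lq_norm q (\<lambda>x. G k x - g x)) \<longlonglongrightarrow> 0"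
  shows "(\<lambda>k. form l (G k)) \<longlonglongrightarrow> form l g"
proof -
  have p0: "p > 0" "p > 1" using p by auto
  have TG: "Psi_op p l (G k) \<in> Lq p" "Psi_op p l g \<in> Lq p" for k using bounded_opD(1)[OF Psi_op_bounded] G g by blast+
  let ?d = "\<lambda>k x. G k x - g x" and ?e = "\<lambda>k x. Psi_op p l (G k) x - Psi_op p l g x"
  have d: "?d k \<in> Lq q" for k by (rule Lq_diff[OF G g q(3)])
  have e: "?e k \<in> Lq p" for k by (rule Lq_diff[OF TG p0(1)])
  have elim: "(\<lambda>k. Lq_norm p (?e k)) \<longlonglongrightarrow> 0"
    by (rule bounded_op_tendsto(1)[OF Psi_op_bounded G g q(3) p0(1) lim])
  have bd: "\<bar>form l (G k) - form l g\<bar> \<le> Lq_norm q (?d k) * Lq_norm p (?e k) + Lq_norm q (?d k) * Lq_norm p (Psi_op p l g) + Lq_norm q g * Lq_norm p (?e k)" for k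
  proof -
    note I = Hoelder(1)[OF p0(2) q(1,4)] and H = Hoelder(2)[OF p0(2) q(1,4)]
    \<comment> \<open>With d = G - g and e = T G - T g, the difference G T G - g T g is d e + d T g
      + g e, an expansion valid without symmetry of T; each term contains a factor tending to 0 in
      norm.\<close>
    have "form l (G k) - form l g = (LINT x|lborel. ?d k x * ?e k x + ?d k x * Psi_op p l g x + g x * ?e k x)"
    proof -
      have "form l (G k) - form l g = (LINT x|lborel. G k x * Psi_op p l (G k) x - g x * Psi_op p l g x)"
        unfolding form_def by (rule Bochner_Integration.integral_diff[symmetric, OF I[OF G TG(1)] I[OF g TG(2)]])
      also have "\<dots> = (LINT x|lborel. ?d k x * ?e k x + ?d k x * Psi_op p l g x + g x * ?e k x)"
        by (rule Bochner_Integration.integral_cong) (simp_all add: algebra_simps)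
      finally show ?thesis .
    qed
    also have "\<dots> = (LINT x|lborel. ?d k x * ?e k x) + (LINT x|lborel. ?d k x * Psi_op p l g x) + (LINT x|lborel. g x * ?e k x)"
      using I[OF d e] I[OF d TG(2)] I[OF g e] by simp
    finally show ?thesis using H[OF d e, of k k] H[OF d TG(2), of k] H[OF g e, of k] by linarith
  qed
  have "(\<lambda>k. Lq_norm q (?d k) * Lq_norm p (?e k) + Lq_norm q (?d k) * Lq_norm p (Psi_op p l g) + Lq_norm q g * Lq_norm p (?e k))
     \<longlonglongrightarrow> 0 * 0 + 0 * Lq_norm p (Psi_op p l g) + Lq_norm q g * 0"
    by (intro tendsto_intros lim elim)
  then have lim0: "(\<lambda>k. Lq_norm q (?d k) * Lq_norm p (?e k) + Lq_norm q (?d k) * Lq_norm p (Psi_op p l g) + Lq_norm q g * Lq_norm p (?e k)) \<longlonglongrightarrow> 0"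
    by simp
  have "(\<lambda>k. form l (G k) - form l g) \<longlonglongrightarrow> 0"
    by (rule Lim_null_comparison[OF _ lim0]) (use bd in auto)
  then show ?thesis by (rule LIM_zero_cancel)
qed

text \<open>S is the supremum of form / norm^2, cut off at 0 by inserting that value. Functions
  within a factor \<kappa> < 1 of S stand in for a maximiser.\<close>

lemma form_near_optimal:
  "\<exists>S\<ge>0. (\<forall>g\<in>Lq q. form l g \<le> S * (Lq_norm q g)\<^sup>2) \<and>
     (S > 0 \<longrightarrow> (\<forall>\<kappa>. 0 < \<kappa> \<and> \<kappa> < 1 \<longrightarrow> (\<exists>v\<in>Lq q. Lq_norm q v > 0 \<and> \<kappa> * S * (Lq_norm q v)\<^sup>2 < form l v)))"
proof -
  obtain C where C: "C > 0" "\<And>g. g \<in> Lq q \<Longrightarrow> \<bar>form l g\<bar> \<le> C * (Lq_norm q g)\<^sup>2"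
    using form_bound[of l] by blast
  define X where "X = (\<lambda>g. form l g / (Lq_norm q g)\<^sup>2) ` {g \<in> Lq q. Lq_norm q g > 0}"
  define S where "S = Sup (insert 0 X)"
  have bdd: "bdd_above (insert 0 X)"
  proof (rule bdd_aboveI)
    fix y assume "y \<in> insert 0 X"
    then show "y \<le> C"
    proof
      assume "y \<in> X"
      then obtain g where g: "g \<in> Lq q" "Lq_norm q g > 0" "y = form l g / (Lq_norm q g)\<^sup>2" by (auto simp: X_def)
      then show "y \<le> C" using C(2)[OF g(1)] by (simp add: pos_divide_le_eq)
    qed (use C(1) in simp)
  qed
  have "S \<ge> 0" unfolding S_def using bdd by (intro cSup_upper) auto
  moreover have "form l g \<le> S * (Lq_norm q g)\<^sup>2" if g: "g \<in> Lq q" for g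
  proof (cases "Lq_norm q g = 0")
    case True
    then show ?thesis using C(2)[OF g] by simp
  next
    case False
    then have n: "Lq_norm q g > 0" using Lq_norm_nonneg[of q g] by linarith
    then have "form l g / (Lq_norm q g)\<^sup>2 \<le> S" unfolding S_def using g bdd by (intro cSup_upper) (auto simp: X_def)
    then show ?thesis using n by (simp add: pos_divide_le_eq)
  qed
  moreover have "\<exists>v\<in>Lq q. Lq_norm q v > 0 \<and> \<kappa> * S * (Lq_norm q v)\<^sup>2 < form l v" if S: "S > 0" and \<kappa>: "0 < \<kappa>" "\<kappa> < 1" for \<kappa>
  proof -
    have "\<kappa> * S < Sup (insert 0 X)" using S \<kappa> by (simp add: S_def[symmetric])
    then obtain y where y: "y \<in> insert 0 X" "\<kappa> * S < y" using less_cSupE[of "\<kappa> * S" "insert 0 X"] by blast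
    have "0 < \<kappa> * S" using S \<kappa> by simp
    with y have "y \<in> X" by auto
    then obtain g where g: "g \<in> Lq q" "Lq_norm q g > 0" "y = form l g / (Lq_norm q g)\<^sup>2" by (auto simp: X_def)
    then have "\<kappa> * S * (Lq_norm q g)\<^sup>2 < form l g" using y(2) by (simp add: pos_less_divide_eq)
    then show ?thesis using g by blast
  qed
  ultimately show ?thesis by blast
qed

text \<open>Testing h with t = 0 gives a bound for every v; it therefore applies to a semitrivial
  pair whose second component is 0 only almost everywhere.\<close>

lemma potential_ge_left:
  assumes w: "(u, v) \<in> Lq_pair q"
  shows "kap p a1 * Lq_norm q u powr q \<le> potential (u, v)"
proof -
  have u: "u \<in> Lq q" using w by (simp add: Lq_pair_def)
  have "kap p a1 * Lq_norm q u powr q = (LINT x|lborel. kap p a1 * \<bar>u x\<bar> powr q)"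
    by (simp add: Lq_norm_powr q)
  also have "\<dots> \<le> potential (u, v)"
    unfolding potential_def
  proof (rule integral_mono_AE[OF _ potential_bounds(1)[OF w]])
    show "integrable lborel (\<lambda>x. kap p a1 * \<bar>u x\<bar> powr q)" using LqD(2)[OF u] by simp
    show "AE x in lborel. kap p a1 * \<bar>u x\<bar> powr q \<le> h_nl a b p x (fst (u, v) x) (snd (u, v) x)"
      using nonlinearity_AE a_bounds
    proof eventually_elim
      case (elim x)
      interpret nonlinearity a b p x by fact
      have "kap p a1 * \<bar>u x\<bar> powr q \<le> kap p (a x) * \<bar>u x\<bar> powr q"
        using elim p a0 by (intro mult_right_mono kap_antimono) auto
      then show ?case using h_ge_left[of "u x" "v x"] by simp
    qed
  qed
  finally show ?thesis .
qed

lemma potential_diagonal_le: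
  assumes v: "v \<in> Lq q" and b0: "0 \<le> b0" "b0 \<le> p - 1" "AE x in lborel. b0 \<le> b x"
  shows "potential (v, v) \<le> 2 * kap p (a0 * (1 + b0)) * Lq_norm q v powr q"
proof -
  have w: "(v, v) \<in> Lq_pair q" using v by (simp add: Lq_pair_def)
  have "potential (v, v) \<le> (LINT x|lborel. 2 * kap p (a0 * (1 + b0)) * \<bar>v x\<bar> powr q)"
    unfolding potential_def
  proof (rule integral_mono_AE[OF potential_bounds(1)[OF w]])
    show "integrable lborel (\<lambda>x. 2 * kap p (a0 * (1 + b0)) * \<bar>v x\<bar> powr q)" using LqD(2)[OF v] by simp
    show "AE x in lborel. h_nl a b p x (fst (v, v) x) (snd (v, v) x) \<le> 2 * kap p (a0 * (1 + b0)) * \<bar>v x\<bar> powr q"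
      using nonlinearity_AE a_bounds b0(3)
    proof eventually_elim
      case (elim x)
      interpret nonlinearity a b p x by fact
      show ?case using h_diagonal[of a0 b0 "v x"] elim a0 b0 by simp
    qed
  qed
  also have "\<dots> = 2 * kap p (a0 * (1 + b0)) * Lq_norm q v powr q"
    by (simp add: Lq_norm_powr q)
  finally show ?thesis .
qed

text \<open>After scaling out \<open>s = \<surd>l\<close>, the comparison of the semitrivial pair with the diagonal pair built from
  \<open>v0\<close> involves only the best constant \<open>S\<close> for frequency \<open>1\<close> and the bounds of the coefficients.\<close>

lemma diagonal_comparison:
  fixes z v0 :: "real ^ 'n \<Rightarrow> real"
  assumes N: "CARD('n) \<ge> 2" and T: "conv_extension p (Psi 1 :: real ^ 'n \<Rightarrow> real) T"
    and b0: "0 \<le> b0" "b0 \<le> p - 1" "AE x in lborel. b0 \<le> b x"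
    and S: "S > 0" "\<And>g. g \<in> Lq q \<Longrightarrow> form 1 g \<le> S * (Lq_norm q g)\<^sup>2"
    and v0: "v0 \<in> Lq q" "Lq_norm q v0 > 0" and \<kappa>: "0 < \<kappa>" "4 * (kap p (a0 * (1 + b0)))\<^sup>2 < (2 * \<kappa>) powr q * (kap p a1)\<^sup>2"
    and s: "s > 0" and s': "s' > 0"
    and opt: "\<kappa> * S * (Lq_norm q v0)\<^sup>2 < form 1 v0"
      "\<kappa> * S * (Lq_norm q v0)\<^sup>2 < (s / s') ^ (CARD('n) + 2) * form 1 (\<lambda>x. v0 ((s / s') *\<^sub>R x))"
    and z: "z \<in> Lq q" "form (s\<^sup>2) z > 0" and A: "kap p a1 * Lq_norm q z powr q \<le> A"
  shows "\<exists>v\<in>Lq q. form (s\<^sup>2) v + form (s'\<^sup>2) v > 0 \<and>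
     (potential (v, v))\<^sup>2 * form (s\<^sup>2) z powr q < A\<^sup>2 * (form (s\<^sup>2) v + form (s'\<^sup>2) v) powr q"
proof -
  let ?N = "CARD('n)"
  define k1 where "k1 = kap p a1"
  define k2 where "k2 = kap p (a0 * (1 + b0))"
  have k1: "k1 > 0" and k2: "k2 > 0" using p a0 a0_le_a1 b0 by (auto simp: k1_def k2_def intro!: kap_pos)
  define L where "L = S / s ^ (?N + 2)"
  have L: "L > 0" using S s by (simp add: L_def)
  define Z where "Z = Lq_norm q z powr q"
  define V where "V = Lq_norm q v0 powr q"
  have V: "V > 0" using v0 by (simp add: V_def)
  \<comment> \<open>v0 is transported from frequency 1 to s^2. The form of frequency s'^2 then sees
    v0 dilated by s / s', which is close to the identity when the frequencies are close.\<close>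
  define v where "v x = v0 (s *\<^sub>R x)" for x
  have v: "v \<in> Lq q" unfolding v_def[abs_def] by (rule Lq_dilation[OF s v0(1)])
  have vq: "Lq_norm q v powr q = V / s ^ ?N"
    unfolding v_def[abs_def] V_def using Lq_norm_dilation[OF s q(3) v0(1)] by simp
  note FS = form_scaling[OF N _ zero_less_one T, simplified]
  have f1: "form (s\<^sup>2) v = form 1 v0 / s ^ (?N + 2)"
    using FS[OF s v] s by (simp add: v_def[abs_def])
  have f2: "form (s'\<^sup>2) v = (s / s') ^ (?N + 2) * form 1 (\<lambda>x. v0 ((s / s') *\<^sub>R x)) / s ^ (?N + 2)"
    using FS[OF s' v] s s' by (simp add: v_def[abs_def] power_divide)
  have "2 * \<kappa> * L * (Lq_norm q v0)\<^sup>2 = (\<kappa> * S * (Lq_norm q v0)\<^sup>2 + \<kappa> * S * (Lq_norm q v0)\<^sup>2) / s ^ (?N + 2)"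
    by (simp add: L_def)
  also have "\<dots> < form (s\<^sup>2) v + form (s'\<^sup>2) v"
    unfolding f1 f2 add_divide_distrib[symmetric] using s by (intro divide_strict_right_mono add_strict_mono opt) auto
  finally have B': "2 * \<kappa> * L * (Lq_norm q v0)\<^sup>2 < form (s\<^sup>2) v + form (s'\<^sup>2) v" .
  have B'0: "0 < 2 * \<kappa> * L * (Lq_norm q v0)\<^sup>2" using \<kappa> L v0 by simp
  define z1 where "z1 x = z ((1 / s) *\<^sub>R x)" for x
  have s1: "1 / s > 0" using s by simp
  have z1: "z1 \<in> Lq q" unfolding z1_def[abs_def] by (rule Lq_dilation[OF s1 z(1)])
  have z1q: "Lq_norm q z1 powr q = Z * s ^ ?N"
    unfolding z1_def[abs_def] Z_def using Lq_norm_dilation[OF s1 q(3) z(1)] by (simp add: power_divide)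
  have "form (s\<^sup>2) z = form 1 z1 / s ^ (?N + 2)" using FS[OF s z(1)] by (simp add: z1_def[abs_def])
  also have "\<dots> \<le> S * (Lq_norm q z1)\<^sup>2 / s ^ (?N + 2)" using s by (intro divide_right_mono S z1) auto
  finally have Bz: "form (s\<^sup>2) z \<le> L * (Lq_norm q z1)\<^sup>2" by (simp add: L_def)
  have sqq: "(n\<^sup>2) powr q = (n powr q)\<^sup>2" if "n \<ge> 0" for n :: real
    using that by (simp add: power2_eq_square powr_mult)
  have Z: "Z > 0"
  proof (rule ccontr)
    assume "\<not> Z > 0"
    then have "Lq_norm q z1 powr q = 0" using z1q by (simp add: Z_def)
    then have "Lq_norm q z1 = 0" by simp
    then show False using Bz z(2) by simp
  qed
  have "(potential (v, v))\<^sup>2 * form (s\<^sup>2) z powr q \<le> (2 * k2 * (V / s ^ ?N))\<^sup>2 * (L * (Lq_norm q z1)\<^sup>2) powr q"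
  proof (intro mult_mono power_mono powr_mono2)
    show "potential (v, v) \<le> 2 * k2 * (V / s ^ ?N)"
      using potential_diagonal_le[OF v b0] by (simp add: vq k2_def)
    show "0 \<le> potential (v, v)" using v by (intro potential_nonneg) (simp add: Lq_pair_def)
  qed (use q z Bz in auto)
  \<comment> \<open>The powers of s cancel: s^(-2N) from the norm of v against s^(2N) from that of
    z1. Only the constants of the hypothesis on \<kappa> remain to be compared.\<close>
  also have "\<dots> = 4 * k2\<^sup>2 * (V\<^sup>2 * L powr q * Z\<^sup>2)"
    using s by (simp add: powr_mult sqq z1q power_mult_distrib power_divide)
  also have "\<dots> < (2 * \<kappa>) powr q * k1\<^sup>2 * (V\<^sup>2 * L powr q * Z\<^sup>2)"
    using \<kappa>(2) V Z L unfolding k1_def k2_def by (intro mult_strict_right_mono) auto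
  also have "\<dots> = (k1 * Z)\<^sup>2 * (2 * \<kappa> * L * (Lq_norm q v0)\<^sup>2) powr q"
    by (simp add: powr_mult sqq V_def power_mult_distrib)
  also have "\<dots> \<le> A\<^sup>2 * (form (s\<^sup>2) v + form (s'\<^sup>2) v) powr q"
    using A k1 Z q B' B'0 by (intro mult_mono power_mono powr_mono2) (auto simp: k1_def Z_def)
  finally have "(potential (v, v))\<^sup>2 * form (s\<^sup>2) z powr q < A\<^sup>2 * (form (s\<^sup>2) v + form (s'\<^sup>2) v) powr q" .
  moreover have "form (s\<^sup>2) v + form (s'\<^sup>2) v > 0" using B' B'0 by linarith
  ultimately show ?thesis using v by blast
qed

theorem ground_state_fully_nontrivial_ge_4:
  assumes N: "CARD('n) \<ge> 2"
    and b0: "0 \<le> b0" "b0 \<le> p - 1" "AE x in lborel. b0 \<le> b x"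
    and cond: "4 * (kap p (a0 * (1 + b0)))\<^sup>2 < 2 powr q * (kap p a1)\<^sup>2"
  shows "\<exists>\<delta>>0. \<forall>\<mu>>0. \<forall>\<nu>>0. \<bar>sqrt (\<mu> / \<nu>) - 1\<bar> < \<delta> \<longrightarrow> (\<forall>w. dual_ground_state a b p \<mu> \<nu> w \<longrightarrow> fully_nontrivial w)"
proof -
  have gs_form: "form \<mu> (fst w) + form \<nu> (snd w) > 0" if "dual_ground_state a b p \<mu> \<nu> w" for \<mu> \<nu> w
    using ground_state_comparison(2,3)[OF that] q by simp
  have gs_ext: "\<exists>T. conv_extension p (Psi 1 :: real ^ 'n \<Rightarrow> real) T" if "dual_ground_state a b p \<mu> \<nu> w" "\<mu> > 0" "\<nu> > 0" for \<mu> \<nu> w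
  proof -
    have "form \<mu> (fst w) \<noteq> 0 \<or> form \<nu> (snd w) \<noteq> 0" using gs_form[OF that(1)] by auto
    then show ?thesis using form_nontrivial_extension extension_transfer[OF N] that zero_less_one by metis
  qed
  show ?thesis
  proof (cases "\<exists>T. conv_extension p (Psi 1 :: real ^ 'n \<Rightarrow> real) T")
    case False
    then have "\<not> dual_ground_state a b p \<mu> \<nu> w" if "\<mu> > 0" "\<nu> > 0" for \<mu> \<nu> w
      using gs_ext that by blast
    then show ?thesis using zero_less_one by blast
  next
    case True
    then obtain T where T: "conv_extension p (Psi 1 :: real ^ 'n \<Rightarrow> real) T" by blast
    obtain S where S0: "S \<ge> 0" and S: "\<And>g. g \<in> Lq q \<Longrightarrow> form 1 g \<le> S * (Lq_norm q g)\<^sup>2" and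
      opt: "\<And>\<kappa>. S > 0 \<Longrightarrow> 0 < \<kappa> \<Longrightarrow> \<kappa> < 1 \<Longrightarrow> \<exists>v\<in>Lq q. Lq_norm q v > 0 \<and> \<kappa> * S * (Lq_norm q v)\<^sup>2 < form 1 v"
      using form_near_optimal[of 1] by blast
    note FS = form_scaling[OF N _ zero_less_one T, simplified]
    show ?thesis
    proof (cases "S = 0")
      case True
      \<comment> \<open>With best constant 0 no form is positive at any frequency, contrary to B = q
        A > 0; no ground state exists and any \<delta> serves.\<close>
      have le: "form l g \<le> 0" if "l > 0" "g \<in> Lq q" for l g
      proof -
        have "form l g = form 1 (\<lambda>x. g ((1 / sqrt l) *\<^sub>R x)) / sqrt l ^ (CARD('n) + 2)"
          using FS[of "sqrt l" g] that by simp
        moreover have "form 1 (\<lambda>x. g ((1 / sqrt l) *\<^sub>R x)) \<le> 0"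
          using S[OF Lq_dilation[of "1 / sqrt l" g q]] that True by simp
        ultimately show ?thesis using that by (simp add: divide_nonpos_pos)
      qed
      have "\<not> dual_ground_state a b p \<mu> \<nu> w" if "\<mu> > 0" "\<nu> > 0" for \<mu> \<nu> w
      proof
        assume gs: "dual_ground_state a b p \<mu> \<nu> w"
        have "fst w \<in> Lq q" "snd w \<in> Lq q"
          using ground_state_comparison(1)[OF gs] by (auto simp: Lq_pair_def)
        then have "form \<mu> (fst w) \<le> 0" "form \<nu> (snd w) \<le> 0" using le that by blast+
        then show False using gs_form[OF gs] by linarith
      qed
      then show ?thesis using zero_less_one by blast
    next
      case False
      then have Spos: "S > 0" using S0 by simp
      have k1: "kap p a1 > 0" using p a0 a0_le_a1 by (intro kap_pos) auto
      \<comment> \<open>c is the value of \<kappa>^q at which the comparison would become an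
        equality; it is below 1 by \<open>cond\<close>, and \<kappa> is taken halfway between
        c^(1/q) and 1.\<close>
      define c where "c = 4 * (kap p (a0 * (1 + b0)))\<^sup>2 / (kap p a1)\<^sup>2 / 2 powr q"
      have c: "0 \<le> c" "c < 1" using cond k1 by (auto simp: c_def divide_simps mult.commute)
      define t where "t = c powr (1 / q)"
      have t: "0 \<le> t" "t < 1" using c q powr_less_mono2[of "1 / q" c 1] by (auto simp: t_def)
      define \<kappa> where "\<kappa> = (t + 1) / 2"
      have \<kappa>: "0 < \<kappa>" "\<kappa> < 1" "t < \<kappa>" using t by (auto simp: \<kappa>_def)
      have "c = t powr q" using c q by (simp add: t_def powr_powr)
      also have "\<dots> < \<kappa> powr q" using t \<kappa> q by (intro powr_less_mono2) auto
      finally have "4 * (kap p (a0 * (1 + b0)))\<^sup>2 / (kap p a1)\<^sup>2 < \<kappa> powr q * 2 powr q"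
        unfolding c_def by (subst (asm) pos_divide_less_eq) simp_all
      then have \<kappa>2: "4 * (kap p (a0 * (1 + b0)))\<^sup>2 < (2 * \<kappa>) powr q * (kap p a1)\<^sup>2"
        using k1 by (simp add: divide_less_eq powr_mult mult.commute)
      obtain v0 where v0: "v0 \<in> Lq q" "Lq_norm q v0 > 0" and o1: "\<kappa> * S * (Lq_norm q v0)\<^sup>2 < form 1 v0"
        using opt[OF Spos \<kappa>(1,2)] by blast
      define F where "F r = r ^ (CARD('n) + 2) * form 1 (\<lambda>x. v0 (r *\<^sub>R x))" for r :: real
      \<comment> \<open>Continuity of F at r = 1, where F equals \<open>form 1 v0\<close>, argued by
        contradiction along a sequence. The index shift \<open>k + 2\<close> keeps X k >= 1/2, as
        \<open>dilation_tendsto\<close> requires.\<close>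
      have "\<exists>\<delta>>0. \<forall>r. \<bar>r - 1\<bar> < \<delta> \<longrightarrow> \<kappa> * S * (Lq_norm q v0)\<^sup>2 < F r"
      proof (rule ccontr)
        assume neg: "\<not> ?thesis"
        have "\<exists>r. \<bar>r - 1\<bar> < 1 / real (k + 2) \<and> \<not> \<kappa> * S * (Lq_norm q v0)\<^sup>2 < F r" for k
        proof -
          have "1 / real (k + 2) > 0" by simp
          then show ?thesis using neg by blast
        qed
        then obtain X where X: "\<And>k. \<bar>X k - 1\<bar> < 1 / real (k + 2)" "\<And>k. \<not> \<kappa> * S * (Lq_norm q v0)\<^sup>2 < F (X k)" by metis
        have X12: "X k \<ge> 1 / 2" for k
        proof -
          have "1 / real (k + 2) \<le> 1 / 2" by (intro divide_left_mono) auto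
          then show ?thesis using X(1)[of k] by linarith
        qed
        have "(\<lambda>k. X k - 1) \<longlonglongrightarrow> 0"
        proof (rule Lim_null_comparison)
          show "\<forall>\<^sub>F k in sequentially. norm (X k - 1) \<le> 1 / real (k + 2)"
            using X(1) by (auto intro!: always_eventually less_imp_le)
          have "(\<lambda>k. 1 / real k) \<longlonglongrightarrow> 0" by (rule lim_1_over_n)
          then show "(\<lambda>k. 1 / real (k + 2)) \<longlonglongrightarrow> 0" by (rule LIMSEQ_ignore_initial_segment)
        qed
        then have Xlim: "X \<longlonglongrightarrow> 1" by (rule LIM_zero_cancel)
        have "(\<lambda>k. form 1 (\<lambda>x. v0 (X k *\<^sub>R x))) \<longlonglongrightarrow> form 1 v0"
        proof (rule form_tendsto[OF _ v0(1)])
          show "(\<lambda>x. v0 (X k *\<^sub>R x)) \<in> Lq q" for k using X12[of k] by (intro Lq_dilation v0) linarith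
          show "(\<lambda>k. Lq_norm q (\<lambda>x. v0 (X k *\<^sub>R x) - v0 x)) \<longlonglongrightarrow> 0"
            using q by (intro dilation_tendsto v0 Xlim X12) auto
        qed
        then have "(\<lambda>k. F (X k)) \<longlonglongrightarrow> 1 ^ (CARD('n) + 2) * form 1 v0"
          unfolding F_def by (intro tendsto_mult tendsto_power Xlim)
        then have "form 1 v0 \<le> \<kappa> * S * (Lq_norm q v0)\<^sup>2"
          using X(2) by (intro LIMSEQ_le_const2[of "\<lambda>k. F (X k)"]) (auto simp: not_less)
        then show False using o1 by linarith
      qed
      then obtain \<delta> where \<delta>: "\<delta> > 0" "\<And>r. \<bar>r - 1\<bar> < \<delta> \<Longrightarrow> \<kappa> * S * (Lq_norm q v0)\<^sup>2 < F r" by blast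
      \<comment> \<open>With |r - 1| < 1/2 one has |1/r - 1| <= 2 |r - 1| < \<delta>. So F is
        controlled at r and at 1/r, as the two semitrivial cases require.\<close>
      define \<delta>' where "\<delta>' = min (1 / 2) (\<delta> / 2)"
      have "\<delta>' > 0" using \<delta>(1) by (simp add: \<delta>'_def)
      moreover have "fully_nontrivial w" if \<mu>: "\<mu> > 0" and \<nu>: "\<nu> > 0" and close: "\<bar>sqrt (\<mu> / \<nu>) - 1\<bar> < \<delta>'" and gs: "dual_ground_state a b p \<mu> \<nu> w" for \<mu> \<nu> w
      proof -
        note G = ground_state_comparison[OF gs]
        obtain u v where w: "w = (u, v)" by fastforce
        have uv: "u \<in> Lq q" "v \<in> Lq q" using G(1) by (auto simp: w Lq_pair_def)
        define s where "s = sqrt \<mu>"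
        define s' where "s' = sqrt \<nu>"
        have s: "s > 0" "s' > 0" "s\<^sup>2 = \<mu>" "s'\<^sup>2 = \<nu>" using \<mu> \<nu> by (auto simp: s_def s'_def)
        define r where "r = s / s'"
        have r: "\<bar>r - 1\<bar> < \<delta>'" using close by (simp add: r_def s_def s'_def real_sqrt_divide)
        have r1: "\<bar>r - 1\<bar> < \<delta>" using r \<delta>(1) by (simp add: \<delta>'_def)
        have r2: "\<bar>1 / r - 1\<bar> < \<delta>"
        proof -
          have rh: "r > 1 / 2" using r by (auto simp: \<delta>'_def abs_if split: if_splits)
          have "\<bar>1 / r - 1\<bar> = \<bar>r - 1\<bar> / r" using rh by (simp add: abs_if field_simps)
          also have "\<dots> \<le> \<bar>r - 1\<bar> / (1 / 2)" using rh by (intro divide_left_mono) auto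
          also have "\<dots> < \<delta>" using r by (simp add: \<delta>'_def)
          finally show ?thesis .
        qed
        have F1: "\<kappa> * S * (Lq_norm q v0)\<^sup>2 < (s / s') ^ (CARD('n) + 2) * form 1 (\<lambda>x. v0 ((s / s') *\<^sub>R x))"
          using \<delta>(2)[OF r1] by (simp add: F_def r_def)
        have F2: "\<kappa> * S * (Lq_norm q v0)\<^sup>2 < (s' / s) ^ (CARD('n) + 2) * form 1 (\<lambda>x. v0 ((s' / s) *\<^sub>R x))"
          using \<delta>(2)[OF r2] by (simp add: F_def r_def)
        have B: "form \<mu> u + form \<nu> v = q * potential w" "q * potential w > 0" using G(2,3) q by (auto simp: w)
        have False if v0': "AE x in lborel. v x = 0"
        proof -
          have f: "form \<mu> u = q * potential w" using B(1) form_zero[OF v0'] by simp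
          have "kap p a1 * Lq_norm q u powr q \<le> potential w"
            using potential_ge_left[of u v] G(1) by (simp add: w)
          then obtain g where g: "g \<in> Lq q" "form \<mu> g + form \<nu> g > 0"
            "(potential (g, g))\<^sup>2 * form \<mu> u powr q < (potential w)\<^sup>2 * (form \<mu> g + form \<nu> g) powr q"
            using diagonal_comparison[OF N T b0 Spos S v0 \<kappa>(1) \<kappa>2 s(1,2) o1 F1 uv(1)] B f s by auto
          have "(g, g) \<in> Lq_pair q" using g by (simp add: Lq_pair_def)
          from G(4)[OF this] show False using g B f by simp
        qed
        moreover have False if u0: "AE x in lborel. u x = 0"
        proof -
          have f: "form \<nu> v = q * potential w" using B(1) form_zero[OF u0] by simp
          have sw: "potential (v, u) = potential w" using potential_swap[OF G(1)] by (simp add: w)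
          have "kap p a1 * Lq_norm q v powr q \<le> potential w"
            using potential_ge_left[of v u] uv sw by (simp add: Lq_pair_def)
          then obtain g where g: "g \<in> Lq q" "form \<nu> g + form \<mu> g > 0"
            "(potential (g, g))\<^sup>2 * form \<nu> v powr q < (potential w)\<^sup>2 * (form \<nu> g + form \<mu> g) powr q"
            using diagonal_comparison[OF N T b0 Spos S v0 \<kappa>(1) \<kappa>2 s(2,1) o1 F2 uv(2)] B f s by auto
          have "(g, g) \<in> Lq_pair q" using g by (simp add: Lq_pair_def)
          from G(4)[OF this] show False using g B f by (simp add: add.commute)
        qed
        ultimately show ?thesis by (auto simp: fully_nontrivial_def w)
      qed
      ultimately show ?thesis by blast
    qed
  qed
qed

end

theorem theorem2:
  fixes a b :: "real ^ 'n \<Rightarrow> real" and p a0 :: real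
  assumes "CARD('n) \<ge> 2"
    and "2 * (real CARD('n) + 1) / (real CARD('n) - 1) < p"
    and "ereal p < crit_exp CARD('n)"
    and "a \<in> L_infty" and "b \<in> L_infty"
    and "Z_periodic a" and "Z_periodic b"
    and "AE x in lborel. 0 \<le> b x \<and> b x \<le> p - 1"
    and "a0 > 0" and "AE x in lborel. a x \<ge> a0"
  shows "(2 < p \<and> p < 4 \<and> ess_inf b > 0 \<longrightarrow>
            (\<forall>\<mu>>0. \<forall>\<nu>>0. \<forall>w. dual_ground_state a b p \<mu> \<nu> w \<longrightarrow> fully_nontrivial w))
       \<and> (p \<ge> 4 \<and> ess_inf b > ess_sup a / ess_inf a * 2 powr ((p - 2) / 2) - 1 \<longrightarrow>
            (\<exists>\<delta>>0. \<forall>\<mu>>0. \<forall>\<nu>>0. \<bar>sqrt (\<mu> / \<nu>) - 1\<bar> < \<delta> \<longrightarrow>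
               (\<forall>w. dual_ground_state a b p \<mu> \<nu> w \<longrightarrow> fully_nontrivial w)))"
proof -
  have b_ess: "AE x in lborel. ess_inf b \<le> b x" by (rule ess_inf_bounds(1)[OF assms(5)])
  have "a0 \<le> ess_inf a" by (rule ess_inf_bounds(2)[OF assms(4,10)])
  then have a_pos: "ess_inf a > 0" using assms(9) by linarith
  have prob: "dual_problem a b p (ess_inf a) (ess_sup a)" if "2 < p"
  proof
    show "a \<in> borel_measurable borel" "b \<in> borel_measurable borel" using assms(4,5) by (auto simp: L_infty_def)
    show "AE x in lborel. ess_inf a \<le> a x \<and> a x \<le> ess_sup a"
      using ess_inf_bounds(1)[OF assms(4)] ess_sup_bounds(1)[OF assms(4)] by eventually_elim simp
    show "AE x in lborel. 0 \<le> b x" using assms(8) by eventually_elim simp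
  qed (use that a_pos in auto)
  show ?thesis
  proof (intro conjI impI)
    assume "2 < p \<and> p < 4 \<and> ess_inf b > 0"
    then show "\<forall>\<mu>>0. \<forall>\<nu>>0. \<forall>w. dual_ground_state a b p \<mu> \<nu> w \<longrightarrow> fully_nontrivial w"
      using dual_problem.ground_state_fully_nontrivial_less_4[OF prob assms(1) _ _ b_ess] by blast
  next
    assume hyp: "p \<ge> 4 \<and> ess_inf b > ess_sup a / ess_inf a * 2 powr ((p - 2) / 2) - 1"
    then have p2: "p > 2" by linarith
    interpret dual_problem a b p "ess_inf a" "ess_sup a" by (rule prob[OF p2])
    \<comment> \<open>R compares the diagonal coefficient with the supremum of a, and the hypothesis
      says R > 2^((p-2)/2). Raised to the power 2/(p-1) this becomes R^(2/(p-1)) > 2^(2-q), because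
      2 - q = (p-2)/(p-1).\<close>
    define R where "R = ess_inf a * (1 + ess_inf b) / ess_sup a"
    have sup_pos: "ess_sup a > 0" using a_pos a0_le_a1 by linarith
    have "ess_sup a / ess_inf a * 2 powr ((p - 2) / 2) < 1 + ess_inf b" using hyp by linarith
    then have R: "2 powr ((p - 2) / 2) < R"
      using a_pos sup_pos by (simp add: R_def field_simps)
    have Rpos: "R > 0" by (rule less_trans[OF _ R]) simp
    \<comment> \<open>The threshold for b is at least 1 - 1 = 0, since both the quotient of the
      bounds of a and the power of 2 are at least 1.\<close>
    have b0: "0 \<le> ess_inf b"
    proof -
      have "1 * 1 \<le> ess_sup a / ess_inf a * 2 powr ((p - 2) / 2)"
        using a_pos a0_le_a1 p2 by (intro mult_mono ge_one_powr_ge_zero) auto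
      then show ?thesis using hyp by linarith
    qed
    have b1: "ess_inf b \<le> p - 1"
    proof -
      have "AE x in (lborel :: (real ^ 'n) measure). ess_inf b \<le> p - 1"
        using b_ess assms(8) by eventually_elim linarith
      then show ?thesis by (rule AE_lborel_constD)
    qed
    have "4 * (kap p (ess_inf a * (1 + ess_inf b)))\<^sup>2 < 2 powr q * (kap p (ess_sup a))\<^sup>2"
    proof -
      let ?e = "1 / (p - 1)"
      have "2 powr (2 - q) = (2 powr ((p - 2) / 2)) powr (2 * ?e)"
      proof -
        have "2 - q = (p - 2) / 2 * (2 * ?e)" using p2 by (simp add: conj_exp_def divide_simps) (simp add: algebra_simps)
        then show ?thesis by (simp only: powr_powr)
      qed
      also have "\<dots> < R powr (2 * ?e)" using R p2 by (intro powr_less_mono2) auto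
      finally have "2 powr (2 - q) * R powr (- (2 * ?e)) < R powr (2 * ?e) * R powr (- (2 * ?e))"
        using Rpos by (intro mult_strict_right_mono) auto
      also have "R powr (2 * ?e) * R powr (- (2 * ?e)) = 1" using Rpos by (simp flip: powr_add)
      finally have "2 powr q * (2 powr (2 - q) * R powr (- (2 * ?e))) < 2 powr q * 1"
        by (intro mult_strict_left_mono) auto
      moreover have "2 powr q * 2 powr (2 - q) = (4 :: real)" by (simp flip: powr_add)
      ultimately have lt: "4 * R powr (- (2 * ?e)) < 2 powr q" by (metis mult.assoc mult.right_neutral)
      have "ess_inf a * (1 + ess_inf b) = ess_sup a * R" using sup_pos by (simp add: R_def)
      then have "kap p (ess_inf a * (1 + ess_inf b)) = kap p (ess_sup a) * R powr (- ?e)"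
        by (simp add: kap_def powr_mult)
      moreover have "(R powr (- ?e))\<^sup>2 = R powr (- (2 * ?e))"
        by (simp add: power2_eq_square flip: powr_add)
      ultimately have "4 * (kap p (ess_inf a * (1 + ess_inf b)))\<^sup>2 = (kap p (ess_sup a))\<^sup>2 * (4 * R powr (- (2 * ?e)))"
        by (simp add: power_mult_distrib)
      also have "\<dots> < (kap p (ess_sup a))\<^sup>2 * 2 powr q"
        using lt kap_pos[of p "ess_sup a"] p2 sup_pos by (intro mult_strict_left_mono) auto
      finally show ?thesis by (simp add: mult.commute)
    qed
    then show "\<exists>\<delta>>0. \<forall>\<mu>>0. \<forall>\<nu>>0. \<bar>sqrt (\<mu> / \<nu>) - 1\<bar> < \<delta> \<longrightarrow> (\<forall>w. dual_ground_state a b p \<mu> \<nu> w \<longrightarrow> fully_nontrivial w)"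
      using ground_state_fully_nontrivial_ge_4[OF assms(1) b0 b1 b_ess] by blast
  qed
qed

end
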